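(* There exist sufficiently large universal constants $c$ and $Q$ such that the following holds. Let $K\subseteq\mathbb{R}^n$ be star-shaped, $\sigma>0$, $\varepsilon\in(0,1/Q)$, and define $$\delta^*=\sup\Big\{\delta\ge 0:\ N\frac{\delta^2}{\sigma^2}\le \log M^{\mathrm{loc}}(\delta,c)\Big\}.$$ Assume $N\gtrsim \sup_{\delta>0}\log M^{\mathrm{loc}}(\delta,c)$. Then $\mathfrak{M}_{\mathrm{sym}}\asymp \max(\delta^{*2},\varepsilon^2\sigma^2)\wedge d^2$ if $K$ is bounded with diameter $d$, and $\mathfrak{M}_{\mathrm{sym}}\asymp\max(\delta^{*2},\varepsilon^2\sigma^2)$ if $K$ is unbounded.
   Context: Model: fix integers $n,N\ge1$, $\sigma>0$, contamination level $\varepsilon$. The unknown mean $\mu$ lies in a known set $K\subseteq\mathbb{R}^n$. The uncorrupted sample is $\tilde X_i=\mu+\xi_i$, $i=1,\dots,N$, with $\xi_i$ i.i.d. copies of $\xi$ whose distribution belongs to $\Xi^{\mathrm{sym}}_{\sigma^2}$: the family of (sign-)symmetric distributions ($\xi\overset{d}{=}-\xi$) on $\mathbb{R}^n$ with mean zero and covariance $\Sigma\preceq\sigma^2 I$. An adversary $\mathcal{C}$, which may inspect the whole uncorrupted sample and knows the model and estimator, replaces at most a fraction $\varepsilon$ of the points arbitrarily; one observes $X=\mathcal{C}(\tilde X)$. The minimax risk is $$\mathfrak{M}_{\mathrm{sym}}=\inf_{\hat\mu}\sup_{\mu\in K}\sup_{\xi\in\Xi^{\mathrm{sym}}_{\sigma^2}}\sup_{\mathcal{C}}\mathbb{E}_\mu\|\hat\mu(\mathcal{C}(\tilde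 X))-\mu\|^2.$$ Star-shaped: there is $k^*\in K$ with $(1-t)k^*+tk\in K$ for all $k\in K$, $t\in[0,1]$. Diameter $d=\sup_{x,y\in K}\|x-y\|$. Local metric entropy: $M(\eta,A)$ is the maximal cardinality of a subset of $A$ with pairwise Euclidean distances $>\eta$; $M^{\mathrm{loc}}(\eta,c)=\sup_{\nu\in K}M(\eta/c,\ B(\nu,\eta)\cap K)$. $a\wedge b=\min(a,b)$; $\asymp,\gtrsim$ are up to universal multiplicative constants. *)

theory Defs
  imports "HOL-Probability.Probability"
begin

text \<open>Vectors of R^n are represented as functions nat => real that are
  extensional on the index set {..<n}, so that the dimension n can be
  quantified inside the statement (the constants must be uniform in n).\<close>

definition Rn :: "nat \<Rightarrow> (nat \<Rightarrow> real) set" where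
  "Rn n = PiE {..<n} (\<lambda>_. UNIV)"

definition borelRn :: "nat \<Rightarrow> (nat \<Rightarrow> real) measure" where
  "borelRn n = PiM {..<n} (\<lambda>_. borel)"

definition vinner :: "nat \<Rightarrow> (nat \<Rightarrow> real) \<Rightarrow> (nat \<Rightarrow> real) \<Rightarrow> real" where
  "vinner n x y = (\<Sum>i<n. x i * y i)"

definition vnorm :: "nat \<Rightarrow> (nat \<Rightarrow> real) \<Rightarrow> real" where
  "vnorm n x = sqrt (\<Sum>i<n. (x i)^2)"

definition vdist :: "nat \<Rightarrow> (nat \<Rightarrow> real) \<Rightarrow> (nat \<Rightarrow> real) \<Rightarrow> real" where
  "vdist n x y = vnorm n (\<lambda>i. x i - y i)"

definition vadd :: "nat \<Rightarrow> (nat \<Rightarrow> real) \<Rightarrow> (nat \<Rightarrow> real) \<Rightarrow> (nat \<Rightarrow> real)" where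
  "vadd n x y = (\<lambda>i\<in>{..<n}. x i + y i)"

definition vneg :: "nat \<Rightarrow> (nat \<Rightarrow> real) \<Rightarrow> (nat \<Rightarrow> real)" where
  "vneg n x = (\<lambda>i\<in>{..<n}. - x i)"

definition vcball :: "nat \<Rightarrow> (nat \<Rightarrow> real) \<Rightarrow> real \<Rightarrow> (nat \<Rightarrow> real) set" where
  "vcball n \<nu> r = {x \<in> Rn n. vdist n \<nu> x \<le> r}"

definition star_shaped :: "nat \<Rightarrow> (nat \<Rightarrow> real) set \<Rightarrow> bool" where
  "star_shaped n K \<longleftrightarrow> (\<exists>k0\<in>K. \<forall>k\<in>K. \<forall>t\<in>{0..1::real}.
      (\<lambda>i\<in>{..<n}. (1 - t) * k0 i + t * k i) \<in> K)"

definition vbounded :: "nat \<Rightarrow> (nat \<Rightarrow> real) set \<Rightarrow> bool" where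
  "vbounded n K \<longleftrightarrow> (\<exists>B. \<forall>x\<in>K. \<forall>y\<in>K. vdist n x y \<le> B)"

definition diam :: "nat \<Rightarrow> (nat \<Rightarrow> real) set \<Rightarrow> real" where
  "diam n K = Sup {vdist n x y | x y. x \<in> K \<and> y \<in> K}"

definition packing :: "nat \<Rightarrow> real \<Rightarrow> (nat \<Rightarrow> real) set \<Rightarrow> ereal" where
  "packing n \<eta> A = (SUP S \<in> {S. finite S \<and> S \<subseteq> A \<and>
       (\<forall>x\<in>S. \<forall>y\<in>S. x \<noteq> y \<longrightarrow> vdist n x y > \<eta>)}. ereal (real (card S)))"

definition Mloc :: "nat \<Rightarrow> (nat \<Rightarrow> real) set \<Rightarrow> real \<Rightarrow> real \<Rightarrow> ereal" where
  "Mloc n K \<eta> c = (SUP \<nu> \<in> K. packing n (\<eta> / c) (vcball n \<nu> \<eta> \<inter> K))"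

definition eln :: "ereal \<Rightarrow> ereal" where
  "eln x = (if x = \<infinity> then \<infinity> else if x > 0 then ereal (ln (real_of_ereal x)) else - \<infinity>)"

definition delta_star :: "nat \<Rightarrow> (nat \<Rightarrow> real) set \<Rightarrow> real \<Rightarrow> nat \<Rightarrow> real \<Rightarrow> real" where
  "delta_star n K c N \<sigma> =
     Sup {\<delta>. \<delta> \<ge> 0 \<and> ereal (real N * \<delta>^2 / \<sigma>^2) \<le> eln (Mloc n K \<delta> c)}"

text \<open>Symmetric distributions on R^n with mean zero and covariance \<preceq> sigma^2 I.
  For mean-zero xi, u^T Cov(xi) u = E[(u . xi)^2].\<close>
definition Xi_sym :: "nat \<Rightarrow> real \<Rightarrow> (nat \<Rightarrow> real) measure set" where
  "Xi_sym n \<sigma> = {P. prob_space P \<and> sets P = sets (borelRn n) \<and>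
      distr P (borelRn n) (vneg n) = P \<and>
      integrable P (\<lambda>x. (vnorm n x)^2) \<and>
      (\<forall>i<n. (\<integral>x. x i \<partial>P) = 0) \<and>
      (\<forall>u\<in>Rn n. (\<integral>x. (vinner n u x)^2 \<partial>P) \<le> \<sigma>^2 * (\<Sum>i<n. (u i)^2))}"

definition sample_space :: "nat \<Rightarrow> nat \<Rightarrow> (nat \<Rightarrow> nat \<Rightarrow> real) measure" where
  "sample_space n N = PiM {..<N} (\<lambda>_. borelRn n)"

definition estimators :: "nat \<Rightarrow> nat \<Rightarrow> ((nat \<Rightarrow> nat \<Rightarrow> real) \<Rightarrow> (nat \<Rightarrow> real)) set" where
  "estimators n N = sample_space n N \<rightarrow>\<^sub>M borelRn n"

definition adversaries :: "nat \<Rightarrow> nat \<Rightarrow> real \<Rightarrow>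
    ((nat \<Rightarrow> nat \<Rightarrow> real) \<Rightarrow> (nat \<Rightarrow> nat \<Rightarrow> real)) set" where
  "adversaries n N \<epsilon> = {C \<in> sample_space n N \<rightarrow>\<^sub>M sample_space n N.
      \<forall>x \<in> space (sample_space n N). real (card {i\<in>{..<N}. C x i \<noteq> x i}) \<le> \<epsilon> * real N}"

definition risk :: "nat \<Rightarrow> nat \<Rightarrow> ((nat \<Rightarrow> nat \<Rightarrow> real) \<Rightarrow> (nat \<Rightarrow> real)) \<Rightarrow> (nat \<Rightarrow> real) \<Rightarrow>
    (nat \<Rightarrow> real) measure \<Rightarrow> ((nat \<Rightarrow> nat \<Rightarrow> real) \<Rightarrow> (nat \<Rightarrow> nat \<Rightarrow> real)) \<Rightarrow> ennreal" where
  "risk n N est \<mu> P C =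
     (\<integral>\<^sup>+ \<xi>. ennreal ((vdist n (est (C (\<lambda>i\<in>{..<N}. vadd n \<mu> (\<xi> i)))) \<mu>)^2)
        \<partial>(PiM {..<N} (\<lambda>_. P)))"

definition minimax_sym :: "nat \<Rightarrow> nat \<Rightarrow> (nat \<Rightarrow> real) set \<Rightarrow> real \<Rightarrow> real \<Rightarrow> ennreal" where
  "minimax_sym n N K \<sigma> \<epsilon> =
     (INF est \<in> estimators n N. SUP \<mu> \<in> K. SUP P \<in> Xi_sym n \<sigma>. SUP C \<in> adversaries n N \<epsilon>.
        risk n N est \<mu> P C)"

end

theory Submission
  imports Defs
begin

text \<open>
  Upper bound. To compare two candidates, project the sample onto the line joining them, centre at
  the midpoint, rescale by \<open>\<sigma>\<close>, clip at \<open>\<plusminus> 3\<close> and look at the sign of the sum. For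
  symmetric noise with finite variance clipping creates no bias towards the wrong candidate: at distance
  \<open>u \<sigma>\<close> from the midpoint the mean is at most \<open>-3/4 min u 1\<close>, while an
  \<open>\<epsilon>\<close>-fraction of outliers shifts it by at most \<open>6 \<epsilon>\<close>. So the test is reliable
  down to separation of order \<open>\<epsilon> \<sigma>\<close>, with error probability \<open>(1 + u\<^sup>2) powr (- c N)\<close>: Gaussian
  for small \<open>u\<close>, and for large \<open>u\<close> polynomial with an exponent of order \<open>N\<close>, which is what
  makes unbounded \<open>K\<close> tractable. The estimator runs these tests on a maximal
  \<open>\<eta>\<close>-separated subset of \<open>K\<close>, with \<open>\<eta>\<close> twice the target rate, and picks a point whose
  farthest victorious rival is nearly as close as possible. Star-shapedness makes the
  local entropy nonincreasing in the radius, so the \<open>j\<close>-th dyadic shell, of radius \<open>2 ^ j \<eta>\<close>, contains at most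
  \<open>exp ((j + 2) L)\<close> rivals, \<open>L\<close> being the local entropy at \<open>\<eta>\<close>, and a union bound over shells converges.

  Lower bound. For the entropy part, Gaussian noise and a second-moment bound on likelihood ratios.
  For the contamination part, noise uniform on a segment: the uniform distribution
  is turned into its translate by a deterministic wrap-around of a small fraction of the points, which
  is a legitimate adversary up to a Markov bound on the number of moved points.
\<close>

section \<open>Geometry of separated sets in star-shaped sets\<close>

text \<open>The ratio \<open>c = 20\<close> comes from counting 17 equally spaced points on a
  segment issuing from the star centre: if \<open>K\<close> reaches distance \<open>\<delta>\<close>
  from the centre, its local entropy at scale \<open>\<delta>\<close> is at least
  \<open>ln 17\<close>, and \<open>17 > 4^2\<close> absorbs the factor 4 that the packing lower
  bound demands. The same count puts the critical radius \<open>\<delta>s\<close> at or above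
  \<open>\<sigma> * sqrt (ln 2 / N)\<close>, unless \<open>K\<close> does not reach that far; then
  \<open>\<delta>s\<close> is at least a third of the diameter and a constant estimator suffices.
  The obstacle is unbounded \<open>K\<close> under noise with two moments only: test errors decay
  polynomially in the distance, so shell entropy has to be compared with a logarithm. The hypothesis
  on \<open>N\<close>, with constant 400000, controls the far shells; it also makes every local
  packing number finite and bounds \<open>\<delta>s\<close> by \<open>\<sigma>\<close>. No constant
  is optimised.\<close>

lemma vnorm_L2_set: "vnorm n x = L2_set x {..<n}"
  by (simp add: vnorm_def L2_set_def)

lemma vdist_nonneg [simp]: "0 \<le> vdist n x y"
  by (simp add: vdist_def vnorm_def sum_nonneg)

lemma vdist_same [simp]: "vdist n x x = 0"
  by (simp add: vdist_def vnorm_def)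

lemma vdist_commute: "vdist n x y = vdist n y x"
  by (simp add: vdist_def vnorm_def power2_commute)

lemma vdist_triangle: "vdist n x z \<le> vdist n x y + vdist n y z"
  using L2_set_triangle_ineq[of "\<lambda>i. x i - y i" "\<lambda>i. y i - z i" "{..<n}"]
  by (simp add: vdist_def vnorm_L2_set)

lemma vdist_power2: "(vdist n x y)\<^sup>2 = (\<Sum>i<n. (x i - y i)\<^sup>2)"
  by (simp add: vdist_def vnorm_def sum_nonneg)

lemma vdist_pos:
  assumes "x \<in> Rn n" "y \<in> Rn n" "x \<noteq> y"
  shows "0 < vdist n x y"
proof -
  obtain i where i: "i < n" "x i \<noteq> y i"
    using assms unfolding Rn_def by (metis PiE_ext lessThan_iff)
  have "0 < (x i - y i)\<^sup>2" using i by simp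
  also have "\<dots> \<le> (\<Sum>i<n. (x i - y i)\<^sup>2)"
    using i by (intro member_le_sum) auto
  finally show ?thesis by (simp add: vdist_def vnorm_def)
qed

lemma sum_mult_le_vnorm: "\<bar>\<Sum>i<n. x i * y i\<bar> \<le> vnorm n x * vnorm n y"
proof -
  have "\<bar>\<Sum>i<n. x i * y i\<bar> \<le> (\<Sum>i<n. \<bar>x i\<bar> * \<bar>y i\<bar>)"
    using sum_abs[of "\<lambda>i. x i * y i" "{..<n}"] by (simp add: abs_mult)
  also have "\<dots> \<le> vnorm n x * vnorm n y"
    unfolding vnorm_L2_set by (rule L2_set_mult_ineq)
  finally show ?thesis .
qed

text \<open>The homothety with centre \<open>a\<close> and ratio \<open>t\<close>, written exactly
  as in \<open>star_shaped\<close> so that the two unfold to the same term.\<close>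

definition vcomb :: "nat \<Rightarrow> real \<Rightarrow> (nat \<Rightarrow> real) \<Rightarrow> (nat \<Rightarrow> real) \<Rightarrow> (nat \<Rightarrow> real)" where
  "vcomb n t a x = (\<lambda>i\<in>{..<n}. (1 - t) * a i + t * x i)"

lemma vcomb_in_Rn [simp]: "vcomb n t a x \<in> Rn n"
  by (simp add: vcomb_def Rn_def)

lemma vdist_vcomb: "vdist n (vcomb n t a x) (vcomb n t a y) = \<bar>t\<bar> * vdist n x y"
proof -
  have "vdist n (vcomb n t a x) (vcomb n t a y) = sqrt (\<Sum>i<n. t\<^sup>2 * (x i - y i)\<^sup>2)"
    unfolding vdist_def vnorm_def
    by (intro arg_cong[where f = sqrt] sum.cong) (auto simp: vcomb_def algebra_simps power2_eq_square)
  also have "\<dots> = \<bar>t\<bar> * vdist n x y"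
    by (simp add: sum_distrib_left[symmetric] real_sqrt_mult vdist_def vnorm_def)
  finally show ?thesis .
qed

lemma vdist_vcomb_segment: "vdist n (vcomb n s a x) (vcomb n t a x) = \<bar>s - t\<bar> * vdist n a x"
proof -
  have "vdist n (vcomb n s a x) (vcomb n t a x) = sqrt (\<Sum>i<n. (s - t)\<^sup>2 * (a i - x i)\<^sup>2)"
    unfolding vdist_def vnorm_def
    by (intro arg_cong[where f = sqrt] sum.cong) (auto simp: vcomb_def algebra_simps power2_eq_square)
  also have "\<dots> = \<bar>s - t\<bar> * vdist n a x"
    by (simp add: sum_distrib_left[symmetric] real_sqrt_mult vdist_def vnorm_def)
  finally show ?thesis .
qed

lemma vcomb_0: "a \<in> Rn n \<Longrightarrow> vcomb n 0 a x = a"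
  by (auto simp: vcomb_def Rn_def PiE_def extensional_def restrict_def)

lemma vdist_vcomb_centre: "vdist n a (vcomb n t a x) = \<bar>t\<bar> * vdist n a x"
proof -
  have "vdist n a (vcomb n t a x) = vdist n (vcomb n 0 a x) (vcomb n t a x)"
    unfolding vdist_def vnorm_def
    by (intro arg_cong[where f = sqrt] sum.cong) (auto simp: vcomb_def)
  then show ?thesis by (simp add: vdist_vcomb_segment)
qed

definition star_centre :: "nat \<Rightarrow> (nat \<Rightarrow> real) set \<Rightarrow> (nat \<Rightarrow> real) \<Rightarrow> bool" where
  "star_centre n K k0 \<longleftrightarrow> k0 \<in> K \<and> (\<forall>k\<in>K. \<forall>t\<in>{0..1}. vcomb n t k0 k \<in> K)"

lemma star_shaped_centre: "star_shaped n K \<longleftrightarrow> (\<exists>k0. star_centre n K k0)"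
  by (auto simp: star_shaped_def star_centre_def vcomb_def)

section \<open>Separated sets and local packing numbers\<close>

definition separated :: "nat \<Rightarrow> real \<Rightarrow> (nat \<Rightarrow> real) set \<Rightarrow> bool" where
  "separated n \<eta> S \<longleftrightarrow> (\<forall>x\<in>S. \<forall>y\<in>S. x \<noteq> y \<longrightarrow> vdist n x y > \<eta>)"

lemma separated_subset: "separated n \<eta> S \<Longrightarrow> T \<subseteq> S \<Longrightarrow> separated n \<eta> T"
  by (auto simp: separated_def)

lemma separated_insert:
  "separated n \<eta> S \<Longrightarrow> \<not> (\<exists>s\<in>S. vdist n s x \<le> \<eta>) \<Longrightarrow> separated n \<eta> (insert x S)"
  by (auto simp: separated_def vdist_commute[of n x] not_le)

lemma card_le_packing:
  "finite S \<Longrightarrow> S \<subseteq> A \<Longrightarrow> separated n \<eta> S \<Longrightarrow> ereal (real (card S)) \<le> packing n \<eta> A"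
  unfolding packing_def separated_def by (intro SUP_upper) auto

lemma card_le_Mloc:
  "finite S \<Longrightarrow> \<nu> \<in> K \<Longrightarrow> S \<subseteq> K \<Longrightarrow> (\<And>x. x \<in> S \<Longrightarrow> x \<in> Rn n \<and> vdist n \<nu> x \<le> \<eta>) \<Longrightarrow>
    separated n (\<eta> / c) S \<Longrightarrow> ereal (real (card S)) \<le> Mloc n K \<eta> c"
  unfolding Mloc_def by (rule SUP_upper2[of \<nu>], assumption, rule card_le_packing) (auto simp: vcball_def)

lemma less_Mloc_obtain:
  assumes "ereal m < Mloc n K \<eta> c"
  obtains \<nu> S where "\<nu> \<in> K" "finite S" "S \<subseteq> K" "S \<subseteq> vcball n \<nu> \<eta>" "separated n (\<eta> / c) S"
    "m < real (card S)"
proof -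
  obtain \<nu> where \<nu>: "\<nu> \<in> K" "ereal m < packing n (\<eta> / c) (vcball n \<nu> \<eta> \<inter> K)"
    using assms unfolding Mloc_def less_SUP_iff by blast
  from \<nu>(2) obtain S where "finite S" "S \<subseteq> vcball n \<nu> \<eta> \<inter> K"
      "\<forall>x\<in>S. \<forall>y\<in>S. x \<noteq> y \<longrightarrow> vdist n x y > \<eta> / c" "m < real (card S)"
    unfolding packing_def less_SUP_iff by auto
  with \<nu> show ?thesis using that[of \<nu> S] by (auto simp: separated_def)
qed

lemma Mloc_le_iff:
  "Mloc n K \<eta> c \<le> u \<longleftrightarrow> (\<forall>\<nu> S. \<nu> \<in> K \<longrightarrow> finite S \<longrightarrow> S \<subseteq> vcball n \<nu> \<eta> \<inter> K \<longrightarrow>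
     separated n (\<eta> / c) S \<longrightarrow> ereal (real (card S)) \<le> u)"
  unfolding Mloc_def packing_def separated_def by (auto simp: SUP_le_iff)

text \<open>Contraction towards \<open>k0\<close> with ratio \<open>\<delta> / \<delta>'\<close>
  stays inside \<open>K\<close> and scales radius and separation alike, so a packing at the larger
  scale becomes an equally large one at the smaller scale.\<close>

lemma Mloc_antimono:
  assumes K: "K \<subseteq> Rn n" "star_centre n K k0" and \<delta>: "0 < \<delta>" "\<delta> \<le> \<delta>'" and c: "c > 0"
  shows "Mloc n K \<delta>' c \<le> Mloc n K \<delta> c"
  unfolding Mloc_le_iff
proof (intro allI impI)
  fix \<nu> S assume \<nu>: "\<nu> \<in> K" and S: "finite S" "S \<subseteq> vcball n \<nu> \<delta>' \<inter> K" "separated n (\<delta>' / c) S"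
  define t where "t = \<delta> / \<delta>'"
  have t: "0 < t" "t \<le> 1" "t * \<delta>' = \<delta>" using \<delta> by (auto simp: t_def)
  let ?f = "vcomb n t k0"
  have inj: "inj_on ?f S"
  proof (rule inj_onI, rule ccontr)
    fix x y assume xy: "x \<in> S" "y \<in> S" "?f x = ?f y" "x \<noteq> y"
    then have "0 < vdist n x y" using S K by (intro vdist_pos) auto
    then show False using vdist_vcomb[of n t k0 x y] xy t by simp
  qed
  have "ereal (real (card (?f ` S))) \<le> Mloc n K \<delta> c"
  proof (rule card_le_Mloc[where \<nu> = "?f \<nu>"])
    show "finite (?f ` S)" using S by simp
    show "?f \<nu> \<in> K" using K(2) \<nu> t by (auto simp: star_centre_def)
    show "?f ` S \<subseteq> K" using K(2) S(2) t by (auto simp: star_centre_def)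
    show "x \<in> Rn n \<and> vdist n (?f \<nu>) x \<le> \<delta>" if "x \<in> ?f ` S" for x
    proof -
      from that obtain z where z: "z \<in> S" "x = ?f z" by auto
      have "t * vdist n \<nu> z \<le> t * \<delta>'"
        using z S(2) t by (intro mult_left_mono) (auto simp: vcball_def)
      then show ?thesis using z t by (simp add: vdist_vcomb)
    qed
    show "separated n (\<delta> / c) (?f ` S)"
      unfolding separated_def
    proof (intro ballI impI)
      fix x y assume "x \<in> ?f ` S" "y \<in> ?f ` S" "x \<noteq> y"
      then obtain z w where z: "z \<in> S" "w \<in> S" "x = ?f z" "y = ?f w" "z \<noteq> w" by auto
      have "\<delta>' / c < vdist n z w" using S(3) z by (auto simp: separated_def)
      then have "t * (\<delta>' / c) < t * vdist n z w" using t by (intro mult_strict_left_mono)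
      then show "\<delta> / c < vdist n x y" using z t by (simp add: vdist_vcomb)
    qed
  qed
  then show "ereal (real (card S)) \<le> Mloc n K \<delta> c" by (simp add: card_image[OF inj])
qed

lemma Mloc_ge_1:
  assumes "K \<subseteq> Rn n" "k \<in> K" "0 \<le> \<delta>"
  shows "1 \<le> Mloc n K \<delta> c"
  using card_le_Mloc[of "{k}" k K n \<delta> c] assms by (auto simp: separated_def one_ereal_def)

text \<open>Seventeen points on the segment from \<open>k0\<close> towards \<open>x\<close>, with
  spacing \<open>\<delta> / 16 > \<delta> / 20\<close>, all lie in the ball of radius
  \<open>\<delta>\<close> around \<open>k0\<close>.\<close>

lemma Mloc_ge_17:
  assumes K: "K \<subseteq> Rn n" "star_centre n K k0" and x: "x \<in> K" "\<delta> \<le> vdist n k0 x" and "0 < \<delta>"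
  shows "17 \<le> Mloc n K \<delta> 20"
proof -
  define l where "l = vdist n k0 x"
  have l: "0 < l" "\<delta> \<le> l" using assms by (auto simp: l_def)
  define p where "p i = vcomb n (real i * (\<delta> / (16 * l))) k0 x" for i
  have dist: "vdist n (p i) (p j) = \<bar>real i - real j\<bar> * (\<delta> / 16)" for i j
  proof -
    have "\<bar>real i * (\<delta> / (16 * l)) - real j * (\<delta> / (16 * l))\<bar> = \<bar>real i - real j\<bar> * (\<delta> / (16 * l))"
      unfolding left_diff_distrib[symmetric] abs_mult using l \<open>0 < \<delta>\<close> by simp
    then show ?thesis using l unfolding p_def vdist_vcomb_segment by (simp add: l_def[symmetric])
  qed
  have sep: "\<delta> / 20 < vdist n (p i) (p j)" if "i \<noteq> j" for i j
  proof -
    have "1 \<le> \<bar>real i - real j\<bar>" using that by linarith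
    then have "1 * (\<delta> / 16) \<le> \<bar>real i - real j\<bar> * (\<delta> / 16)" using \<open>0 < \<delta>\<close> by (intro mult_right_mono) auto
    then show ?thesis using \<open>0 < \<delta>\<close> unfolding dist by linarith
  qed
  have inj: "inj_on p {..16}"
  proof (rule inj_onI, rule ccontr)
    fix i j assume "p i = p j" "i \<noteq> j"
    then show False using sep[of i j] \<open>0 < \<delta>\<close> by simp
  qed
  have pK: "p i \<in> K" if "i \<le> 16" for i
  proof -
    have "real i * \<delta> \<le> 16 * l" using that l \<open>0 < \<delta>\<close> by (intro mult_mono) auto
    then have "real i * (\<delta> / (16 * l)) \<in> {0..1}" using l \<open>0 < \<delta>\<close> by (auto simp: divide_simps)
    then show ?thesis using K(2) x(1) unfolding star_centre_def p_def by blast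
  qed
  have "ereal (real (card (p ` {..16}))) \<le> Mloc n K \<delta> 20"
  proof (rule card_le_Mloc[where \<nu> = k0])
    show "k0 \<in> K" using K(2) by (simp add: star_centre_def)
    then have k0: "k0 = p 0" using K(1) by (auto simp: p_def vcomb_0)
    show "y \<in> Rn n \<and> vdist n k0 y \<le> \<delta>" if "y \<in> p ` {..16}" for y
    proof -
      from that obtain i where i: "i \<le> 16" "y = p i" by auto
      have "real i * (\<delta> / 16) \<le> 16 * (\<delta> / 16)" using i \<open>0 < \<delta>\<close> by (intro mult_right_mono) auto
      then show ?thesis using i unfolding k0 i(2) dist by (simp add: p_def)
    qed
    show "separated n (\<delta> / 20) (p ` {..16})"
      unfolding separated_def using sep by (metis imageE)
  qed (use pK in auto)
  then show ?thesis by (simp add: card_image[OF inj])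
qed

text \<open>A finite set is covered by balls of radius \<open>\<delta> / c\<close> around a maximal separated subset,
  so each halving of the radius costs one factor of the local packing number.\<close>

lemma card_separated_le_power:
  assumes K: "K \<subseteq> Rn n" "star_centre n K k0" and c: "c \<ge> 2" and \<eta>: "0 < \<eta>"
    and m: "Mloc n K \<eta> c \<le> ereal m"
  shows "finite S \<Longrightarrow> \<nu> \<in> K \<Longrightarrow> S \<subseteq> K \<Longrightarrow> separated n \<eta> S \<Longrightarrow>
    (\<And>x. x \<in> S \<Longrightarrow> vdist n \<nu> x \<le> 2 ^ j * \<eta> / 2) \<Longrightarrow> real (card S) \<le> m ^ j"
proof (induction j arbitrary: \<nu> S)
  \<comment> \<open>In a ball of radius \<open>\<eta> / 2\<close> two points are at most
    \<open>\<eta>\<close> apart, so strict separation leaves one point at most.\<close>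
  case 0
  have "x = y" if "x \<in> S" "y \<in> S" for x y
  proof (rule ccontr)
    assume "x \<noteq> y"
    then have "\<eta> < vdist n x y" using 0 that by (auto simp: separated_def)
    moreover have "vdist n x y \<le> \<eta> / 2 + \<eta> / 2"
      using vdist_triangle[of n x y \<nu>] 0(5)[OF that(1)] 0(5)[OF that(2)]
      by (simp add: vdist_commute[of n x \<nu>])
    ultimately show False by simp
  qed
  then have "card S \<le> 1" using 0 by (auto simp: card_le_Suc0_iff_eq)
  then show ?case by simp
next
  case (Suc j)
  \<comment> \<open>\<open>\<delta>\<close> is the radius of the given ball, so the packing number
    at scale \<open>\<delta>\<close> bounds the covering set \<open>T\<close> below;
    \<open>c \<ge> 2\<close> makes the covering radius \<open>\<delta> / c\<close> at most the
    radius of the induction hypothesis.\<close>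
  define \<delta> where "\<delta> = 2 ^ j * \<eta>"
  have \<delta>: "\<eta> \<le> \<delta>" "0 < \<delta>" using \<eta> by (auto simp: \<delta>_def)
  let ?P = "{T. T \<subseteq> S \<and> separated n (\<delta> / c) T}"
  have "finite ?P" using Suc.prems(1) by (auto intro: finite_subset[of _ "Pow S"])
  moreover have "{} \<in> ?P" by (auto simp: separated_def)
  ultimately have "\<exists>T\<in>?P. \<forall>T'\<in>?P. T \<subseteq> T' \<longrightarrow> T = T'"
    by (intro finite_has_maximal) auto
  then obtain T where T: "T \<in> ?P" and max: "\<forall>T'\<in>?P. T \<subseteq> T' \<longrightarrow> T = T'"
    by (rule bexE)
  have finT: "finite T" using T Suc.prems(1) finite_subset by blast
  have "ereal (real (card T)) \<le> Mloc n K \<delta> c"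
    using T Suc.prems K(1) finT by (intro card_le_Mloc[where \<nu> = \<nu>]) (auto simp: \<delta>_def)
  also have "\<dots> \<le> ereal m"
    using order_trans[OF Mloc_antimono[OF K \<eta> \<delta>(1)] m] c by simp
  finally have cardT: "real (card T) \<le> m" by simp
  have cover: "S \<subseteq> (\<Union>t\<in>T. {x \<in> S. vdist n t x \<le> 2 ^ j * \<eta> / 2})"
  proof
    fix x assume x: "x \<in> S"
    have "\<exists>t\<in>T. vdist n t x \<le> \<delta> / c"
    proof (cases "x \<in> T")
      case True then show ?thesis using \<delta> c by (intro bexI[of _ x]) auto
    next
      case False
      then have "\<not> separated n (\<delta> / c) (insert x T)"
        using bspec[OF max, of "insert x T"] T x by auto
      then show ?thesis using T separated_insert[of n "\<delta> / c" T x] by blast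
    qed
    then obtain t where t: "t \<in> T" "vdist n t x \<le> \<delta> / c" by blast
    have "\<delta> / c \<le> \<delta> / 2" using \<delta> c by (intro divide_left_mono) auto
    with t(2) have "vdist n t x \<le> \<delta> / 2" by linarith
    then have "vdist n t x \<le> 2 ^ j * \<eta> / 2" by (simp only: \<delta>_def)
    then show "x \<in> (\<Union>t\<in>T. {x \<in> S. vdist n t x \<le> 2 ^ j * \<eta> / 2})"
      using x t(1) by blast
  qed
  have m0: "0 \<le> m" using cardT by linarith
  have "card S \<le> card (\<Union>t\<in>T. {x \<in> S. vdist n t x \<le> 2 ^ j * \<eta> / 2})"
    using finT Suc.prems(1) by (intro card_mono[OF _ cover]) auto
  also have "\<dots> \<le> (\<Sum>t\<in>T. card {x \<in> S. vdist n t x \<le> 2 ^ j * \<eta> / 2})"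
    by (rule card_UN_le[OF finT])
  finally have "real (card S) \<le> (\<Sum>t\<in>T. real (card {x \<in> S. vdist n t x \<le> 2 ^ j * \<eta> / 2}))"
    unfolding of_nat_sum[symmetric] of_nat_le_iff .
  also have "\<dots> \<le> (\<Sum>t\<in>T. m ^ j)"
  proof (intro sum_mono)
    fix t assume "t \<in> T"
    then show "real (card {x \<in> S. vdist n t x \<le> 2 ^ j * \<eta> / 2}) \<le> m ^ j"
      using Suc.prems(1,3) T separated_subset[OF Suc.prems(4)]
      by (intro Suc.IH[of "{x \<in> S. vdist n t x \<le> 2 ^ j * \<eta> / 2}" t]) (simp_all add: subset_iff)
  qed
  also have "\<dots> \<le> m * m ^ j" using cardT m0 by (simp add: mult_right_mono)
  finally show ?case by simp
qed

text \<open>\<open>G\<close> may be infinite, so the power bound is first applied to its finite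
  subsets; their bounded size rules out an infinite intersection with the ball.\<close>

lemma finite_separated_ball:
  assumes K: "K \<subseteq> Rn n" "star_centre n K k0" and c: "c \<ge> 2" and \<eta>: "0 < \<eta>"
    and m: "Mloc n K \<eta> c \<le> ereal m" and G: "G \<subseteq> K" "separated n \<eta> G" and \<nu>: "\<nu> \<in> K"
  shows "finite {x \<in> G. vdist n \<nu> x \<le> 2 ^ j * \<eta> / 2}"
    and "real (card {x \<in> G. vdist n \<nu> x \<le> 2 ^ j * \<eta> / 2}) \<le> m ^ j"
proof -
  let ?S = "{x \<in> G. vdist n \<nu> x \<le> 2 ^ j * \<eta> / 2}"
  have le: "real (card T) \<le> m ^ j" if "finite T" "T \<subseteq> ?S" for T
    using card_separated_le_power[OF K c \<eta> m that(1) \<nu>, of j] that G separated_subset[OF G(2), of T]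
    by blast
  show fin: "finite ?S"
  proof (rule ccontr)
    assume "infinite ?S"
    from infinite_arbitrarily_large[OF this, of "Suc (nat \<lceil>m ^ j\<rceil>)"]
    obtain T where T: "finite T" "card T = Suc (nat \<lceil>m ^ j\<rceil>)" "T \<subseteq> ?S" by (elim exE conjE)
    show False using le[OF T(1,3)] T(2) by linarith
  qed
  show "real (card ?S) \<le> m ^ j" using le[OF fin] by simp
qed

text \<open>Dyadic balls around \<open>k0\<close> exhaust \<open>G\<close>. Countability is what
  makes the suprema, infima and the selection in the estimator measurable.\<close>

lemma countable_separated:
  assumes K: "K \<subseteq> Rn n" "star_centre n K k0" and c: "c \<ge> 2" and \<eta>: "0 < \<eta>"
    and m: "Mloc n K \<eta> c \<le> ereal m" and G: "G \<subseteq> K" "separated n \<eta> G"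
  shows "countable G"
proof -
  have k0: "k0 \<in> K" using K by (simp add: star_centre_def)
  have "G \<subseteq> (\<Union>j. {x \<in> G. vdist n k0 x \<le> 2 ^ j * \<eta> / 2})"
  proof
    fix x assume x: "x \<in> G"
    obtain j where "2 * vdist n k0 x / \<eta> < 2 ^ j"
      using real_arch_pow[of 2 "2 * vdist n k0 x / \<eta>"] by auto
    then have "vdist n k0 x \<le> 2 ^ j * \<eta> / 2" using \<eta> by (simp add: field_simps)
    then show "x \<in> (\<Union>j. {x \<in> G. vdist n k0 x \<le> 2 ^ j * \<eta> / 2})" using x by auto
  qed
  moreover have "countable \<dots>"
    using finite_separated_ball(1)[OF K c \<eta> m G k0] by (intro countable_UN) (auto intro: countable_finite)
  ultimately show ?thesis by (rule countable_subset)
qed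

text \<open>Maximality gives covering at the same radius as separation. Zorn's lemma is used because
  \<open>K\<close> may be unbounded and the net infinite.\<close>

lemma maximal_separated_net:
  assumes "0 \<le> \<eta>"
  obtains G where "G \<subseteq> K" "separated n \<eta> G" "\<And>x. x \<in> K \<Longrightarrow> \<exists>g\<in>G. vdist n g x \<le> \<eta>"
proof -
  let ?P = "{G. G \<subseteq> K \<and> separated n \<eta> G}"
  have "\<exists>G\<in>?P. \<forall>H\<in>?P. G \<subseteq> H \<longrightarrow> H = G"
  proof (rule subset_Zorn')
    fix C assume C: "subset.chain ?P C"
    have "separated n \<eta> (\<Union>C)"
      unfolding separated_def
    proof (intro ballI impI)
      fix x y assume xy: "x \<in> \<Union>C" "y \<in> \<Union>C" "x \<noteq> y"
      then obtain X Y where XY: "X \<in> C" "Y \<in> C" "x \<in> X" "y \<in> Y" by auto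
      then have "X \<subseteq> Y \<or> Y \<subseteq> X" using C by (auto simp: subset_chain_def)
      moreover have "separated n \<eta> X" "separated n \<eta> Y" using C XY by (auto simp: subset.chain_def)
      ultimately show "\<eta> < vdist n x y" using XY xy(3) by (auto simp: separated_def)
    qed
    then show "\<Union>C \<in> ?P" using C by (auto simp: subset.chain_def)
  qed
  then obtain G where "G \<in> ?P" and max: "\<forall>H\<in>?P. G \<subseteq> H \<longrightarrow> H = G"
    by (rule bexE)
  then have G: "G \<subseteq> K" "separated n \<eta> G" by auto
  have "\<exists>g\<in>G. vdist n g x \<le> \<eta>" if x: "x \<in> K" for x
  proof (cases "x \<in> G")
    case True then show ?thesis using assms by (intro bexI[of _ x]) auto
  next
    case False
    then have "\<not> separated n \<eta> (insert x G)" using bspec[OF max, of "insert x G"] G x by auto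
    then show ?thesis using G separated_insert[of n \<eta> G x] by blast
  qed
  then show ?thesis using G that by blast
qed

section \<open>Clipped sums of symmetric variables\<close>

text \<open>The level is \<open>3 = 2 + 1\<close>: for \<open>\<bar>z\<bar> \<le> 2\<close> and a
  shift of at most 1 nothing is clipped, while \<open>\<bar>z\<bar> > 2\<close> is charged to the
  second moment.\<close>

definition clip :: "real \<Rightarrow> real" where
  "clip x = max (- 3) (min 3 x)"

lemma clip_bounds: "- 3 \<le> clip x" "clip x \<le> 3" "\<bar>clip x\<bar> \<le> 3"
  by (auto simp: clip_def)

lemma clip_mono: "x \<le> y \<Longrightarrow> clip x \<le> clip y"
  by (auto simp: clip_def)

lemma clip_minus: "clip (- x) = - clip x"
  by (auto simp: clip_def max_def min_def)

lemma borel_measurable_clip [measurable]: "clip \<in> borel_measurable borel"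
  unfolding clip_def by measurable

text \<open>By monotonicity \<open>u\<close> may be lowered to \<open>w = min u 1\<close>. For
  \<open>\<bar>z\<bar> \<le> 2\<close> neither term is clipped and the sum is
  \<open>- 2 * w\<close>; otherwise oddness makes the sum nonpositive, while the right-hand side is
  nonnegative since \<open>z^2 / 4 \<ge> 1\<close>.\<close>

lemma clip_symmetrised_le:
  assumes "0 \<le> u"
  shows "clip (z - u) + clip (- z - u) \<le> - 2 * min u 1 * (1 - z\<^sup>2 / 4)"
proof -
  define w where "w = min u 1"
  have w: "0 \<le> w" "w \<le> 1" "w \<le> u" using assms by (auto simp: w_def)
  have "clip (z - u) + clip (- z - u) \<le> clip (z - w) + clip (- z - w)"
    using w by (intro add_mono clip_mono) auto
  also have "\<dots> \<le> - 2 * w * (1 - z\<^sup>2 / 4)"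
  proof (cases "\<bar>z\<bar> \<le> 2")
    case True
    then have "clip (z - w) + clip (- z - w) = - 2 * w" using w by (auto simp: clip_def)
    also have "\<dots> \<le> - 2 * w * (1 - z\<^sup>2 / 4)" using w by (simp add: right_diff_distrib)
    finally show ?thesis .
  next
    case False
    have "clip (z - w) \<le> clip (z + w)" using w by (intro clip_mono) auto
    then have "clip (z - w) + clip (- z - w) \<le> 0" using clip_minus[of "z + w"] by simp
    moreover have "1 \<le> z\<^sup>2 / 4"
      using False abs_le_square_iff[of 2 z] by simp
    then have "0 \<le> - 2 * w * (1 - z\<^sup>2 / 4)" using w by (intro mult_nonpos_nonpos) auto
    ultimately show ?thesis by linarith
  qed
  finally show ?thesis by (simp add: w_def)
qed

text \<open>No lower bound on \<open>y\<close> is imposed. For negative \<open>y\<close> the claim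
  is inverted and follows from the quadratic Taylor lower bound for
  \<open>exp (- y)\<close>.\<close>

lemma exp_le_quadratic:
  fixes y :: real assumes "y \<le> 1" shows "exp y \<le> 1 + y + y\<^sup>2"
proof (cases "0 \<le> y")
  case True then show ?thesis using exp_bound[of y] assms by simp
next
  case False
  define t where "t = - y"
  have t: "0 \<le> t" using False by (simp add: t_def)
  have "1 \<le> (1 - t + t\<^sup>2) * (1 + t + t\<^sup>2 / 2)"
  proof -
    have "(1 - t + t\<^sup>2) * (1 + t + t\<^sup>2 / 2) = 1 + t ^ 2 / 2 + t ^ 3 / 2 + t ^ 4 / 2"
      by (simp add: field_simps power2_eq_square power3_eq_cube power4_eq_xxxx)
    then show ?thesis using t by simp
  qed
  also have "\<dots> \<le> (1 - t + t\<^sup>2) * exp t"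
  proof (rule mult_left_mono)
    show "1 + t + t\<^sup>2 / 2 \<le> exp t" using exp_lower_Taylor_quadratic[OF t] .
    have "0 \<le> (t - 1)\<^sup>2 + t" using t by simp
    also have "(t - 1)\<^sup>2 + t = 1 - t + t\<^sup>2" by (simp add: power2_eq_square algebra_simps)
    finally show "0 \<le> 1 - t + t\<^sup>2" .
  qed
  finally have "exp (- t) \<le> 1 - t + t\<^sup>2"
    by (simp add: exp_minus field_simps)
  then show ?thesis by (simp add: t_def)
qed

text \<open>Markov's inequality for the exponential of the sum, factorised by independence. The
  number \<open>a\<close> is an allowance per sample point, later filled by the outliers; working
  with \<open>nn_integral\<close> avoids integrability conditions.\<close>

lemma chernoff_iid:
  fixes Y :: "'a \<Rightarrow> real"
  assumes P: "prob_space P" and Y[measurable]: "Y \<in> borel_measurable P" and l: "0 \<le> l"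
    and q: "(\<integral>\<^sup>+ x. ennreal (exp (l * (Y x + a))) \<partial>P) \<le> ennreal q"
  shows "emeasure (PiM {..<N} (\<lambda>_. P)) {x \<in> space (PiM {..<N} (\<lambda>_. P)). - (a * real N) \<le> (\<Sum>i<N. Y (x i))}
    \<le> ennreal q ^ N"
proof -
  interpret P: prob_space P by fact
  interpret product_sigma_finite "\<lambda>_::nat. P" ..
  let ?M = "PiM {..<N} (\<lambda>_. P)"
  let ?E = "{x \<in> space ?M. - (a * real N) \<le> (\<Sum>i<N. Y (x i))}"
  have [measurable]: "?E \<in> sets ?M" by measurable
  have "emeasure ?M ?E = (\<integral>\<^sup>+ x. indicator ?E x \<partial>?M)" by simp
  also have "\<dots> \<le> (\<integral>\<^sup>+ x. (\<Prod>i<N. ennreal (exp (l * (Y (x i) + a)))) \<partial>?M)"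
  proof (rule nn_integral_mono)
    fix x
    have "(\<Prod>i<N. ennreal (exp (l * (Y (x i) + a)))) = ennreal (exp (l * ((\<Sum>i<N. Y (x i)) + a * real N)))"
      by (simp add: prod_ennreal exp_sum[symmetric] sum_distrib_left[symmetric] sum.distrib mult.commute)
    moreover have "1 \<le> exp (l * ((\<Sum>i<N. Y (x i)) + a * real N))" if "x \<in> ?E"
      using that l by (simp add: mult_nonneg_nonneg)
    ultimately show "indicator ?E x \<le> (\<Prod>i<N. ennreal (exp (l * (Y (x i) + a))))"
      by (auto simp: indicator_def)
  qed
  also have "\<dots> = (\<Prod>i<N. \<integral>\<^sup>+ x. ennreal (exp (l * (Y x + a))) \<partial>P)"
    by (intro product_nn_integral_prod) auto
  also have "\<dots> \<le> (\<Prod>i<N. ennreal q)" using q by (intro prod_mono_ennreal) auto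
  finally show ?thesis by simp
qed

text \<open>Models the projection of the noise onto the line through two candidates, divided by
  \<open>\<sigma>\<close>.\<close>

locale symmetric_rv = prob_space P for P :: "'a measure" +
  fixes Z :: "'a \<Rightarrow> real"
  assumes measurable_Z [measurable]: "Z \<in> borel_measurable P"
    and symmetric_Z: "distr P borel (\<lambda>x. - Z x) = distr P borel Z"
    and integrable_Z2: "integrable P (\<lambda>x. (Z x)\<^sup>2)"
    and Z2_le_1: "(\<integral>x. (Z x)\<^sup>2 \<partial>P) \<le> 1"
begin

lemma integrable_clip: "f \<in> borel_measurable P \<Longrightarrow> integrable P (\<lambda>x. clip (f x))"
  by (rule integrable_const_bound[of _ 3]) (auto simp: clip_bounds)

text \<open>Symmetry allows \<open>Z\<close> to be averaged with \<open>- Z\<close>, after which the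
  pointwise bound is integrated; the second moment costs a quarter, which leaves
  \<open>3 / 4\<close>.\<close>

lemma expectation_clip_le:
  assumes u: "0 \<le> u"
  shows "(\<integral>x. clip (Z x - u) \<partial>P) \<le> - (3 / 4) * min u 1"
proof -
  define w where "w = min u 1"
  have w: "0 \<le> w" using u by (simp add: w_def)
  have "(\<integral>x. clip (- Z x - u) \<partial>P) = (\<integral>y. clip (y - u) \<partial>distr P borel (\<lambda>x. - Z x))"
    by (subst integral_distr) auto
  also have "\<dots> = (\<integral>x. clip (Z x - u) \<partial>P)"
    unfolding symmetric_Z by (subst integral_distr) auto
  finally have "2 * (\<integral>x. clip (Z x - u) \<partial>P) = (\<integral>x. clip (Z x - u) + clip (- Z x - u) \<partial>P)"
    by (subst Bochner_Integration.integral_add) (auto intro!: integrable_clip)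
  also have "\<dots> \<le> (\<integral>x. - 2 * w * (1 - (Z x)\<^sup>2 / 4) \<partial>P)"
  proof (rule integral_mono)
    show "integrable P (\<lambda>x. clip (Z x - u) + clip (- Z x - u))"
      by (intro Bochner_Integration.integrable_add integrable_clip) auto
    show "integrable P (\<lambda>x. - 2 * w * (1 - (Z x)\<^sup>2 / 4))"
      using integrable_Z2 by simp
  qed (use clip_symmetrised_le[OF u] in \<open>simp add: w_def\<close>)
  also have "\<dots> = - 2 * w * (1 - (\<integral>x. (Z x)\<^sup>2 \<partial>P) / 4)"
    using integrable_Z2 by (simp add: prob_space)
  also have "\<dots> \<le> - 2 * w * (3 / 4)"
    using Z2_le_1 w by (intro mult_left_mono_neg) auto
  finally show ?thesis by (simp add: w_def)
qed

lemma mgf_clip_small: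
  assumes u: "0 \<le> u" and m: "m \<le> - u" and a: "a \<le> min u 1 / 4"
  shows "(\<integral>\<^sup>+ x. ennreal (exp (min u 1 / 36 * (clip (Z x + m) + a))) \<partial>P) \<le> ennreal (exp (- (min u 1)\<^sup>2 / 144))"
proof -
  define w where "w = min u 1"
  have w: "0 \<le> w" "w \<le> 1" using u by (auto simp: w_def)
  \<comment> \<open>The mean is at most \<open>- 3 / 4 * w\<close>, the allowance \<open>a\<close>
    at most \<open>w / 4\<close>, and the squared clipped variable at most 9. So the exponent is at
    most \<open>- l * w / 2 + 9 * l^2\<close>, whose minimiser \<open>w / 36\<close> gives
    \<open>- w^2 / 144\<close>.\<close>
  let ?l = "w / 36"
  have int: "integrable P (\<lambda>x. clip (Z x - u))" by (intro integrable_clip) simp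
  have "(\<integral>\<^sup>+ x. ennreal (exp (?l * (clip (Z x + m) + a))) \<partial>P)
      \<le> (\<integral>\<^sup>+ x. ennreal (exp (?l * a) * (1 + ?l * clip (Z x - u) + 9 * ?l\<^sup>2)) \<partial>P)"
  proof (intro nn_integral_mono ennreal_leI)
    fix x
    let ?y = "clip (Z x - u)"
    have "clip (Z x + m) \<le> ?y" using m by (intro clip_mono) simp
    then have "exp (?l * (clip (Z x + m) + a)) \<le> exp (?l * (?y + a))"
      using w by (simp add: mult_left_mono)
    also have "\<dots> = exp (?l * a) * exp (?l * ?y)" by (simp add: exp_add[symmetric] algebra_simps)
    also have "exp (?l * ?y) \<le> 1 + ?l * ?y + (?l * ?y)\<^sup>2"
    proof (rule exp_le_quadratic)
      have "?l * ?y \<le> 1 / 36 * 3"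
        using w clip_bounds(2)[of "Z x - u"] mult_left_mono[of ?y 3 ?l] by simp
      then show "?l * ?y \<le> 1" by simp
    qed
    also have "(?l * ?y)\<^sup>2 \<le> 9 * ?l\<^sup>2"
    proof -
      have "?y\<^sup>2 \<le> 3\<^sup>2" using clip_bounds(3) abs_le_square_iff[of ?y 3] by simp
      then have "?l\<^sup>2 * ?y\<^sup>2 \<le> ?l\<^sup>2 * 9" by (intro mult_left_mono) auto
      then show ?thesis unfolding power_mult_distrib by (simp only: mult.commute)
    qed
    finally show "exp (?l * (clip (Z x + m) + a)) \<le> exp (?l * a) * (1 + ?l * ?y + 9 * ?l\<^sup>2)"
      by simp
  qed
  also have "\<dots> = ennreal (\<integral>x. exp (?l * a) * (1 + ?l * clip (Z x - u) + 9 * ?l\<^sup>2) \<partial>P)"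
  proof (rule nn_integral_eq_integral)
    show "integrable P (\<lambda>x. exp (?l * a) * (1 + ?l * clip (Z x - u) + 9 * ?l\<^sup>2))" using int by simp
    show "AE x in P. 0 \<le> exp (?l * a) * (1 + ?l * clip (Z x - u) + 9 * ?l\<^sup>2)"
    proof (intro AE_I2 mult_nonneg_nonneg)
      fix x
      have "- (w / 36 * 3) \<le> ?l * clip (Z x - u)"
        using w clip_bounds(1)[of "Z x - u"] mult_left_mono[of "- 3" "clip (Z x - u)" ?l] by simp
      then show "0 \<le> 1 + ?l * clip (Z x - u) + 9 * ?l\<^sup>2"
        using w zero_le_power2[of ?l] by linarith
    qed simp
  qed
  also have "(\<integral>x. exp (?l * a) * (1 + ?l * clip (Z x - u) + 9 * ?l\<^sup>2) \<partial>P)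
      = exp (?l * a) * (1 + ?l * (\<integral>x. clip (Z x - u) \<partial>P) + 9 * ?l\<^sup>2)"
    using int by (simp add: prob_space)
  also have "\<dots> \<le> exp (- w\<^sup>2 / 144)"
  proof -
    have "?l * (\<integral>x. clip (Z x - u) \<partial>P) \<le> ?l * (- (3 / 4) * w)"
      using expectation_clip_le[OF u] w by (intro mult_left_mono) (auto simp: w_def)
    then have "exp (?l * a) * (1 + ?l * (\<integral>x. clip (Z x - u) \<partial>P) + 9 * ?l\<^sup>2)
        \<le> exp (?l * a) * (1 + (?l * (- (3 / 4) * w) + 9 * ?l\<^sup>2))"
      by (intro mult_left_mono) auto
    also have "\<dots> \<le> exp (?l * a) * exp (?l * (- (3 / 4) * w) + 9 * ?l\<^sup>2)"
      by (intro mult_left_mono exp_ge_add_one_self) auto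
    also have "\<dots> = exp (?l * a + (?l * (- (3 / 4) * w) + 9 * ?l\<^sup>2))" by (simp only: exp_add)
    also have "\<dots> \<le> exp (- w\<^sup>2 / 144)"
    proof -
      have "?l * a \<le> ?l * (w / 4)" using a w by (intro mult_left_mono) (auto simp: w_def)
      then show ?thesis by (simp add: power2_eq_square field_simps)
    qed
    finally show ?thesis .
  qed
  finally show ?thesis by (simp add: w_def ennreal_leI)
qed

text \<open>Far from the origin the clipped variable equals \<open>- 3\<close> outside an event of Chebyshev
  probability \<open>1 / t\<^sup>2\<close>; the tilt \<open>exp (3 l) = t\<close> balances the two contributions.\<close>

lemma mgf_clip_large:
  assumes u: "19 \<le> u" and m: "m \<le> - u" and a: "a \<le> 3 / 2" and t: "t = u - 3"
  shows "(\<integral>\<^sup>+ x. ennreal (exp (ln t / 3 * (clip (Z x + m) + a))) \<partial>P) \<le> ennreal (exp (- ln t / 4))"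
proof -
  have t16: "16 \<le> t" using u t by simp
  let ?l = "ln t / 3"
  have l: "0 \<le> ?l" using t16 by simp
  have e: "exp (?l * 3) = t" "exp (- (?l * 3)) = 1 / t" using t16 by (auto simp: exp_minus inverse_eq_divide)
  have "(\<integral>\<^sup>+ x. ennreal (exp (?l * (clip (Z x + m) + a))) \<partial>P)
      \<le> (\<integral>\<^sup>+ x. ennreal (exp (?l * a) * (1 / t + (Z x)\<^sup>2 / t)) \<partial>P)"
  proof (intro nn_integral_mono ennreal_leI)
    fix x
    have "exp (?l * clip (Z x + m)) \<le> 1 / t + (Z x)\<^sup>2 / t"
    proof (cases "Z x \<le> t")
      case True
      then have "clip (Z x + m) = - 3" using m t by (auto simp: clip_def)
      then show ?thesis using e t16 by simp
    next
      case False
      have "exp (?l * clip (Z x + m)) \<le> exp (?l * 3)"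
        using l clip_bounds(2) by (simp add: mult_left_mono)
      also have "\<dots> = t\<^sup>2 / t" using e t16 by (simp add: power2_eq_square)
      also have "\<dots> \<le> (Z x)\<^sup>2 / t" using False t16 by (intro divide_right_mono power_mono) auto
      also have "\<dots> \<le> 1 / t + (Z x)\<^sup>2 / t" using t16 by simp
      finally show ?thesis .
    qed
    then have "exp (?l * a) * exp (?l * clip (Z x + m)) \<le> exp (?l * a) * (1 / t + (Z x)\<^sup>2 / t)"
      by (intro mult_left_mono) auto
    then show "exp (?l * (clip (Z x + m) + a)) \<le> exp (?l * a) * (1 / t + (Z x)\<^sup>2 / t)"
      by (simp add: exp_add[symmetric] algebra_simps)
  qed
  also have "\<dots> = ennreal (\<integral>x. exp (?l * a) * (1 / t + (Z x)\<^sup>2 / t) \<partial>P)"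
    using integrable_Z2 t16 by (intro nn_integral_eq_integral) auto
  also have "(\<integral>x. exp (?l * a) * (1 / t + (Z x)\<^sup>2 / t) \<partial>P) = exp (?l * a) * (1 / t + (\<integral>x. (Z x)\<^sup>2 \<partial>P) / t)"
    using integrable_Z2 by (simp add: prob_space)
  also have "\<dots> \<le> exp (?l * (3 / 2)) * (1 / t + 1 / t)"
    using Z2_le_1 t16 a l
    by (intro mult_mono add_mono divide_right_mono add_nonneg_nonneg divide_nonneg_nonneg)
       (auto simp: mult_left_mono)
  also have "\<dots> = 2 * exp (- ln t / 2)"
  proof -
    have "1 / t = exp (- ln t)" using t16 by (simp add: exp_minus inverse_eq_divide)
    then have "exp (?l * (3 / 2)) * (1 / t + 1 / t) = 2 * (exp (?l * (3 / 2)) * exp (- ln t))" by simp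
    also have "\<dots> = 2 * exp (- ln t / 2)" unfolding exp_add[symmetric] by (simp add: field_simps)
    finally show ?thesis .
  qed
  \<comment> \<open>Absorbing the factor 2 needs \<open>t \<ge> 16\<close>, hence the threshold
    \<open>u \<ge> 19 = 16 + 3\<close>.\<close>
  also have "\<dots> \<le> exp (ln t / 4) * exp (- ln t / 2)"
  proof (rule mult_right_mono)
    have "ln 16 \<le> ln t" using t16 by simp
    moreover have "ln (16::real) = 4 * ln 2" using ln_realpow[of 2 4] by simp
    ultimately have "ln 2 \<le> ln t / 4" by simp
    then show "2 \<le> exp (ln t / 4)" by (metis exp_le_cancel_iff exp_ln zero_less_numeral)
  qed simp
  also have "\<dots> = exp (- ln t / 4)" by (simp add: exp_add[symmetric] field_simps)
  finally show ?thesis by (simp add: ennreal_leI)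
qed

text \<open>The constant \<open>52000 \<ge> 144 \<cdot> 19\<^sup>2\<close> stems from the small-deviation bound, which is used up to
  \<open>u = 19\<close>; the large-deviation bound is much better.\<close>

lemma test_error_le:
  assumes u: "0 \<le> u" and m: "m \<le> - u" and a: "a \<le> min u 1 / 4"
  shows "emeasure (PiM {..<N} (\<lambda>_. P))
      {x \<in> space (PiM {..<N} (\<lambda>_. P)). - (a * real N) \<le> (\<Sum>i<N. clip (Z (x i) + m))}
    \<le> ennreal (exp (- ln (1 + u\<^sup>2) / 52000)) ^ N"
proof -
  have "\<exists>l\<ge>0. (\<integral>\<^sup>+ x. ennreal (exp (l * (clip (Z x + m) + a))) \<partial>P) \<le> ennreal (exp (- ln (1 + u\<^sup>2) / 52000))"
  proof (cases "u \<le> 19")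
    case True
    define w where "w = min u 1"
    have w: "0 \<le> w" "u \<le> 19 * w" using u True by (auto simp: w_def)
    have "ln (1 + u\<^sup>2) \<le> u\<^sup>2" by (rule ln_add_one_self_le_self) simp
    also have "\<dots> \<le> (19 * w)\<^sup>2" using u w by (intro power_mono) auto
    also have "\<dots> \<le> 52000 / 144 * w\<^sup>2" by (simp add: power2_eq_square field_simps)
    finally have "exp (- w\<^sup>2 / 144) \<le> exp (- ln (1 + u\<^sup>2) / 52000)" by simp
    then show ?thesis
      using mgf_clip_small[OF u m a] w
      by (intro exI[of _ "w / 36"]) (auto simp: w_def intro: order_trans ennreal_leI)
  next
    case False
    define t where "t = u - 3"
    have t: "16 \<le> t" using False by (simp add: t_def)
    \<comment> \<open>Passing from \<open>ln t\<close> to \<open>ln (1 + u^2)\<close> costs a factor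
      3, harmless because the rate \<open>1 / 4\<close> is far above
      \<open>1 / 52000\<close>.\<close>
    have "1 + u\<^sup>2 \<le> t ^ 3"
    proof -
      have "u \<le> 2 * t" using False by (simp add: t_def)
      then have "u\<^sup>2 \<le> (2 * t)\<^sup>2" using u by (intro power_mono) auto
      moreover have "1 \<le> t\<^sup>2" using t by (simp add: power2_eq_square mult_ge1_I)
      moreover have "5 * t\<^sup>2 \<le> t * t\<^sup>2" using t by (intro mult_right_mono) auto
      ultimately show ?thesis by (simp add: power2_eq_square power3_eq_cube algebra_simps)
    qed
    moreover have "0 < 1 + u\<^sup>2" by (simp add: add_pos_nonneg)
    ultimately have "ln (1 + u\<^sup>2) \<le> ln (t ^ 3)" by (intro ln_mono) auto
    also have "\<dots> = 3 * ln t" using t by (simp add: ln_realpow)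
    also have "\<dots> \<le> 13000 * ln t"
      using t by (intro mult_right_mono ln_ge_zero) auto
    finally have "exp (- ln t / 4) \<le> exp (- ln (1 + u\<^sup>2) / 52000)" by simp
    moreover have "a \<le> 3 / 2" using a by simp
    ultimately show ?thesis
      using mgf_clip_large[of u m a t] False m t
      by (intro exI[of _ "ln t / 3"]) (auto simp: t_def intro: order_trans ennreal_leI)
  qed
  then obtain l where "0 \<le> l"
    "(\<integral>\<^sup>+ x. ennreal (exp (l * (clip (Z x + m) + a))) \<partial>P) \<le> ennreal (exp (- ln (1 + u\<^sup>2) / 52000))" by blast
  then show ?thesis
    using prob_space_axioms by (intro chernoff_iid) auto
qed

end

section \<open>Gaussian noise\<close>

text \<open>Both sides agree on boxes with the product of the image measures. It is applied at two
  levels, to the coordinates of one vector and to the points of a sample.\<close>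

lemma distr_PiM_density:
  fixes P :: "'a measure" and l :: "'i \<Rightarrow> 'a \<Rightarrow> ennreal"
  assumes I: "finite I" and P: "prob_space P"
    and f[measurable]: "\<And>i. f i \<in> measurable P P" and l[measurable]: "\<And>i. l i \<in> borel_measurable P"
    and eq: "\<And>i. distr P P (f i) = density P (l i)"
  shows "distr (PiM I (\<lambda>_. P)) (PiM I (\<lambda>_. P)) (\<lambda>x. \<lambda>i\<in>I. f i (x i))
    = density (PiM I (\<lambda>_. P)) (\<lambda>x. \<Prod>i\<in>I. l i (x i))"
proof -
  interpret P: prob_space P by fact
  interpret P: product_sigma_finite "\<lambda>_::'i. P" ..
  define \<nu> where "\<nu> i = density P (l i)" for i
  have \<nu>: "prob_space (\<nu> i)" for i
    unfolding \<nu>_def eq[symmetric] by (rule P.prob_space_distr) simp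
  interpret \<nu>: product_sigma_finite \<nu>
    using \<nu> by (simp add: product_sigma_finite_def prob_space_imp_sigma_finite)
  have sets_\<nu>: "sets (\<nu> i) = sets P" for i by (simp add: \<nu>_def)
  have [measurable]: "(\<lambda>x. \<lambda>i\<in>I. f i (x i)) \<in> measurable (PiM I (\<lambda>_. P)) (PiM I (\<lambda>_. P))"
    by measurable
  have "distr (PiM I (\<lambda>_. P)) (PiM I (\<lambda>_. P)) (\<lambda>x. \<lambda>i\<in>I. f i (x i)) = PiM I \<nu>"
  proof (rule \<nu>.PiM_eqI[OF I])
    show "sets (distr (PiM I (\<lambda>_. P)) (PiM I (\<lambda>_. P)) (\<lambda>x. \<lambda>i\<in>I. f i (x i))) = sets (PiM I \<nu>)"
      by (simp add: sets_\<nu> cong: sets_PiM_cong)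
    fix A assume "\<And>i. i \<in> I \<Longrightarrow> A i \<in> sets (\<nu> i)"
    then have A: "\<And>i. i \<in> I \<Longrightarrow> A i \<in> sets P" by (simp add: sets_\<nu>)
    have "(\<lambda>x. \<lambda>i\<in>I. f i (x i)) -` PiE I A \<inter> space (PiM I (\<lambda>_. P)) = (\<Pi>\<^sub>E i\<in>I. f i -` A i \<inter> space P)"
      by (auto simp: space_PiM PiE_iff)
    then have "emeasure (distr (PiM I (\<lambda>_. P)) (PiM I (\<lambda>_. P)) (\<lambda>x. \<lambda>i\<in>I. f i (x i))) (PiE I A)
        = emeasure (PiM I (\<lambda>_. P)) (\<Pi>\<^sub>E i\<in>I. f i -` A i \<inter> space P)"
      using A I by (subst emeasure_distr) (auto intro!: sets_PiM_I_finite)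
    also have "\<dots> = (\<Prod>i\<in>I. emeasure P (f i -` A i \<inter> space P))"
      using A I by (intro P.emeasure_PiM) auto
    also have "\<dots> = (\<Prod>i\<in>I. emeasure (\<nu> i) (A i))"
      unfolding \<nu>_def eq[symmetric] using A by (intro prod.cong) (auto simp: emeasure_distr)
    finally show "emeasure (distr (PiM I (\<lambda>_. P)) (PiM I (\<lambda>_. P)) (\<lambda>x. \<lambda>i\<in>I. f i (x i))) (PiE I A)
        = (\<Prod>i\<in>I. emeasure (\<nu> i) (A i))" .
  qed
  also have "\<dots> = density (PiM I (\<lambda>_. P)) (\<lambda>x. \<Prod>i\<in>I. l i (x i))"
  proof (rule \<nu>.PiM_eqI[OF I, symmetric])
    show "sets (density (PiM I (\<lambda>_. P)) (\<lambda>x. \<Prod>i\<in>I. l i (x i))) = sets (PiM I \<nu>)"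
      by (simp add: sets_\<nu> cong: sets_PiM_cong)
    fix A assume "\<And>i. i \<in> I \<Longrightarrow> A i \<in> sets (\<nu> i)"
    then have A: "\<And>i. i \<in> I \<Longrightarrow> A i \<in> sets P" by (simp add: sets_\<nu>)
    then have "emeasure (density (PiM I (\<lambda>_. P)) (\<lambda>x. \<Prod>i\<in>I. l i (x i))) (PiE I A)
        = (\<integral>\<^sup>+ x. (\<Prod>i\<in>I. l i (x i)) * indicator (PiE I A) x \<partial>PiM I (\<lambda>_. P))"
      using I by (subst emeasure_density) (auto intro!: sets_PiM_I_finite)
    also have "\<dots> = (\<integral>\<^sup>+ x. (\<Prod>i\<in>I. l i (x i) * indicator (A i) (x i)) \<partial>PiM I (\<lambda>_. P))"
    proof (rule nn_integral_cong)
      fix x assume x: "x \<in> space (PiM I (\<lambda>_. P))"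
      have "indicator (PiE I A) x = (\<Prod>i\<in>I. indicator (A i) (x i) :: ennreal)"
      proof (cases "x \<in> PiE I A")
        case True
        then show ?thesis by (subst prod.neutral) (auto simp: PiE_iff)
      next
        case False
        then obtain i where i: "i \<in> I" "x i \<notin> A i" using x by (auto simp: space_PiM PiE_iff)
        then have "(\<Prod>i\<in>I. indicator (A i) (x i) :: ennreal) = 0"
          using I by (intro prod_zero) (auto intro!: bexI[of _ i])
        then show ?thesis using False by simp
      qed
      then show "(\<Prod>i\<in>I. l i (x i)) * indicator (PiE I A) x = (\<Prod>i\<in>I. l i (x i) * indicator (A i) (x i))"
        by (simp add: prod.distrib)
    qed
    also have "\<dots> = (\<Prod>i\<in>I. \<integral>\<^sup>+ x. l i x * indicator (A i) x \<partial>P)"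
      using A I by (intro P.product_nn_integral_prod) auto
    also have "\<dots> = (\<Prod>i\<in>I. emeasure (\<nu> i) (A i))"
      unfolding \<nu>_def using A by (intro prod.cong) (auto simp: emeasure_density)
    finally show "emeasure (density (PiM I (\<lambda>_. P)) (\<lambda>x. \<Prod>i\<in>I. l i (x i))) (PiE I A)
        = (\<Prod>i\<in>I. emeasure (\<nu> i) (A i))" .
  qed
  finally show ?thesis .
qed

section \<open>The one-dimensional Gaussian and its translates\<close>

definition gauss :: "real \<Rightarrow> real measure" where
  "gauss \<sigma> = density lborel (\<lambda>x. ennreal (normal_density 0 \<sigma> x))"

lemma sets_gauss [simp, measurable_cong]: "sets (gauss \<sigma>) = sets borel"
  by (simp add: gauss_def)

lemma space_gauss [simp]: "space (gauss \<sigma>) = UNIV"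
  by (simp add: gauss_def)

lemma prob_space_gauss: "0 < \<sigma> \<Longrightarrow> prob_space (gauss \<sigma>)"
  unfolding gauss_def by (rule prob_space_normal_density)

text \<open>The likelihood ratio of the normal law with mean \<open>w\<close> against the centred
  one.\<close>

definition gauss_lr :: "real \<Rightarrow> real \<Rightarrow> real \<Rightarrow> real" where
  "gauss_lr \<sigma> w x = exp (w * x / \<sigma>\<^sup>2 - w\<^sup>2 / (2 * \<sigma>\<^sup>2))"

lemma gauss_lr_pos: "0 < gauss_lr \<sigma> w x"
  by (simp add: gauss_lr_def)

lemma borel_measurable_gauss_lr [measurable]: "gauss_lr \<sigma> w \<in> borel_measurable borel"
  unfolding gauss_lr_def by measurable

lemma borel_measurable_gauss_lr_gauss [simp]:
  "(\<lambda>x. ennreal (gauss_lr \<sigma> w x)) \<in> borel_measurable (gauss \<tau>)"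
  "(\<lambda>x. ennreal (gauss_lr \<sigma> w x) ^ 2) \<in> borel_measurable (gauss \<tau>)"
  by measurable

lemma distr_gauss_shift:
  assumes \<sigma>: "0 < \<sigma>"
  shows "distr (gauss \<sigma>) (gauss \<sigma>) (\<lambda>x. w + x) = density (gauss \<sigma>) (\<lambda>x. ennreal (gauss_lr \<sigma> w x))"
proof (rule measure_eqI)
  fix A assume "A \<in> sets (distr (gauss \<sigma>) (gauss \<sigma>) (\<lambda>x. w + x))"
  then have [measurable]: "A \<in> sets borel" by simp
  have "emeasure (distr (gauss \<sigma>) (gauss \<sigma>) (\<lambda>x. w + x)) A
      = (\<integral>\<^sup>+ x. indicator A x \<partial>distr (gauss \<sigma>) (gauss \<sigma>) (\<lambda>x. w + x))"
    by simp
  also have "\<dots> = (\<integral>\<^sup>+ x. indicator A (w + x) \<partial>gauss \<sigma>)"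
    by (subst nn_integral_distr) auto
  also have "\<dots> = (\<integral>\<^sup>+ x. ennreal (normal_density 0 \<sigma> x) * indicator A (w + x) \<partial>lborel)"
    unfolding gauss_def by (subst nn_integral_density) auto
  also have "\<dots> = (\<integral>\<^sup>+ x. ennreal (normal_density 0 \<sigma> (x - w)) * indicator A x \<partial>lborel)"
    by (subst nn_integral_real_affine[of _ 1 "- w"]) (auto simp: add.commute)
  also have "\<dots> = (\<integral>\<^sup>+ x. ennreal (normal_density 0 \<sigma> x) * (ennreal (gauss_lr \<sigma> w x) * indicator A x) \<partial>lborel)"
  proof (rule nn_integral_cong)
    fix x
    have "normal_density 0 \<sigma> (x - w) = normal_density 0 \<sigma> x * gauss_lr \<sigma> w x"
      unfolding normal_density_def gauss_lr_def mult.assoc exp_add[symmetric]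
      using \<sigma> by (simp add: field_simps power2_eq_square)
    then show "ennreal (normal_density 0 \<sigma> (x - w)) * indicator A x
        = ennreal (normal_density 0 \<sigma> x) * (ennreal (gauss_lr \<sigma> w x) * indicator A x)"
      by (simp add: ennreal_mult gauss_lr_pos less_imp_le mult.assoc)
  qed
  also have "\<dots> = (\<integral>\<^sup>+ x. ennreal (gauss_lr \<sigma> w x) * indicator A x \<partial>gauss \<sigma>)"
    unfolding gauss_def by (subst nn_integral_density) auto
  also have "\<dots> = emeasure (density (gauss \<sigma>) (\<lambda>x. ennreal (gauss_lr \<sigma> w x))) A"
    by (subst emeasure_density) auto
  finally show "emeasure (distr (gauss \<sigma>) (gauss \<sigma>) (\<lambda>x. w + x)) A
    = emeasure (density (gauss \<sigma>) (\<lambda>x. ennreal (gauss_lr \<sigma> w x))) A" .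
qed simp

lemma distr_gauss_uminus: "distr (gauss \<sigma>) (gauss \<sigma>) uminus = gauss \<sigma>"
proof (rule measure_eqI)
  fix A assume "A \<in> sets (distr (gauss \<sigma>) (gauss \<sigma>) uminus)"
  then have [measurable]: "A \<in> sets borel" by simp
  have "emeasure (distr (gauss \<sigma>) (gauss \<sigma>) uminus) A
      = (\<integral>\<^sup>+ x. indicator A x \<partial>distr (gauss \<sigma>) (gauss \<sigma>) uminus)" by simp
  also have "\<dots> = (\<integral>\<^sup>+ x. indicator A (- x) \<partial>gauss \<sigma>)"
    by (subst nn_integral_distr) auto
  also have "\<dots> = (\<integral>\<^sup>+ x. ennreal (normal_density 0 \<sigma> x) * indicator A (- x) \<partial>lborel)"
    unfolding gauss_def by (subst nn_integral_density) auto
  also have "\<dots> = (\<integral>\<^sup>+ x. ennreal (normal_density 0 \<sigma> x) * indicator A x \<partial>lborel)"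
    by (subst nn_integral_real_affine[of _ "- 1" 0]) (auto simp: normal_density_def)
  also have "\<dots> = (\<integral>\<^sup>+ x. indicator A x \<partial>gauss \<sigma>)"
    unfolding gauss_def by (subst nn_integral_density) auto
  finally show "emeasure (distr (gauss \<sigma>) (gauss \<sigma>) uminus) A = emeasure (gauss \<sigma>) A" by simp
qed simp

lemma nn_integral_gauss_lr: 
  assumes "0 < \<sigma>" shows "(\<integral>\<^sup>+ x. ennreal (gauss_lr \<sigma> w x) \<partial>gauss \<sigma>) = 1"
proof -
  interpret prob_space "gauss \<sigma>" by (rule prob_space_gauss) fact
  interpret D: prob_space "distr (gauss \<sigma>) (gauss \<sigma>) (\<lambda>x. w + x)" by (rule prob_space_distr) simp
  have "(\<integral>\<^sup>+ x. ennreal (gauss_lr \<sigma> w x) \<partial>gauss \<sigma>) = emeasure (density (gauss \<sigma>) (\<lambda>x. ennreal (gauss_lr \<sigma> w x))) UNIV"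
    by (subst emeasure_density) auto
  also have "\<dots> = 1" unfolding distr_gauss_shift[OF assms, symmetric] using D.emeasure_space_1 by simp
  finally show ?thesis .
qed

text \<open>The squared ratio for \<open>w\<close> is \<open>exp (w^2 / \<sigma>^2)\<close> times
  the ratio for \<open>2 * w\<close>, and the latter integrates to 1.\<close>

lemma nn_integral_gauss_lr_power2:
  assumes \<sigma>: "0 < \<sigma>" shows "(\<integral>\<^sup>+ x. ennreal (gauss_lr \<sigma> w x) ^ 2 \<partial>gauss \<sigma>) = ennreal (exp (w\<^sup>2 / \<sigma>\<^sup>2))"
proof -
  have "ennreal (gauss_lr \<sigma> w x) ^ 2 = ennreal (exp (w\<^sup>2 / \<sigma>\<^sup>2)) * ennreal (gauss_lr \<sigma> (2 * w) x)" for x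
  proof -
    have "(gauss_lr \<sigma> w x) ^ 2 = exp (w\<^sup>2 / \<sigma>\<^sup>2) * gauss_lr \<sigma> (2 * w) x"
      unfolding gauss_lr_def exp_add[symmetric] exp_double[symmetric]
      using \<sigma> by (simp add: field_simps power2_eq_square)
    then show ?thesis by (simp add: ennreal_power ennreal_mult' gauss_lr_pos less_imp_le flip: ennreal_mult')
  qed
  then show ?thesis
    by (simp add: nn_integral_cmult nn_integral_gauss_lr[OF \<sigma>])
qed

section \<open>Isotropic Gaussian noise in dimension \<open>n\<close>\<close>

definition gaussRn :: "nat \<Rightarrow> real \<Rightarrow> (nat \<Rightarrow> real) measure" where
  "gaussRn n \<sigma> = PiM {..<n} (\<lambda>_. gauss \<sigma>)"

lemma sets_gaussRn [simp, measurable_cong]: "sets (gaussRn n \<sigma>) = sets (borelRn n)"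
  unfolding gaussRn_def borelRn_def by (intro sets_PiM_cong) auto

lemma prob_space_gaussRn: "0 < \<sigma> \<Longrightarrow> prob_space (gaussRn n \<sigma>)"
  unfolding gaussRn_def by (intro prob_space_PiM prob_space_gauss)

lemma space_borelRn [simp]: "space (borelRn n) = Rn n"
  by (simp add: borelRn_def space_PiM Rn_def)

lemma space_gaussRn [simp]: "space (gaussRn n \<sigma>) = Rn n"
  using sets_eq_imp_space_eq[OF sets_gaussRn] by simp

lemma gauss_moments:
  assumes "0 < \<sigma>"
  shows "integrable (gauss \<sigma>) (\<lambda>x. x)" "(\<integral>x. x \<partial>gauss \<sigma>) = 0"
    "integrable (gauss \<sigma>) (\<lambda>x. x * x)" "(\<integral>x. x * x \<partial>gauss \<sigma>) = \<sigma>\<^sup>2"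
proof -
  interpret prob_space "gauss \<sigma>" by (rule prob_space_gauss) fact
  have "integrable lborel (\<lambda>x. normal_density 0 \<sigma> x * x)"
    using integrable_normal_moment[OF assms, of 0 1] by simp
  then show "integrable (gauss \<sigma>) (\<lambda>x. x)"
    unfolding gauss_def by (subst integrable_density) auto
  show "(\<integral>x. x \<partial>gauss \<sigma>) = 0"
    unfolding gauss_def using integral_normal_moment_odd[OF assms, of 0 0]
    by (subst integral_density) auto
  have "integrable lborel (\<lambda>x. normal_density 0 \<sigma> x * (x * x))"
    using integrable_normal_moment[OF assms, of 0 2] by (simp add: power2_eq_square)
  then show "integrable (gauss \<sigma>) (\<lambda>x. x * x)"
    unfolding gauss_def by (subst integrable_density) auto
  show "(\<integral>x. x * x \<partial>gauss \<sigma>) = \<sigma>\<^sup>2"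
    unfolding gauss_def using integral_normal_moment_even[OF assms, of 0 1]
    by (subst integral_density) (auto simp: power2_eq_square)
qed

lemma gaussRn_moment2:
  assumes \<sigma>: "0 < \<sigma>" and ij: "i < n" "j < n"
  shows "integrable (gaussRn n \<sigma>) (\<lambda>x. x i * x j)"
    "(\<integral>x. x i * x j \<partial>gaussRn n \<sigma>) = (if i = j then \<sigma>\<^sup>2 else 0)"
proof -
  interpret g: prob_space "gauss \<sigma>" by (rule prob_space_gauss) fact
  interpret product_sigma_finite "\<lambda>_::nat. gauss \<sigma>" ..
  \<comment> \<open>One formula covers both cases: the factor at index \<open>i\<close> is
    \<open>y * y\<close> when \<open>i = j\<close> and \<open>y\<close> otherwise, and all remaining
    factors are 1.\<close>
  define g where "g k y = (if k = i then y else 1) * (if k = j then y else 1)" for k and y :: real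
  have prod: "x i * x j = (\<Prod>k<n. g k (x k))" for x
    unfolding g_def prod.distrib using ij by simp
  have int: "integrable (gauss \<sigma>) (g k)" for k
    unfolding g_def using gauss_moments[OF \<sigma>] by (cases "k = i"; cases "k = j") auto
  show "integrable (gaussRn n \<sigma>) (\<lambda>x. x i * x j)"
    unfolding prod gaussRn_def by (intro product_integrable_prod int) simp
  have "(\<integral>x. x i * x j \<partial>gaussRn n \<sigma>) = (\<Prod>k<n. \<integral>y. g k y \<partial>gauss \<sigma>)"
    unfolding prod gaussRn_def by (intro product_integral_prod int) simp
  also have "\<dots> = (if i = j then \<sigma>\<^sup>2 else 0)"
  proof (cases "i = j")
    case True
    then have "(\<integral>y. g k y \<partial>gauss \<sigma>) = (if k = i then \<sigma>\<^sup>2 else 1)" for k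
      unfolding g_def using gauss_moments[OF \<sigma>] g.prob_space by (cases "k = i") auto
    then show ?thesis using ij True by simp
  next
    case False
    then have "(\<integral>y. g i y \<partial>gauss \<sigma>) = 0"
      unfolding g_def using gauss_moments[OF \<sigma>] by simp
    then show ?thesis using ij False by (subst prod_zero) auto
  qed
  finally show "(\<integral>x. x i * x j \<partial>gaussRn n \<sigma>) = (if i = j then \<sigma>\<^sup>2 else 0)" .
qed

lemma gaussRn_in_Xi_sym:
  assumes \<sigma>: "0 < \<sigma>" shows "gaussRn n \<sigma> \<in> Xi_sym n \<sigma>"
proof -
  interpret g: prob_space "gauss \<sigma>" by (rule prob_space_gauss) fact
  have "distr (gaussRn n \<sigma>) (borelRn n) (vneg n) = distr (gaussRn n \<sigma>) (gaussRn n \<sigma>) (\<lambda>x. \<lambda>i\<in>{..<n}. - x i)"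
    by (rule distr_cong) (auto simp: vneg_def)
  \<comment> \<open>Negation preserves each Gaussian factor, so the product lemma applies with all
    densities constantly 1.\<close>
  also have "\<dots> = density (gaussRn n \<sigma>) (\<lambda>x. \<Prod>i<n. 1)"
    unfolding gaussRn_def
    by (rule distr_PiM_density[OF _ g.prob_space_axioms]) (auto simp: distr_gauss_uminus density_1)
  finally have sym: "distr (gaussRn n \<sigma>) (borelRn n) (vneg n) = gaussRn n \<sigma>" by (simp add: density_1)
  have sq: "integrable (gaussRn n \<sigma>) (\<lambda>x. (vnorm n x)\<^sup>2)"
    using gaussRn_moment2(1)[OF \<sigma>]
    by (simp add: vnorm_def sum_nonneg) (auto simp: power2_eq_square intro!: Bochner_Integration.integrable_sum)
  have mean: "(\<integral>x. x i \<partial>gaussRn n \<sigma>) = 0" if "i < n" for i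
  proof -
    have "(\<integral>x. x i \<partial>gaussRn n \<sigma>) = (\<integral>y. y \<partial>distr (gaussRn n \<sigma>) (gauss \<sigma>) (\<lambda>x. x i))"
      unfolding gaussRn_def using that by (subst integral_distr) auto
    also have "distr (gaussRn n \<sigma>) (gauss \<sigma>) (\<lambda>x. x i) = gauss \<sigma>"
      unfolding gaussRn_def using that g.prob_space_axioms by (subst distr_PiM_component) auto
    finally show ?thesis using gauss_moments[OF \<sigma>] by simp
  qed
  have cov: "(\<integral>x. (vinner n u x)\<^sup>2 \<partial>gaussRn n \<sigma>) \<le> \<sigma>\<^sup>2 * (\<Sum>i<n. (u i)\<^sup>2)" for u
  proof -
    have "(vinner n u x)\<^sup>2 = (\<Sum>i<n. \<Sum>j<n. u i * u j * (x i * x j))" for x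
      unfolding vinner_def power2_eq_square sum_product by (simp add: algebra_simps)
    then have "(\<integral>x. (vinner n u x)\<^sup>2 \<partial>gaussRn n \<sigma>) = (\<integral>x. (\<Sum>i<n. \<Sum>j<n. u i * u j * (x i * x j)) \<partial>gaussRn n \<sigma>)"
      by simp
    also have "\<dots> = (\<Sum>i<n. \<integral>x. (\<Sum>j<n. u i * u j * (x i * x j)) \<partial>gaussRn n \<sigma>)"
      using gaussRn_moment2(1)[OF \<sigma>]
      by (intro Bochner_Integration.integral_sum Bochner_Integration.integrable_sum) auto
    also have "\<dots> = (\<Sum>i<n. \<Sum>j<n. \<integral>x. u i * u j * (x i * x j) \<partial>gaussRn n \<sigma>)"
      using gaussRn_moment2(1)[OF \<sigma>]
      by (intro sum.cong refl Bochner_Integration.integral_sum) auto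
    also have "\<dots> = (\<Sum>i<n. \<Sum>j<n. u i * u j * (if i = j then \<sigma>\<^sup>2 else 0))"
      using gaussRn_moment2(2)[OF \<sigma>] by (intro sum.cong refl) simp
    also have "\<dots> = \<sigma>\<^sup>2 * (\<Sum>i<n. (u i)\<^sup>2)"
      by (simp add: sum_distrib_left power2_eq_square mult.commute if_distrib cong: if_cong)
    finally show ?thesis by simp
  qed
  show ?thesis
    unfolding Xi_sym_def using sym sq mean cov prob_space_gaussRn[OF \<sigma>] by simp
qed

section \<open>Lower bound from packings\<close>

lemma vadd_in_Rn [simp]: "vadd n x y \<in> Rn n"
  by (simp add: vadd_def Rn_def)

lemma measurable_vadd [measurable]: "vadd n w \<in> borelRn n \<rightarrow>\<^sub>M borelRn n"
  unfolding vadd_def borelRn_def by measurable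

lemma measurable_borelRn_component [measurable]: "i < n \<Longrightarrow> (\<lambda>x. x i) \<in> borel_measurable (borelRn n)"
  unfolding borelRn_def by measurable

lemma measurable_vdist [measurable (raw)]:
  assumes [measurable]: "f \<in> M \<rightarrow>\<^sub>M borelRn n"
  shows "(\<lambda>x. vdist n (f x) s) \<in> borel_measurable M"
  unfolding vdist_def vnorm_def by measurable

text \<open>Names the uncorrupted sample that occurs inside \<open>risk\<close>, as a function of
  the noise.\<close>

definition shift_sample :: "nat \<Rightarrow> nat \<Rightarrow> (nat \<Rightarrow> real) \<Rightarrow> (nat \<Rightarrow> nat \<Rightarrow> real) \<Rightarrow> (nat \<Rightarrow> nat \<Rightarrow> real)" where
  "shift_sample n N \<mu> \<xi> = (\<lambda>i\<in>{..<N}. vadd n \<mu> (\<xi> i))"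

lemma measurable_shift_sample [measurable]:
  "shift_sample n N \<mu> \<in> sample_space n N \<rightarrow>\<^sub>M sample_space n N"
  unfolding shift_sample_def sample_space_def by measurable

lemma shift_sample_shift_sample:
  assumes "s \<in> Rn n"
  shows "shift_sample n N \<nu> (shift_sample n N (\<lambda>k\<in>{..<n}. s k - \<nu> k) \<xi>) = shift_sample n N s \<xi>"
  by (auto simp: shift_sample_def vadd_def intro!: restrict_ext)

lemma sets_PiM_Xi_sym:
  "P \<in> Xi_sym n \<sigma> \<Longrightarrow> sets (PiM {..<N} (\<lambda>_. P)) = sets (sample_space n N)"
  unfolding sample_space_def by (intro sets_PiM_cong) (auto simp: Xi_sym_def)

lemma prob_space_PiM_Xi_sym: "P \<in> Xi_sym n \<sigma> \<Longrightarrow> prob_space (PiM {..<N} (\<lambda>_. P))"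
  by (intro prob_space_PiM) (simp add: Xi_sym_def)

lemma id_in_adversaries: "0 \<le> \<epsilon> \<Longrightarrow> (\<lambda>x. x) \<in> adversaries n N \<epsilon>"
  by (simp add: adversaries_def)

lemma minimax_sym_geI:
  assumes "\<And>est. est \<in> estimators n N \<Longrightarrow>
    \<exists>\<mu>\<in>K. \<exists>P\<in>Xi_sym n \<sigma>. \<exists>C\<in>adversaries n N \<epsilon>. b \<le> risk n N est \<mu> P C"
  shows "b \<le> minimax_sym n N K \<sigma> \<epsilon>"
  unfolding minimax_sym_def
proof (rule INF_greatest)
  fix est assume "est \<in> estimators n N"
  then obtain \<mu> P C where *: "\<mu> \<in> K" "P \<in> Xi_sym n \<sigma>" "C \<in> adversaries n N \<epsilon>" "b \<le> risk n N est \<mu> P C"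
    using assms by blast
  show "b \<le> (SUP \<mu>\<in>K. SUP P\<in>Xi_sym n \<sigma>. SUP C\<in>adversaries n N \<epsilon>. risk n N est \<mu> P C)"
    by (intro SUP_upper2[OF *(1)] SUP_upper2[OF *(2)] SUP_upper2[OF *(3)] *(4))
qed

text \<open>The likelihood ratio of a whole Gaussian sample translated by \<open>w\<close> against
  the untranslated one.\<close>

definition sample_lr :: "nat \<Rightarrow> nat \<Rightarrow> real \<Rightarrow> (nat \<Rightarrow> real) \<Rightarrow> (nat \<Rightarrow> nat \<Rightarrow> real) \<Rightarrow> ennreal" where
  "sample_lr n N \<sigma> w \<xi> = (\<Prod>i<N. \<Prod>k<n. ennreal (gauss_lr \<sigma> (w k) (\<xi> i k)))"

lemma measurable_sample_lr [measurable]: "sample_lr n N \<sigma> w \<in> borel_measurable (sample_space n N)"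
  unfolding sample_lr_def sample_space_def by measurable

lemma distr_gauss_sample_shift:
  assumes \<sigma>: "0 < \<sigma>" and Q: "Q = PiM {..<N} (\<lambda>_. gaussRn n \<sigma>)"
  shows "distr Q Q (shift_sample n N w) = density Q (sample_lr n N \<sigma> w)"
proof -
  interpret g: prob_space "gauss \<sigma>" by (rule prob_space_gauss) fact
  interpret G: prob_space "gaussRn n \<sigma>" by (rule prob_space_gaussRn) fact
  have 1: "distr (gaussRn n \<sigma>) (gaussRn n \<sigma>) (vadd n w)
      = density (gaussRn n \<sigma>) (\<lambda>x. \<Prod>k<n. ennreal (gauss_lr \<sigma> (w k) (x k)))"
    unfolding gaussRn_def vadd_def
    by (rule distr_PiM_density[OF _ g.prob_space_axioms, where f = "\<lambda>k y. w k + y"])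
       (auto simp: distr_gauss_shift[OF \<sigma>])
  have [measurable]: "vadd n w \<in> gaussRn n \<sigma> \<rightarrow>\<^sub>M gaussRn n \<sigma>"
    using measurable_vadd by (simp cong: measurable_cong_sets)
  have [measurable]: "(\<lambda>x. \<Prod>k<n. ennreal (gauss_lr \<sigma> (w k) (x k))) \<in> borel_measurable (gaussRn n \<sigma>)"
    by measurable
  show ?thesis
    unfolding Q shift_sample_def sample_lr_def
    by (rule distr_PiM_density[OF _ G.prob_space_axioms, where f = "\<lambda>_. vadd n w"]) (auto simp: 1)
qed

text \<open>One plus the chi-square divergence between the translated and the centred sample; it is
  multiplicative over points and coordinates.\<close>

lemma nn_integral_sample_lr_power2:
  assumes \<sigma>: "0 < \<sigma>"
  shows "(\<integral>\<^sup>+ \<xi>. sample_lr n N \<sigma> w \<xi> ^ 2 \<partial>PiM {..<N} (\<lambda>_. gaussRn n \<sigma>))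
    = ennreal (exp (real N * (vnorm n w)\<^sup>2 / \<sigma>\<^sup>2))"
proof -
  interpret g: prob_space "gauss \<sigma>" by (rule prob_space_gauss) fact
  interpret G: prob_space "gaussRn n \<sigma>" by (rule prob_space_gaussRn) fact
  interpret g: product_sigma_finite "\<lambda>_::nat. gauss \<sigma>" ..
  interpret G: product_sigma_finite "\<lambda>_::nat. gaussRn n \<sigma>" ..
  have 1: "(\<integral>\<^sup>+ x. (\<Prod>k<n. ennreal (gauss_lr \<sigma> (w k) (x k)) ^ 2) \<partial>gaussRn n \<sigma>) = ennreal (exp ((vnorm n w)\<^sup>2 / \<sigma>\<^sup>2))"
    unfolding gaussRn_def
    by (subst g.product_nn_integral_prod)
       (auto simp: nn_integral_gauss_lr_power2[OF \<sigma>] prod_ennreal exp_sum[symmetric] vnorm_def sum_nonneg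
         sum_divide_distrib)
  have [measurable]: "(\<lambda>x. \<Prod>k<n. ennreal (gauss_lr \<sigma> (w k) (x k)) ^ 2) \<in> borel_measurable (gaussRn n \<sigma>)"
    by measurable
  show ?thesis
    unfolding sample_lr_def prod_power_distrib
    by (subst G.product_nn_integral_prod)
       (auto simp: 1 ennreal_power exp_of_nat_mult[symmetric])
qed

text \<open>The integrand is dominated via \<open>1\<^sub>B L \<le> (t 1\<^sub>B + L\<^sup>2 / t) / 2\<close>, so disjointness of the
  decision regions and the second moment of the likelihood ratios replace Fano's inequality.\<close>

lemma minimax_sym_ge_packing:
  assumes \<sigma>: "0 < \<sigma>" and \<epsilon>: "0 \<le> \<epsilon>" and r: "0 \<le> r" and K: "K \<subseteq> Rn n"
    and S: "finite S" "S \<subseteq> K" "S \<subseteq> vcball n \<nu> \<delta>" "separated n (2 * r) S"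
    and card: "4 * exp (real N * \<delta>\<^sup>2 / \<sigma>\<^sup>2) \<le> real (card S)"
  shows "ennreal (r\<^sup>2 / 2) \<le> minimax_sym n N K \<sigma> \<epsilon>"
proof (rule minimax_sym_geI)
  fix est assume "est \<in> estimators n N"
  then have [measurable]: "est \<in> sample_space n N \<rightarrow>\<^sub>M borelRn n" by (simp add: estimators_def)
  define P where "P = gaussRn n \<sigma>"
  have P: "P \<in> Xi_sym n \<sigma>" unfolding P_def by (rule gaussRn_in_Xi_sym) fact
  define Q where "Q = PiM {..<N} (\<lambda>_. P)"
  have sets_Q [measurable_cong]: "sets Q = sets (sample_space n N)"
    unfolding Q_def by (rule sets_PiM_Xi_sym[OF P])
  interpret Q: prob_space Q unfolding Q_def by (rule prob_space_PiM_Xi_sym[OF P])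
  define M where "M = real (card S)"
  have M: "0 < M" using card exp_gt_zero[of "real N * \<delta>\<^sup>2 / \<sigma>\<^sup>2"] unfolding M_def by linarith
  \<comment> \<open>\<open>A s\<close> is success when the truth is \<open>s\<close>.
    \<open>B s\<close> is the same decision region under the single reference law with mean
    \<open>\<nu>\<close>, so the sets \<open>B s\<close> are disjoint; translation by
    \<open>s - \<nu>\<close> carries one into the other.\<close>
  define A where "A s = {x \<in> space Q. vdist n (est (shift_sample n N s x)) s < r}" for s
  have A[measurable]: "A s \<in> sets Q" for s unfolding A_def by measurable
  define B where "B s = {x \<in> space Q. vdist n (est (shift_sample n N \<nu> x)) s < r}" for s
  have B[measurable]: "B s \<in> sets Q" for s unfolding B_def by measurable
  define w where "w s = (\<lambda>k\<in>{..<n}. s k - \<nu> k)" for s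
  let ?L = "\<lambda>s. sample_lr n N \<sigma> (w s)"
  have L[measurable]: "?L s \<in> borel_measurable Q" for s
    by measurable
  have prob_A: "emeasure Q (A s) \<le> ennreal (M / 4) * emeasure Q (B s) + ennreal (1 / 4)" if s: "s \<in> S" for s
  proof -
    have sR: "s \<in> Rn n" using s S K by auto
    have [measurable]: "shift_sample n N (w s) \<in> Q \<rightarrow>\<^sub>M Q"
      using measurable_shift_sample by (simp cong: measurable_cong_sets)
    have "A s = shift_sample n N (w s) -` B s \<inter> space Q"
      using measurable_space[of "shift_sample n N (w s)" Q Q]
      by (auto simp: A_def B_def w_def shift_sample_shift_sample[OF sR])
    then have "emeasure Q (A s) = emeasure (distr Q Q (shift_sample n N (w s))) (B s)"
      by (subst emeasure_distr) auto
    also have "\<dots> = (\<integral>\<^sup>+ x. ?L s x * indicator (B s) x \<partial>Q)"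
      unfolding distr_gauss_sample_shift[OF \<sigma> Q_def[unfolded P_def]]
      using B L by (intro emeasure_density) (auto simp: Q_def P_def)
    also have "\<dots> \<le> (\<integral>\<^sup>+ x. ennreal (M / 4) * indicator (B s) x + ennreal (1 / M) * ?L s x ^ 2 \<partial>Q)"
    proof (rule nn_integral_mono)
      fix x
      obtain l where l: "0 \<le> l" "?L s x = ennreal l"
      proof
        show "?L s x = ennreal (\<Prod>i<N. \<Prod>k<n. gauss_lr \<sigma> (w s k) (x i k))"
          unfolding sample_lr_def by (simp add: prod_ennreal gauss_lr_pos less_imp_le prod_nonneg)
      qed (auto intro!: prod_nonneg simp: gauss_lr_pos less_imp_le)
      \<comment> \<open>The choice \<open>t = M / 2\<close> makes both parts of the total over
        \<open>S\<close> at most \<open>M / 4\<close>.\<close>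
      have "l \<le> M / 4 + 1 / M * l\<^sup>2"
      proof -
        have "0 \<le> (M / 2 - l)\<^sup>2 / M" using M by simp
        also have "\<dots> = M / 4 + 1 / M * l\<^sup>2 - l" using M by (simp add: power2_eq_square field_simps)
        finally show ?thesis by simp
      qed
      then have "ennreal l \<le> ennreal (M / 4) + ennreal (1 / M) * ennreal l ^ 2"
        using M l by (simp add: ennreal_power flip: ennreal_mult' ennreal_plus)
      then show "?L s x * indicator (B s) x \<le> ennreal (M / 4) * indicator (B s) x + ennreal (1 / M) * ?L s x ^ 2"
        unfolding l(2) by (simp add: indicator_def)
    qed
    also have "\<dots> = ennreal (M / 4) * emeasure Q (B s) + ennreal (1 / M) * (\<integral>\<^sup>+ x. ?L s x ^ 2 \<partial>Q)"
      by (subst nn_integral_add) (auto simp: nn_integral_cmult)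
    also have "ennreal (1 / M) * (\<integral>\<^sup>+ x. ?L s x ^ 2 \<partial>Q) \<le> ennreal (1 / 4)"
    proof -
      have "vnorm n (w s) = vdist n \<nu> s"
        unfolding vdist_commute[of n \<nu>] by (simp add: vdist_def vnorm_def w_def)
      then have "(vnorm n (w s))\<^sup>2 \<le> \<delta>\<^sup>2" using s S(3) by (auto simp: vcball_def intro!: power_mono)
      then have "exp (real N * (vnorm n (w s))\<^sup>2 / \<sigma>\<^sup>2) \<le> exp (real N * \<delta>\<^sup>2 / \<sigma>\<^sup>2)"
        unfolding exp_le_cancel_iff by (intro divide_right_mono mult_left_mono) auto
      then have "exp (real N * (vnorm n (w s))\<^sup>2 / \<sigma>\<^sup>2) \<le> M / 4"
        using card unfolding M_def by linarith
      then have "1 / M * exp (real N * (vnorm n (w s))\<^sup>2 / \<sigma>\<^sup>2) \<le> 1 / M * (M / 4)"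
        using M by (intro mult_left_mono) auto
      then show ?thesis
        unfolding Q_def P_def nn_integral_sample_lr_power2[OF \<sigma>]
        using M by (simp flip: ennreal_mult')
    qed
    finally show ?thesis by (simp add: add_left_mono)
  qed
  have "disjoint_family_on B S"
    unfolding disjoint_family_on_def
  proof (intro ballI impI equals0I)
    fix s t x assume st: "s \<in> S" "t \<in> S" "s \<noteq> t" and x: "x \<in> B s \<inter> B t"
    then have "vdist n s t < r + r"
      using vdist_triangle[of n s t "est (shift_sample n N \<nu> x)"] by (auto simp: B_def vdist_commute[of n s])
    then show False using S(4) st by (force simp: separated_def)
  qed
  then have "(\<Sum>s\<in>S. emeasure Q (B s)) = emeasure Q (\<Union>s\<in>S. B s)"
    using S(1) by (intro sum_emeasure) auto
  then have B1: "(\<Sum>s\<in>S. emeasure Q (B s)) \<le> 1" by (simp add: Q.emeasure_le_1)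
  \<comment> \<open>The total success probability is at most \<open>M / 2\<close>, so some
    \<open>s\<close> is missed with probability at least \<open>1 / 2\<close>.\<close>
  have "(\<Sum>s\<in>S. emeasure Q (A s)) \<le> (\<Sum>s\<in>S. ennreal (M / 4) * emeasure Q (B s) + ennreal (1 / 4))"
    by (intro sum_mono prob_A)
  also have "\<dots> = ennreal (M / 4) * (\<Sum>s\<in>S. emeasure Q (B s)) + ennreal (M / 4)"
    using M unfolding sum.distrib sum_distrib_left[symmetric]
    by (simp add: M_def ennreal_of_nat_eq_real_of_nat flip: ennreal_mult')
  also have "\<dots> \<le> ennreal (M / 4) * 1 + ennreal (M / 4)"
    using B1 by (intro add_right_mono mult_left_mono) auto
  also have "\<dots> = ennreal (M / 2)" using M by (simp flip: ennreal_plus)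
  finally have sum_A: "(\<Sum>s\<in>S. measure Q (A s)) \<le> M / 2"
    using M by (simp add: Q.emeasure_eq_measure sum_ennreal)
  have "\<exists>s\<in>S. measure Q (A s) \<le> 1 / 2"
  proof (rule ccontr)
    assume "\<not> ?thesis"
    then have "(\<Sum>s\<in>S. 1 / 2) < (\<Sum>s\<in>S. measure Q (A s))"
      using S(1) M by (intro sum_strict_mono) (auto simp: M_def)
    then show False using sum_A by (simp add: M_def)
  qed
  then obtain s where s: "s \<in> S" "measure Q (A s) \<le> 1 / 2" by blast
  have "ennreal (r\<^sup>2 / 2) \<le> ennreal (r\<^sup>2 * measure Q (space Q - A s))"
    using s(2) mult_left_mono[of "1 / 2" "1 - measure Q (A s)" "r\<^sup>2"]
    by (intro ennreal_leI) (simp add: Q.prob_compl)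
  also have "\<dots> = (\<integral>\<^sup>+ x. ennreal (r\<^sup>2) * indicator (space Q - A s) x \<partial>Q)"
    by (simp add: nn_integral_cmult Q.emeasure_eq_measure ennreal_mult)
  also have "\<dots> \<le> (\<integral>\<^sup>+ x. ennreal ((vdist n (est (shift_sample n N s x)) s)\<^sup>2) \<partial>Q)"
    using r by (intro nn_integral_mono) (auto simp: indicator_def A_def not_less intro!: ennreal_leI power_mono)
  also have "\<dots> = risk n N est s P (\<lambda>x. x)" by (simp add: risk_def shift_sample_def Q_def)
  finally show "\<exists>\<mu>\<in>K. \<exists>P\<in>Xi_sym n \<sigma>. \<exists>C\<in>adversaries n N \<epsilon>. ennreal (r\<^sup>2 / 2) \<le> risk n N est \<mu> P C"
    using s(1) S(2) P id_in_adversaries[OF \<epsilon>] by blast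
qed

section \<open>Pairwise tests and the tournament estimator\<close>

text \<open>Positive values favour \<open>\<nu>'\<close>, negative ones
  \<open>\<nu>\<close>.\<close>

definition score :: "nat \<Rightarrow> real \<Rightarrow> (nat \<Rightarrow> real) \<Rightarrow> (nat \<Rightarrow> real) \<Rightarrow> (nat \<Rightarrow> real) \<Rightarrow> real" where
  "score n \<sigma> \<nu> \<nu>' x = (\<Sum>k<n. (x k - (\<nu> k + \<nu>' k) / 2) * (\<nu>' k - \<nu> k)) / (\<sigma> * vdist n \<nu> \<nu>')"

text \<open>A tie counts as a win for both candidates, which makes the relation total.\<close>

definition beats :: "nat \<Rightarrow> nat \<Rightarrow> real \<Rightarrow> (nat \<Rightarrow> real) \<Rightarrow> (nat \<Rightarrow> real) \<Rightarrow> (nat \<Rightarrow> nat \<Rightarrow> real) \<Rightarrow> bool" where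
  "beats n N \<sigma> \<nu>' \<nu> X \<longleftrightarrow> 0 \<le> (\<Sum>i<N. clip (score n \<sigma> \<nu> \<nu>' (X i)))"

lemma score_swap: "score n \<sigma> \<nu>' \<nu> x = - score n \<sigma> \<nu> \<nu>' x"
proof -
  have "(\<Sum>k<n. (x k - (\<nu>' k + \<nu> k) / 2) * (\<nu> k - \<nu>' k)) = - (\<Sum>k<n. (x k - (\<nu> k + \<nu>' k) / 2) * (\<nu>' k - \<nu> k))"
    unfolding sum_negf[symmetric] by (intro sum.cong) (auto simp: field_simps)
  then show ?thesis by (simp add: score_def vdist_commute[of n \<nu>'])
qed

lemma beats_total: "beats n N \<sigma> \<nu>' \<nu> X \<or> beats n N \<sigma> \<nu> \<nu>' X"
  unfolding beats_def score_swap[of n \<sigma> \<nu>' \<nu>] clip_minus sum_negf by linarith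

lemma measurable_score [measurable]: "score n \<sigma> \<nu> \<nu>' \<in> borel_measurable (borelRn n)"
  unfolding score_def by measurable

lemma measurable_beats [measurable]: "Measurable.pred (sample_space n N) (beats n N \<sigma> \<nu>' \<nu>)"
  unfolding beats_def sample_space_def by measurable

text \<open>Replacing one point moves a clipped score by at most \<open>6 = 3 - (- 3)\<close>,
  whatever the new value.\<close>

lemma beats_corrupted_le:
  assumes "C \<in> adversaries n N \<epsilon>" "X \<in> space (sample_space n N)" "beats n N \<sigma> \<nu>' \<nu> (C X)"
  shows "- (6 * \<epsilon> * real N) \<le> (\<Sum>i<N. clip (score n \<sigma> \<nu> \<nu>' (X i)))"
proof -
  let ?s = "\<lambda>X i. clip (score n \<sigma> \<nu> \<nu>' (X i))"
  let ?J = "{i \<in> {..<N}. C X i \<noteq> X i}"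
  have "(\<Sum>i<N. ?s (C X) i) - (\<Sum>i<N. ?s X i) = (\<Sum>i<N. ?s (C X) i - ?s X i)"
    by (simp add: sum_subtractf)
  also have "\<dots> \<le> (\<Sum>i<N. if C X i \<noteq> X i then 6 else 0)"
  proof (rule sum_mono)
    fix i
    show "?s (C X) i - ?s X i \<le> (if C X i \<noteq> X i then 6 else 0)"
      using clip_bounds(2)[of "score n \<sigma> \<nu> \<nu>' (C X i)"] clip_bounds(1)[of "score n \<sigma> \<nu> \<nu>' (X i)"] by auto
  qed
  also have "\<dots> = 6 * real (card ?J)"
    unfolding sum.If_cases[OF finite_lessThan] by (simp add: Int_def)
  also have "\<dots> \<le> 6 * (\<epsilon> * real N)"
    using assms(1,2) by (intro mult_left_mono) (auto simp: adversaries_def)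
  finally show ?thesis using assms(3) by (simp add: beats_def)
qed

text \<open>Reduction to \<open>test_error_le\<close>: the score of an uncorrupted point is
  \<open>Z + m\<close>, where \<open>Z\<close> is a projection of the noise and \<open>m\<close>,
  the score of the true mean, is at most \<open>- u\<close> by Cauchy-Schwarz. The allowance is
  \<open>a = 6 * \<epsilon>\<close>.\<close>

lemma emeasure_beats_le:
  assumes \<sigma>: "0 < \<sigma>" and P: "P \<in> Xi_sym n \<sigma>" and C: "C \<in> adversaries n N \<epsilon>"
    and R: "\<mu> \<in> Rn n" and D: "0 < vdist n \<nu> \<nu>'"
    and \<mu>: "vdist n \<nu> \<mu> \<le> \<eta>" and u: "0 \<le> u" "u \<le> (vdist n \<nu> \<nu>' / 2 - \<eta>) / \<sigma>"
    and \<epsilon>: "6 * \<epsilon> \<le> min u 1 / 4"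
  defines "Q \<equiv> PiM {..<N} (\<lambda>_::nat. P)"
  shows "emeasure Q {\<xi> \<in> space Q. beats n N \<sigma> \<nu>' \<nu> (C (shift_sample n N \<mu> \<xi>))}
    \<le> ennreal (exp (- ln (1 + u\<^sup>2) / 52000)) ^ N"
proof -
  define d where "d = vdist n \<nu> \<nu>'"
  have d: "0 < d" using D by (simp add: d_def)
  \<comment> \<open>The norm of \<open>w\<close> is \<open>1 / \<sigma>\<close>, so the covariance
    bound gives \<open>Z\<close> second moment at most 1.\<close>
  define w where "w = (\<lambda>k\<in>{..<n}. (\<nu>' k - \<nu> k) / (\<sigma> * d))"
  have w: "w \<in> Rn n" by (simp add: w_def Rn_def)
  have w2: "(\<Sum>k<n. (w k)\<^sup>2) = 1 / \<sigma>\<^sup>2"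
  proof -
    have "(\<Sum>k<n. (w k)\<^sup>2) = (\<Sum>k<n. (\<nu>' k - \<nu> k)\<^sup>2) / (\<sigma> * d)\<^sup>2"
      unfolding sum_divide_distrib by (intro sum.cong) (auto simp: w_def power_divide)
    also have "(\<Sum>k<n. (\<nu>' k - \<nu> k)\<^sup>2) = d\<^sup>2"
      unfolding d_def vdist_commute[of n \<nu>] vdist_power2 ..
    finally show ?thesis using d by (simp add: power_mult_distrib)
  qed
  define Z where "Z = vinner n w"
  define m where "m = score n \<sigma> \<nu> \<nu>' \<mu>"
  have sets_P [measurable_cong]: "sets P = sets (borelRn n)" using P by (simp add: Xi_sym_def)
  have Z[measurable]: "Z \<in> borel_measurable (borelRn n)" unfolding Z_def vinner_def by measurable
  have [measurable]: "vneg n \<in> borelRn n \<rightarrow>\<^sub>M borelRn n"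
    unfolding vneg_def borelRn_def by measurable
  have Z_vneg: "Z (vneg n x) = - Z x" for x
    by (simp add: Z_def vinner_def vneg_def sum_negf)
  interpret P: prob_space P using P by (simp add: Xi_sym_def)
  interpret symmetric_rv P Z
  proof
    show "Z \<in> borel_measurable P" by measurable
    have "distr P borel (\<lambda>x. - Z x) = distr P borel (Z \<circ> vneg n)" by (simp add: comp_def Z_vneg)
    also have "\<dots> = distr (distr P (borelRn n) (vneg n)) borel Z" by (rule distr_distr[symmetric]) measurable
    also have "distr P (borelRn n) (vneg n) = P" using P by (simp add: Xi_sym_def)
    finally show "distr P borel (\<lambda>x. - Z x) = distr P borel Z" .
    have Z_le: "(Z x)\<^sup>2 \<le> 1 / \<sigma>\<^sup>2 * (vnorm n x)\<^sup>2" for x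
      using power_mono[OF sum_mult_le_vnorm[of w x n], of 2] w2
      by (simp add: Z_def vinner_def power_mult_distrib vnorm_def[of n w] sum_nonneg)
    have "integrable P (\<lambda>x. 1 / \<sigma>\<^sup>2 * (vnorm n x)\<^sup>2)" using P by (simp add: Xi_sym_def)
    then show "integrable P (\<lambda>x. (Z x)\<^sup>2)"
      by (rule Bochner_Integration.integrable_bound) (use Z_le in \<open>auto intro!: AE_I2\<close>)
    have "(\<integral>x. (Z x)\<^sup>2 \<partial>P) \<le> \<sigma>\<^sup>2 * (\<Sum>i<n. (w i)\<^sup>2)" using P w by (simp add: Xi_sym_def Z_def)
    then show "(\<integral>x. (Z x)\<^sup>2 \<partial>P) \<le> 1" using \<sigma> by (simp add: w2)
  qed
  have score_shift: "score n \<sigma> \<nu> \<nu>' (vadd n \<mu> x) = Z x + m" for x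
  proof -
    have "(\<Sum>k<n. (vadd n \<mu> x k - (\<nu> k + \<nu>' k) / 2) * (\<nu>' k - \<nu> k))
        = (\<Sum>k<n. x k * (\<nu>' k - \<nu> k)) + (\<Sum>k<n. (\<mu> k - (\<nu> k + \<nu>' k) / 2) * (\<nu>' k - \<nu> k))"
      unfolding sum.distrib[symmetric] by (intro sum.cong) (auto simp: vadd_def algebra_simps)
    moreover have "Z x = (\<Sum>k<n. x k * (\<nu>' k - \<nu> k)) / (\<sigma> * d)"
      unfolding Z_def vinner_def sum_divide_distrib by (intro sum.cong) (auto simp: w_def)
    ultimately show ?thesis by (simp add: score_def m_def add_divide_distrib d_def)
  qed
  have m_le: "m \<le> - u"
  proof -
    have "(\<Sum>k<n. (\<mu> k - (\<nu> k + \<nu>' k) / 2) * (\<nu>' k - \<nu> k))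
        = (\<Sum>k<n. (\<mu> k - \<nu> k) * (\<nu>' k - \<nu> k)) - (\<Sum>k<n. (\<nu>' k - \<nu> k)\<^sup>2) / 2"
      unfolding sum_divide_distrib sum_subtractf[symmetric]
      by (intro sum.cong) (auto simp: power2_eq_square field_simps)
    also have "(\<Sum>k<n. (\<nu>' k - \<nu> k)\<^sup>2) = d\<^sup>2"
      unfolding d_def vdist_commute[of n \<nu>] vdist_power2 ..
    also have "(\<Sum>k<n. (\<mu> k - \<nu> k) * (\<nu>' k - \<nu> k)) \<le> \<eta> * d"
    proof -
      have "(\<Sum>k<n. (\<mu> k - \<nu> k) * (\<nu>' k - \<nu> k)) \<le> vdist n \<mu> \<nu> * vdist n \<nu>' \<nu>"
        using sum_mult_le_vnorm[of "\<lambda>k. \<mu> k - \<nu> k" "\<lambda>k. \<nu>' k - \<nu> k" n] by (simp add: vdist_def)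
      also have "\<dots> = vdist n \<nu> \<mu> * d" by (simp add: vdist_commute d_def)
      also have "\<dots> \<le> \<eta> * d" using \<mu> d by (intro mult_right_mono) auto
      finally show ?thesis .
    qed
    finally have "m \<le> (\<eta> * d - d\<^sup>2 / 2) / (\<sigma> * d)"
      unfolding m_def score_def d_def[symmetric] using \<sigma> d by (intro divide_right_mono) auto
    also have "\<dots> = - ((d / 2 - \<eta>) / \<sigma>)" using \<sigma> d by (simp add: field_simps power2_eq_square)
    also have "\<dots> \<le> - u" using u by (simp add: d_def)
    finally show ?thesis .
  qed
  have sets_Q: "sets Q = sets (sample_space n N)"
    unfolding Q_def by (rule sets_PiM_Xi_sym[OF P])
  then have space_Q: "space Q = space (sample_space n N)" by (rule sets_eq_imp_space_eq)
  have "{\<xi> \<in> space Q. beats n N \<sigma> \<nu>' \<nu> (C (shift_sample n N \<mu> \<xi>))}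
      \<subseteq> {\<xi> \<in> space Q. - (6 * \<epsilon> * real N) \<le> (\<Sum>i<N. clip (Z (\<xi> i) + m))}"
  proof (intro subsetI CollectI conjI)
    fix \<xi> assume \<xi>: "\<xi> \<in> {\<xi> \<in> space Q. beats n N \<sigma> \<nu>' \<nu> (C (shift_sample n N \<mu> \<xi>))}"
    then have "shift_sample n N \<mu> \<xi> \<in> space (sample_space n N)"
      using measurable_space[OF measurable_shift_sample] by (auto simp: space_Q)
    with C have "- (6 * \<epsilon> * real N) \<le> (\<Sum>i<N. clip (score n \<sigma> \<nu> \<nu>' (shift_sample n N \<mu> \<xi> i)))"
      using \<xi> by (intro beats_corrupted_le[of C]) auto
    also have "\<dots> = (\<Sum>i<N. clip (Z (\<xi> i) + m))"
      by (intro sum.cong) (auto simp: shift_sample_def score_shift)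
    finally show "- (6 * \<epsilon> * real N) \<le> (\<Sum>i<N. clip (Z (\<xi> i) + m))" .
  qed auto
  then have "emeasure Q {\<xi> \<in> space Q. beats n N \<sigma> \<nu>' \<nu> (C (shift_sample n N \<mu> \<xi>))}
      \<le> emeasure Q {\<xi> \<in> space Q. - (6 * \<epsilon> * real N) \<le> (\<Sum>i<N. clip (Z (\<xi> i) + m))}"
    by (rule emeasure_mono) (unfold Q_def, measurable)
  also have "\<dots> \<le> ennreal (exp (- ln (1 + u\<^sup>2) / 52000)) ^ N"
    unfolding Q_def by (rule test_error_le[OF u(1) m_le \<epsilon>])
  finally show ?thesis .
qed

text \<open>If \<open>\<nu>\<close> and the chosen point disagree, whichever of them lost has the distance between them
  as a lower bound for its defeat radius, and the chosen point has almost the smallest one.\<close>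

definition defeat_radius :: "nat \<Rightarrow> nat \<Rightarrow> real \<Rightarrow> (nat \<Rightarrow> real) set \<Rightarrow> (nat \<Rightarrow> real) \<Rightarrow> (nat \<Rightarrow> nat \<Rightarrow> real) \<Rightarrow> ennreal" where
  "defeat_radius n N \<sigma> G \<nu> X = (SUP \<nu>'\<in>G. if beats n N \<sigma> \<nu>' \<nu> X then ennreal (vdist n \<nu> \<nu>') else 0)"

text \<open>The infimum of the defeat radii need not be attained, so the estimator takes the first
  candidate, in an enumeration of \<open>G\<close>, that is within \<open>\<eta>\<close> of it; a
  least index depends measurably on the sample.\<close>

lemma tournament_estimator:
  assumes G: "countable G" "G \<noteq> {}" "G \<subseteq> Rn n" and \<eta>: "0 < \<eta>"
  obtains est where "est \<in> estimators n N"
    "\<And>X \<nu>. \<nu> \<in> G \<Longrightarrow> ennreal (vdist n \<nu> (est X)) \<le> defeat_radius n N \<sigma> G \<nu> X + ennreal \<eta>"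
proof -
  let ?D = "defeat_radius n N \<sigma> G"
  define g where "g = from_nat_into G"
  have g: "g i \<in> G" for i unfolding g_def by (rule from_nat_into[OF G(2)])
  have g_surj: "\<exists>i. g i = \<nu>" if "\<nu> \<in> G" for \<nu>
    unfolding g_def using from_nat_into_surj[OF G(1) that] .
  define ok where "ok i X \<longleftrightarrow> ?D (g i) X \<le> (INF \<nu>\<in>G. ?D \<nu> X) + ennreal \<eta>" for i X
  define est where "est X = g (LEAST i. ok i X)" for X
  have D[measurable]: "?D \<nu> \<in> borel_measurable (sample_space n N)" for \<nu>
    unfolding defeat_radius_def using G(1) by (intro borel_measurable_SUP) measurable
  have INF: "(\<lambda>X. INF \<nu>\<in>G. ?D \<nu> X) \<in> borel_measurable (sample_space n N)"
    using G(1) by (intro borel_measurable_INF) measurable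
  have [measurable]: "Measurable.pred (sample_space n N) (ok i)" for i
    unfolding ok_def pred_def by (intro borel_measurable_le borel_measurable_add borel_measurable_const D INF)
  have meas: "est \<in> sample_space n N \<rightarrow>\<^sub>M borelRn n"
    unfolding est_def
  proof (rule measurable_compose_countable[where f = "\<lambda>i _. g i"])
    show "(\<lambda>X. g i) \<in> sample_space n N \<rightarrow>\<^sub>M borelRn n" for i
      using g G(3) by (intro measurable_const) auto
  qed measurable
  have ok: "ok (LEAST i. ok i X) X" for X
  proof (rule LeastI_ex)
    show "\<exists>i. ok i X"
    \<comment> \<open>An infinite infimum makes every index acceptable, so the least index exists
      for every sample.\<close>
    proof (cases "(INF \<nu>\<in>G. ?D \<nu> X) = \<top>")
      case True
      then show ?thesis by (auto simp: ok_def)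
    next
      case False
      then have "(INF \<nu>\<in>G. ?D \<nu> X) < (INF \<nu>\<in>G. ?D \<nu> X) + ennreal \<eta>"
        using \<eta> by (cases "INF \<nu>\<in>G. ?D \<nu> X") (auto simp: ennreal_less_iff simp flip: ennreal_plus)
      then obtain \<nu> where "\<nu> \<in> G" "?D \<nu> X < (INF \<nu>\<in>G. ?D \<nu> X) + ennreal \<eta>"
        unfolding INF_less_iff by blast
      then show ?thesis using g_surj[of \<nu>] by (auto simp: ok_def intro: less_imp_le)
    qed
  qed
  have "ennreal (vdist n \<nu> (est X)) \<le> ?D \<nu> X + ennreal \<eta>" if \<nu>: "\<nu> \<in> G" for X \<nu>
  proof -
    have est: "est X \<in> G" unfolding est_def by (rule g)
    have D_ge: "ennreal (vdist n a b) \<le> ?D a X" if "a \<in> G" "b \<in> G" "beats n N \<sigma> b a X" for a b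
      unfolding defeat_radius_def using that by (intro SUP_upper2[of b]) auto
    from beats_total[of n N \<sigma> "est X" \<nu> X] show ?thesis
    proof
      assume "beats n N \<sigma> (est X) \<nu> X"
      then show ?thesis using D_ge[OF \<nu> est] by (simp add: add_increasing2)
    next
      assume "beats n N \<sigma> \<nu> (est X) X"
      then have "ennreal (vdist n \<nu> (est X)) \<le> ?D (est X) X"
        using D_ge[OF est \<nu>] by (simp add: vdist_commute)
      also have "\<dots> \<le> (INF \<nu>\<in>G. ?D \<nu> X) + ennreal \<eta>" using ok[of X] by (simp add: ok_def est_def)
      also have "\<dots> \<le> ?D \<nu> X + ennreal \<eta>" using \<nu> by (intro add_right_mono INF_lower)
      finally show ?thesis .
    qed
  qed
  with meas show ?thesis using that by (auto simp: estimators_def)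
qed

section \<open>Risk of the tournament estimator\<close>

lemma two_power_ge:
  assumes "30 \<le> i" shows "2500000 * (real i + 3) \<le> 2 ^ i"
  using assms
proof (induction i rule: dec_induct)
  case (step i)
  then have "2500000 * (real (Suc i) + 3) \<le> 2 * (2500000 * (real i + 3))" by simp
  also have "\<dots> \<le> 2 * 2 ^ i" using step by (intro mult_left_mono) auto
  finally show ?case by simp
qed simp

text \<open>With \<open>x = 4 ^ i * \<kappa>\<close> the squared test distance, entropy may use up
  half of the test exponent \<open>N / 52000 * ln (1 + x)\<close>; the other half must make the
  series over shells converge.\<close>

lemma entropy_le_ln:
  fixes \<kappa> L N :: real
  assumes i: "30 \<le> i" and \<kappa>: "0 < \<kappa>" and N: "0 \<le> N" and L: "L \<le> 16 * N * \<kappa>" "L \<le> N / 400000"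
  shows "(real i + 2) * L \<le> N / 104000 * ln (1 + 4 ^ i * \<kappa>)"
proof -
  define x where "x = 4 ^ i * \<kappa>"
  have x: "0 < x" using \<kappa> by (simp add: x_def)
  \<comment> \<open>The constant 2500000 rounds up \<open>16 * 104000 * 3 / 2\<close>, the
    requirement of the middle case below.\<close>
  have two: "2500000 * (real i + 3) \<le> 2 ^ i" using i by (rule two_power_ge)
  have four: "(4::real) ^ i = 2 ^ i * 2 ^ i" by (simp add: power_mult_distrib[symmetric])
  have \<kappa>_eq: "\<kappa> = x / 4 ^ i" by (simp add: x_def)
  note ln2 = ln2_ge_two_thirds
  have key: "(real i + 2) * min (16 * \<kappa>) (1 / 400000) \<le> ln (1 + x) / 104000"
  proof -
    \<comment> \<open>For \<open>x \<le> 1\<close> the logarithm is at least \<open>x / 2\<close>;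
      up to \<open>2 ^ i\<close> it is at least \<open>ln 2\<close> while
      \<open>\<kappa> \<le> 1 / 2 ^ i\<close>; beyond that it is at least \<open>i * ln 2\<close>,
      and only the bound of \<open>L\<close> by \<open>N / 400000\<close> helps.\<close>
    consider "x \<le> 1" | "1 < x" "x \<le> 2 ^ i" | "2 ^ i < x" by linarith
    then show ?thesis
    proof cases
      case 1
      have "(2500000 * (real i + 3)) * 2 \<le> 2 ^ i * 2 ^ i"
        using two i power_increasing[of 1 i "2::real"] by (intro mult_mono) auto
      then have "(real i + 2) * 3328000 \<le> 4 ^ i" unfolding four by (simp add: algebra_simps)
      then have "(real i + 2) * 3328000 * \<kappa> \<le> x"
        unfolding x_def using \<kappa> by (intro mult_right_mono) auto
      then have "(real i + 2) * 3328000 * \<kappa> / 208000 \<le> x / 208000" by (rule divide_right_mono) simp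
      then have "(real i + 2) * (16 * \<kappa>) \<le> x / 2 / 104000" by (simp add: algebra_simps)
      also have "x / 2 \<le> ln (1 + x)"
      proof -
        have "x / 2 \<le> 1 - 1 / (1 + x)" using x mult_left_mono[OF 1, of x] by (simp add: field_simps)
        also have "\<dots> \<le> - ln (1 / (1 + x))" using ln_le_minus_one[of "1 / (1 + x)"] x by simp
        also have "\<dots> = ln (1 + x)" using x by (simp add: ln_div)
        finally show ?thesis .
      qed
      finally have "(real i + 2) * (16 * \<kappa>) \<le> ln (1 + x) / 104000" by (simp add: divide_right_mono)
      moreover have "(real i + 2) * min (16 * \<kappa>) (1 / 400000) \<le> (real i + 2) * (16 * \<kappa>)"
        by (intro mult_left_mono) auto
      ultimately show ?thesis by linarith
    next
      case 2
      have "\<kappa> * 2 ^ i \<le> 1"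
        using 2 unfolding \<kappa>_eq four by (simp add: field_simps)
      then have "\<kappa> * (2500000 * (real i + 3)) \<le> 1"
        using mult_left_mono[OF two, of \<kappa>] \<kappa> by linarith
      then have "\<kappa> * (real i + 2) * 2500000 \<le> 1"
        using \<kappa> by (simp add: algebra_simps)
      then have "(real i + 2) * (16 * \<kappa>) \<le> 2 / 3 / 104000" by (simp add: algebra_simps)
      also have "\<dots> \<le> ln (1 + x) / 104000"
      proof (intro divide_right_mono)
        have "ln 2 \<le> ln (1 + x)" using 2 by (intro ln_mono) auto
        then show "2 / 3 \<le> ln (1 + x)" using ln2 by linarith
      qed simp
      finally have "(real i + 2) * (16 * \<kappa>) \<le> ln (1 + x) / 104000" .
      moreover have "(real i + 2) * min (16 * \<kappa>) (1 / 400000) \<le> (real i + 2) * (16 * \<kappa>)"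
        by (intro mult_left_mono) auto
      ultimately show ?thesis by linarith
    next
      case 3
      have "(real i + 2) * min (16 * \<kappa>) (1 / 400000) \<le> (real i + 2) * (1 / 400000)"
        by (intro mult_left_mono) auto
      also have "\<dots> \<le> real i * (2 / 3) / 104000" using i by (simp add: field_simps)
      also have "\<dots> \<le> real i * ln 2 / 104000"
        using ln2 by (intro divide_right_mono mult_left_mono) auto
      also have "real i * ln 2 = ln (2 ^ i)" by (simp add: ln_realpow)
      also have "\<dots> / 104000 \<le> ln (1 + x) / 104000"
        using 3 x by (intro divide_right_mono ln_mono) auto
      finally show ?thesis .
    qed
  qed
  have "L \<le> N * min (16 * \<kappa>) (1 / 400000)" using L by (auto simp: min_def algebra_simps)
  then have "(real i + 2) * L \<le> (real i + 2) * (N * min (16 * \<kappa>) (1 / 400000))"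
    by (intro mult_left_mono) auto
  also have "\<dots> = N * ((real i + 2) * min (16 * \<kappa>) (1 / 400000))" by simp
  also have "\<dots> \<le> N * (ln (1 + x) / 104000)" using key N by (intro mult_left_mono)
  finally show ?thesis by (simp add: x_def)
qed

text \<open>The right-hand side is \<open>(1 + x)\<close> to the power \<open>a\<close>. Bernoulli's
  inequality with an integer exponent \<open>q\<close> between \<open>a / 4\<close> and
  \<open>a / 2\<close> bounds its square root below by \<open>a * x / 4\<close>.\<close>

lemma exp_ln_ge_square:
  fixes a x :: real
  assumes a: "2 \<le> a" and x: "0 \<le> x"
  shows "(a * x / 4)\<^sup>2 \<le> exp (a * ln (1 + x))"
proof -
  define q where "q = nat \<lfloor>a / 2\<rfloor>"
  have "1 \<le> \<lfloor>a / 2\<rfloor>" using a by linarith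
  then have q: "real q \<le> a / 2" "a / 4 \<le> real q"
    using a unfolding q_def by (cases "a \<le> 4"; linarith)+
  have "a * x / 4 \<le> real q * x + 1" using mult_right_mono[OF q(2) x] by simp
  also have "\<dots> \<le> (x + 1) ^ q" using x by (rule linear_plus_1_le_power)
  also have "\<dots> = exp (real q * ln (1 + x))" using x by (simp add: exp_of_nat_mult add.commute)
  also have "\<dots> \<le> exp (a / 2 * ln (1 + x))"
    unfolding exp_le_cancel_iff using x by (intro mult_right_mono q(1)) simp
  finally have "(a * x / 4)\<^sup>2 \<le> (exp (a / 2 * ln (1 + x)))\<^sup>2"
    using a x by (intro power_mono) auto
  also have "\<dots> = exp (a * ln (1 + x))" by (simp add: exp_double[symmetric])
  finally show ?thesis .
qed

text \<open>The factor \<open>4 ^ (i + 1)\<close> is the squared outer radius of the shell in units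
  of \<open>\<eta>\<close>. The half exponent left over after entropy decays like
  \<open>1 / 16 ^ i\<close>, hence the geometric bound.\<close>

lemma shell_term_le:
  fixes \<kappa> L :: real
  assumes i: "30 \<le> i" and \<kappa>: "0 < \<kappa>" and L: "L \<le> 16 * real N * \<kappa>" "L \<le> real N / 400000"
    and N: "400000 * ln 2 \<le> real N" "1 / 6 \<le> real N * \<kappa>"
  shows "4 ^ (i + 1) * (exp L ^ (i + 2) * exp (- ln (1 + 4 ^ i * \<kappa>) / 52000) ^ N) \<le> 4 * 2496000\<^sup>2 * (1 / 4) ^ i"
proof -
  define x where "x = 4 ^ i * \<kappa>"
  have x: "0 < x" using \<kappa> by (simp add: x_def)
  define a where "a = real N / 104000"
  have a: "2 \<le> a" using N(1) ln2_ge_two_thirds by (simp add: a_def)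
  have "exp L ^ (i + 2) * exp (- ln (1 + x) / 52000) ^ N = exp ((real i + 2) * L - 2 * a * ln (1 + x))"
    unfolding exp_of_nat_mult[symmetric] exp_add[symmetric] by (simp add: a_def algebra_simps)
  also have "\<dots> \<le> exp (- (a * ln (1 + x)))"
    using entropy_le_ln[OF i \<kappa> _ L] by (simp add: a_def x_def)
  also have "\<dots> = 1 / exp (a * ln (1 + x))" by (simp add: exp_minus inverse_eq_divide)
  also have "\<dots> \<le> 1 / (4 ^ i / 2496000)\<^sup>2"
  proof (intro divide_left_mono)
    \<comment> \<open>Here \<open>2496000 = 6 * 4 * 104000\<close>.\<close>
    have "4 ^ i / 6 \<le> 4 ^ i * (real N * \<kappa>)"
      using mult_left_mono[OF N(2), of "4 ^ i"] by simp
    then have "4 ^ i / 2496000 \<le> a * x / 4" by (simp add: a_def x_def algebra_simps)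
    then have "(4 ^ i / 2496000)\<^sup>2 \<le> (a * x / 4)\<^sup>2" by (intro power_mono) auto
    also have "\<dots> \<le> exp (a * ln (1 + x))" using a x by (intro exp_ln_ge_square) auto
    finally show "(4 ^ i / 2496000)\<^sup>2 \<le> exp (a * ln (1 + x))" .
  qed auto
  finally have "exp L ^ (i + 2) * exp (- ln (1 + x) / 52000) ^ N \<le> 1 / (4 ^ i / 2496000)\<^sup>2" .
  then have "4 ^ (i + 1) * (exp L ^ (i + 2) * exp (- ln (1 + x) / 52000) ^ N) \<le> 4 ^ (i + 1) * (1 / (4 ^ i / 2496000)\<^sup>2)"
    by (intro mult_left_mono) auto
  also have "\<dots> = 4 * 2496000\<^sup>2 * (1 / 4) ^ i"
    by (simp add: power_divide power2_eq_square)
  finally show ?thesis by (simp add: x_def)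
qed

text \<open>The 8 is \<open>2 * 2^2\<close>, from distance \<open>2 * \<eta>\<close> lost to the net
  and the near-minimiser. The doubled bracket holds the squared core radius \<open>2 ^ 30\<close>
  and the geometric series, of sum \<open>4 / 3\<close>, over the outer shells.\<close>

definition upper_const :: real where
  "upper_const = 8 + 2 * (4 ^ 30 + 4 / 3 * (4 * 2496000\<^sup>2))"

text \<open>Rivals within \<open>2 ^ 30 * \<eta>\<close> of the net point near the truth are
  tolerated outright; beyond, the probability that some rival in a shell wins is weighted by the
  squared radius of the shell and summed.\<close>

lemma tournament_risk_le:
  assumes \<sigma>: "0 < \<sigma>" and \<epsilon>: "0 < \<epsilon>" "\<epsilon> \<le> 1 / 24" and K: "K \<subseteq> Rn n" "star_centre n K k0"
    and \<eta>: "2 * \<epsilon> * \<sigma> \<le> \<eta>" "0 < \<eta>" and L: "Mloc n K \<eta> c \<le> ereal (exp L)" and c: "2 \<le> c"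
    and L_le: "L \<le> real N * \<eta>\<^sup>2 / \<sigma>\<^sup>2" "L \<le> real N / 400000"
    and N: "400000 * ln 2 \<le> real N" "\<sigma>\<^sup>2 * (8 / 3) \<le> real N * \<eta>\<^sup>2"
  shows "minimax_sym n N K \<sigma> \<epsilon> \<le> ennreal (upper_const * \<eta>\<^sup>2)"
proof -
  obtain G where G: "G \<subseteq> K" "separated n \<eta> G" and net: "\<And>x. x \<in> K \<Longrightarrow> \<exists>g\<in>G. vdist n g x \<le> \<eta>"
    using maximal_separated_net[of \<eta> K n] \<eta>(2) by (metis less_imp_le)
  have k0: "k0 \<in> K" using K(2) by (simp add: star_centre_def)
  have G_count: "countable G" by (rule countable_separated[OF K c \<eta>(2) L G])
  have G_ne: "G \<noteq> {}" using net[OF k0] by auto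
  have GR: "G \<subseteq> Rn n" using G(1) K(1) by auto
  obtain est where est: "est \<in> estimators n N"
    and est_le: "\<And>X \<nu>. \<nu> \<in> G \<Longrightarrow> ennreal (vdist n \<nu> (est X)) \<le> defeat_radius n N \<sigma> G \<nu> X + ennreal \<eta>"
    using tournament_estimator[OF G_count G_ne GR \<eta>(2), of N \<sigma>] by blast
  define \<kappa> where "\<kappa> = \<eta>\<^sup>2 / (16 * \<sigma>\<^sup>2)"
  have \<kappa>: "0 < \<kappa>" using \<eta> \<sigma> by (simp add: \<kappa>_def)
  have risk: "risk n N est \<mu> P C \<le> ennreal (upper_const * \<eta>\<^sup>2)"
    if \<mu>: "\<mu> \<in> K" and P: "P \<in> Xi_sym n \<sigma>" and C: "C \<in> adversaries n N \<epsilon>" for \<mu> P C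
  proof -
    obtain \<nu> where \<nu>: "\<nu> \<in> G" "vdist n \<nu> \<mu> \<le> \<eta>" using net[OF \<mu>] by blast
    have \<nu>K: "\<nu> \<in> K" using \<nu> G by auto
    define Q where "Q = PiM {..<N} (\<lambda>_::nat. P)"
    interpret Q: prob_space Q unfolding Q_def by (rule prob_space_PiM_Xi_sym[OF P])
    have sets_Q [measurable_cong]: "sets Q = sets (sample_space n N)"
      unfolding Q_def by (rule sets_PiM_Xi_sym[OF P])
    have [measurable]: "C \<in> sample_space n N \<rightarrow>\<^sub>M sample_space n N" using C by (simp add: adversaries_def)
    define X where "X \<xi> = C (shift_sample n N \<mu> \<xi>)" for \<xi>
    have X[measurable]: "X \<in> Q \<rightarrow>\<^sub>M sample_space n N" unfolding X_def by measurable
    \<comment> \<open>The outer radius equals \<open>2 ^ (i + 2) * \<eta> / 2\<close>, which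
      explains the exponent \<open>i + 2\<close> in the cardinality bound.\<close>
    define shell where "shell i = {g \<in> G. 2 ^ i * \<eta> < vdist n \<nu> g \<and> vdist n \<nu> g \<le> 2 ^ (i + 1) * \<eta>}" for i
    have shell_sub: "shell i \<subseteq> {g \<in> G. vdist n \<nu> g \<le> 2 ^ (i + 2) * \<eta> / 2}" for i
      by (auto simp: shell_def algebra_simps)
    have fin: "finite (shell i)" for i
      using finite_subset[OF shell_sub finite_separated_ball(1)[OF K c \<eta>(2) L G \<nu>K]] .
    have card: "real (card (shell i)) \<le> exp L ^ (i + 2)" for i
      using card_mono[OF finite_separated_ball(1)[OF K c \<eta>(2) L G \<nu>K] shell_sub[of i]]
        finite_separated_ball(2)[OF K c \<eta>(2) L G \<nu>K, of "i + 2"] by linarith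
    define E where "E i = (\<Union>g\<in>shell i. {\<xi> \<in> space Q. beats n N \<sigma> g \<nu> (X \<xi>)})" for i
    have E[measurable]: "E i \<in> sets Q" for i
      unfolding E_def using fin by (intro sets.finite_UN) measurable
    have prob_E: "emeasure Q (E i) \<le> ennreal (exp L ^ (i + 2) * exp (- ln (1 + 4 ^ i * \<kappa>) / 52000) ^ N)"
      if i: "30 \<le> i" for i
    proof -
      \<comment> \<open>On shell \<open>i\<close> the margin
        \<open>vdist n \<nu> g / 2 - \<eta>\<close> is at least \<open>2 ^ i * \<eta> / 4\<close>,
        since \<open>2 ^ i \<ge> 4\<close>; \<open>\<kappa>\<close> is chosen so that
        \<open>u^2 = 4 ^ i * \<kappa>\<close>.\<close>
      define u where "u = 2 ^ i * \<eta> / (4 * \<sigma>)"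
      have u: "0 \<le> u" using \<eta> \<sigma> by (simp add: u_def)
      have "u\<^sup>2 = (2 ^ i)\<^sup>2 * \<eta>\<^sup>2 / (16 * \<sigma>\<^sup>2)" by (simp add: u_def power_mult_distrib power_divide)
      also have "((2::real) ^ i)\<^sup>2 = 4 ^ i" by (simp add: power2_eq_square power_mult_distrib[symmetric])
      finally have u2: "u\<^sup>2 = 4 ^ i * \<kappa>" by (simp add: \<kappa>_def)
      have pow: "(48::real) \<le> 2 ^ i" by (rule order_trans[OF _ two_power_ge[OF i]]) simp
      have eps: "6 * \<epsilon> \<le> min u 1 / 4"
      proof -
        have "48 * (2 * \<epsilon> * \<sigma>) \<le> 2 ^ i * \<eta>" using pow \<eta> \<epsilon> \<sigma> by (intro mult_mono) auto
        then have "24 * \<epsilon> \<le> u" using \<sigma> by (simp add: u_def field_simps)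
        then show ?thesis using \<epsilon> by auto
      qed
      have "emeasure Q {\<xi> \<in> space Q. beats n N \<sigma> g \<nu> (X \<xi>)} \<le> ennreal (exp (- ln (1 + u\<^sup>2) / 52000)) ^ N"
        if g: "g \<in> shell i" for g
      proof -
        have d: "2 ^ i * \<eta> < vdist n \<nu> g" using g by (simp add: shell_def)
        have "4 * \<eta> \<le> 2 ^ i * \<eta>" using pow \<eta> by (intro mult_right_mono) auto
        then have "2 ^ i * \<eta> / 4 \<le> vdist n \<nu> g / 2 - \<eta>" using d by linarith
        then have "u \<le> (vdist n \<nu> g / 2 - \<eta>) / \<sigma>"
          using \<sigma> by (simp add: u_def field_simps)
        moreover have "0 < vdist n \<nu> g" using d \<eta>(2) by (meson less_trans mult_pos_pos zero_less_numeral zero_less_power)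
        ultimately show ?thesis
          unfolding Q_def X_def using \<mu> K(1)
          by (intro emeasure_beats_le[OF \<sigma> P C _ _ \<nu>(2) u _ eps]) auto
      qed
      then have "(\<Sum>g\<in>shell i. emeasure Q {\<xi> \<in> space Q. beats n N \<sigma> g \<nu> (X \<xi>)})
          \<le> (\<Sum>g\<in>shell i. ennreal (exp (- ln (1 + u\<^sup>2) / 52000)) ^ N)"
        by (rule sum_mono)
      also have "\<dots> = ennreal (real (card (shell i)) * exp (- ln (1 + u\<^sup>2) / 52000) ^ N)"
        by (simp add: ennreal_power ennreal_mult ennreal_of_nat_eq_real_of_nat)
      also have "\<dots> \<le> ennreal (exp L ^ (i + 2) * exp (- ln (1 + u\<^sup>2) / 52000) ^ N)"
        using card[of i] by (intro ennreal_leI mult_right_mono) auto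
      finally have "(\<Sum>g\<in>shell i. emeasure Q {\<xi> \<in> space Q. beats n N \<sigma> g \<nu> (X \<xi>)})
          \<le> ennreal (exp L ^ (i + 2) * exp (- ln (1 + u\<^sup>2) / 52000) ^ N)" .
      moreover have "emeasure Q (E i) \<le> (\<Sum>g\<in>shell i. emeasure Q {\<xi> \<in> space Q. beats n N \<sigma> g \<nu> (X \<xi>)})"
        unfolding E_def using fin by (intro emeasure_subadditive_finite) auto
      ultimately show ?thesis unfolding u2 by (rule order_trans[rotated])
    qed
    \<comment> \<open>A measurable majorant of the squared defeat radius of \<open>\<nu>\<close>:
      the supremum over rivals is replaced by a series that can be integrated termwise.\<close>
    define T where "T \<xi> = ennreal ((2 ^ 30 * \<eta>)\<^sup>2) + (\<Sum>j. ennreal (4 ^ (30 + j + 1) * \<eta>\<^sup>2) * indicator (E (30 + j)) \<xi>)" for \<xi>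
    have T[measurable]: "T \<in> borel_measurable Q" unfolding T_def by measurable
    have term_le_suminf: "f j \<le> (\<Sum>j. f j)" for f :: "nat \<Rightarrow> ennreal" and j
      using sum_le_suminf[OF summableI, of "{j}" f] by simp
    have beaten: "ennreal ((vdist n \<nu> g)\<^sup>2) \<le> T \<xi>"
      if \<xi>: "\<xi> \<in> space Q" and g: "g \<in> G" "beats n N \<sigma> g \<nu> (X \<xi>)" for g \<xi>
    proof (cases "vdist n \<nu> g \<le> 2 ^ 30 * \<eta>")
      case True
      then have "ennreal ((vdist n \<nu> g)\<^sup>2) \<le> ennreal ((2 ^ 30 * \<eta>)\<^sup>2)"
        by (intro ennreal_leI power_mono) auto
      then show ?thesis unfolding T_def by (rule add_increasing2[rotated]) simp
    next
      case False
      \<comment> \<open>The least dyadic radius reaching \<open>g\<close> has exponent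
        \<open>i > 30\<close>, and \<open>g\<close> lies in the shell with index
        \<open>i - 1\<close>.\<close>
      define P' where "P' i \<longleftrightarrow> vdist n \<nu> g \<le> 2 ^ i * \<eta>" for i
      obtain m where "vdist n \<nu> g / \<eta> < 2 ^ m" using real_arch_pow[of 2 "vdist n \<nu> g / \<eta>"] by auto
      then have "P' m" using \<eta>(2) by (simp add: P'_def field_simps)
      define i where "i = (LEAST i. P' i)"
      have i: "P' i" "\<And>j. j < i \<Longrightarrow> \<not> P' j"
        unfolding i_def by (rule LeastI[of P', OF \<open>P' m\<close>], rule not_less_Least)
      have "30 < i"
      proof (rule ccontr)
        assume "\<not> 30 < i"
        then have "(2::real) ^ i * \<eta> \<le> 2 ^ 30 * \<eta>" using \<eta>(2) by (intro mult_right_mono power_increasing) auto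
        then show False using i(1) False by (simp add: P'_def)
      qed
      then obtain j where j: "i = 30 + j + 1" using less_iff_Suc_add by auto
      have "g \<in> shell (30 + j)"
        using i(1) i(2)[of "30 + j"] g by (simp add: shell_def P'_def j not_le)
      then have "\<xi> \<in> E (30 + j)" using g \<xi> by (auto simp: E_def)
      have "(vdist n \<nu> g)\<^sup>2 \<le> (2 ^ i * \<eta>)\<^sup>2" using i(1) by (intro power_mono) (auto simp: P'_def)
      also have "\<dots> = 4 ^ (30 + j + 1) * \<eta>\<^sup>2"
        unfolding j by (simp add: power_mult_distrib power2_eq_square flip: power_mult_distrib)
      finally have "ennreal ((vdist n \<nu> g)\<^sup>2) \<le> ennreal (4 ^ (30 + j + 1) * \<eta>\<^sup>2) * indicator (E (30 + j)) \<xi>"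
        using \<open>\<xi> \<in> E (30 + j)\<close> by (simp add: ennreal_leI)
      also have "\<dots> \<le> (\<Sum>j. ennreal (4 ^ (30 + j + 1) * \<eta>\<^sup>2) * indicator (E (30 + j)) \<xi>)"
        by (rule term_le_suminf)
      finally show ?thesis unfolding T_def by (rule add_increasing[rotated]) simp
    qed
    have pointwise: "ennreal ((vdist n (est (X \<xi>)) \<mu>)\<^sup>2) \<le> ennreal (8 * \<eta>\<^sup>2) + 2 * T \<xi>" if \<xi>: "\<xi> \<in> space Q" for \<xi>
    proof (cases "T \<xi>")
      case top then show ?thesis by simp
    next
      case (real t)
      have "defeat_radius n N \<sigma> G \<nu> (X \<xi>) \<le> ennreal (sqrt t)"
        unfolding defeat_radius_def
      proof (rule SUP_least)
        fix g assume g: "g \<in> G"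
        show "(if beats n N \<sigma> g \<nu> (X \<xi>) then ennreal (vdist n \<nu> g) else 0) \<le> ennreal (sqrt t)"
          using beaten[OF \<xi> g] real by (auto intro!: ennreal_leI real_le_rsqrt)
      qed
      then have "ennreal (vdist n \<nu> (est (X \<xi>))) \<le> ennreal (sqrt t + \<eta>)"
        using order_trans[OF est_le[OF \<nu>(1)] add_right_mono] real \<eta>(2) by (simp add: ennreal_plus)
      then have "vdist n \<nu> (est (X \<xi>)) \<le> sqrt t + \<eta>"
        using real \<eta>(2) by (subst (asm) ennreal_le_iff) auto
      then have "vdist n (est (X \<xi>)) \<mu> \<le> sqrt t + 2 * \<eta>"
        using vdist_triangle[of n "est (X \<xi>)" \<mu> \<nu>] \<nu>(2) by (simp add: vdist_commute)
      then have "(vdist n (est (X \<xi>)) \<mu>)\<^sup>2 \<le> (sqrt t + 2 * \<eta>)\<^sup>2" by (intro power_mono) auto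
      also have "\<dots> \<le> 8 * \<eta>\<^sup>2 + 2 * t"
        using zero_le_power2[of "sqrt t - 2 * \<eta>"] real by (simp add: power2_eq_square algebra_simps)
      finally have "ennreal ((vdist n (est (X \<xi>)) \<mu>)\<^sup>2) \<le> ennreal (8 * \<eta>\<^sup>2 + 2 * t)" by (rule ennreal_leI)
      also have "\<dots> = ennreal (8 * \<eta>\<^sup>2) + 2 * T \<xi>" using real by (simp add: ennreal_plus ennreal_mult')
      finally show ?thesis .
    qed
    define B where "B = (4 * 2496000\<^sup>2 :: real)"
    have B: "0 \<le> B" by (simp add: B_def)
    have "(\<integral>\<^sup>+ \<xi>. T \<xi> \<partial>Q) = ennreal ((2 ^ 30 * \<eta>)\<^sup>2) + (\<Sum>j. ennreal (4 ^ (30 + j + 1) * \<eta>\<^sup>2) * emeasure Q (E (30 + j)))"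
      unfolding T_def
      by (subst nn_integral_add, simp, measurable, subst nn_integral_suminf, measurable)
         (simp add: nn_integral_cmult_indicator Q.emeasure_space_1)
    also have "(\<Sum>j. ennreal (4 ^ (30 + j + 1) * \<eta>\<^sup>2) * emeasure Q (E (30 + j))) \<le> (\<Sum>j. ennreal (\<eta>\<^sup>2 * B * (1 / 4) ^ j))"
    proof (rule suminf_le)
      fix j :: nat
      define i where "i = 30 + j"
      have "ennreal (4 ^ (i + 1) * \<eta>\<^sup>2) * emeasure Q (E i)
          \<le> ennreal (4 ^ (i + 1) * \<eta>\<^sup>2) * ennreal (exp L ^ (i + 2) * exp (- ln (1 + 4 ^ i * \<kappa>) / 52000) ^ N)"
        by (intro mult_left_mono prob_E) (auto simp: i_def)
      also have "\<dots> = ennreal (\<eta>\<^sup>2 * (4 ^ (i + 1) * (exp L ^ (i + 2) * exp (- ln (1 + 4 ^ i * \<kappa>) / 52000) ^ N)))"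
        by (subst ennreal_mult[symmetric]) (auto simp: algebra_simps)
      also have "\<dots> \<le> ennreal (\<eta>\<^sup>2 * (B * (1 / 4) ^ i))"
        unfolding B_def
      proof (intro ennreal_leI mult_left_mono shell_term_le)
        show "L \<le> 16 * real N * \<kappa>" using L_le(1) \<sigma> by (simp add: \<kappa>_def)
        show "1 / 6 \<le> real N * \<kappa>" using N(2) \<sigma> by (simp add: \<kappa>_def field_simps)
      qed (use \<kappa> L_le N in \<open>auto simp: i_def\<close>)
      also have "\<dots> \<le> ennreal (\<eta>\<^sup>2 * B * (1 / 4) ^ j)"
        unfolding mult.assoc using B
        by (intro ennreal_leI mult_left_mono power_decreasing) (auto simp: i_def)
      finally show "ennreal (4 ^ (30 + j + 1) * \<eta>\<^sup>2) * emeasure Q (E (30 + j)) \<le> ennreal (\<eta>\<^sup>2 * B * (1 / 4) ^ j)"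
        by (simp only: i_def)
    qed auto
    also have "(\<Sum>j. ennreal (\<eta>\<^sup>2 * B * (1 / 4) ^ j)) = ennreal (\<eta>\<^sup>2 * B * (4 / 3))"
    proof (rule suminf_ennreal_eq)
      show "(\<lambda>j. \<eta>\<^sup>2 * B * (1 / 4) ^ j) sums (\<eta>\<^sup>2 * B * (4 / 3))"
        using sums_mult[OF geometric_sums[of "1 / 4 :: real"], of "\<eta>\<^sup>2 * B"] by simp
    qed (use B in auto)
    finally have int_T: "(\<integral>\<^sup>+ \<xi>. T \<xi> \<partial>Q) \<le> ennreal ((2 ^ 30 * \<eta>)\<^sup>2) + ennreal (\<eta>\<^sup>2 * B * (4 / 3))"
      by (simp add: add_left_mono)
    have "risk n N est \<mu> P C = (\<integral>\<^sup>+ \<xi>. ennreal ((vdist n (est (X \<xi>)) \<mu>)\<^sup>2) \<partial>Q)"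
      by (simp add: risk_def X_def shift_sample_def Q_def)
    also have "\<dots> \<le> (\<integral>\<^sup>+ \<xi>. ennreal (8 * \<eta>\<^sup>2) + 2 * T \<xi> \<partial>Q)"
      by (intro nn_integral_mono pointwise)
    also have "\<dots> = ennreal (8 * \<eta>\<^sup>2) + 2 * (\<integral>\<^sup>+ \<xi>. T \<xi> \<partial>Q)"
      by (subst nn_integral_add) (auto simp: nn_integral_cmult Q.emeasure_space_1)
    also have "\<dots> \<le> ennreal (8 * \<eta>\<^sup>2) + 2 * (ennreal ((2 ^ 30 * \<eta>)\<^sup>2) + ennreal (\<eta>\<^sup>2 * B * (4 / 3)))"
      by (intro add_left_mono mult_left_mono int_T) simp
    also have "\<dots> = ennreal (8 * \<eta>\<^sup>2 + 2 * ((2 ^ 30 * \<eta>)\<^sup>2 + \<eta>\<^sup>2 * B * (4 / 3)))"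
    proof -
      have 2: "(2 :: ennreal) = ennreal 2" by simp
      show ?thesis
        unfolding 2 using B by (simp only: ennreal_plus ennreal_mult zero_le_power2 mult_nonneg_nonneg
            add_nonneg_nonneg divide_nonneg_nonneg zero_le_numeral)
    qed
    also have "8 * \<eta>\<^sup>2 + 2 * ((2 ^ 30 * \<eta>)\<^sup>2 + \<eta>\<^sup>2 * B * (4 / 3)) = upper_const * \<eta>\<^sup>2"
      by (simp add: upper_const_def B_def power_mult_distrib algebra_simps)
    finally show ?thesis .
  qed
  show ?thesis
    unfolding minimax_sym_def
    by (rule INF_lower2[OF est]) (intro SUP_least risk)
qed

section \<open>Uniform noise along a ray\<close>

definition unif :: "real measure" where
  "unif = uniform_measure lborel {- 1..1}"

lemma sets_unif [simp, measurable_cong]: "sets unif = sets borel"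
  by (simp add: unif_def)

lemma space_unif [simp]: "space unif = UNIV"
  by (simp add: unif_def)

lemma measurable_unif [simp]: "measurable unif M = measurable borel M"
  by (rule measurable_cong_sets) simp_all

lemma prob_space_unif: "prob_space unif"
  unfolding unif_def by (rule prob_space_uniform_measure) auto

lemma nn_integral_unif:
  assumes [measurable]: "f \<in> borel_measurable borel"
  shows "(\<integral>\<^sup>+ x. f x \<partial>unif) = (\<integral>\<^sup>+ x. f x * indicator {- 1..1} x \<partial>lborel) / 2"
  unfolding unif_def by (subst nn_integral_uniform_measure) auto

lemma AE_unif: "AE x in unif. \<bar>x\<bar> \<le> 1"
  unfolding unif_def by (rule AE_uniform_measureI) auto

lemma distr_unif_eqI:
  assumes [measurable]: "f \<in> borel_measurable borel" "g \<in> borel_measurable borel"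
    and "\<And>h :: real \<Rightarrow> ennreal. h \<in> borel_measurable borel \<Longrightarrow>
      (\<integral>\<^sup>+ x. h (f x) * indicator {- 1..1} x \<partial>lborel) = (\<integral>\<^sup>+ x. h (g x) * indicator {- 1..1} x \<partial>lborel)"
  shows "distr unif borel f = distr unif borel g"
proof (rule measure_eqI)
  fix A assume "A \<in> sets (distr unif borel f)"
  then have [measurable]: "A \<in> sets borel" by simp
  have *: "emeasure (distr unif borel k) A = (\<integral>\<^sup>+ x. indicator A (k x) * indicator {- 1..1} x \<partial>lborel) / 2"
    if [measurable]: "k \<in> borel_measurable borel" for k
  proof -
    have "emeasure (distr unif borel k) A = (\<integral>\<^sup>+ x. indicator A x \<partial>distr unif borel k)" by simp
    also have "\<dots> = (\<integral>\<^sup>+ x. indicator A (k x) \<partial>unif)" by (subst nn_integral_distr) auto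
    finally show ?thesis by (simp add: nn_integral_unif)
  qed
  show "emeasure (distr unif borel f) A = emeasure (distr unif borel g) A"
    using assms(3)[of "indicator A"] by (simp add: *)
qed simp

lemma distr_unif_uminus: "distr unif borel uminus = unif"
proof -
  have "distr unif borel uminus = distr unif borel (\<lambda>x. x)"
  proof (rule distr_unif_eqI)
    fix h :: "real \<Rightarrow> ennreal" assume [measurable]: "h \<in> borel_measurable borel"
    show "(\<integral>\<^sup>+ x. h (- x) * indicator {- 1..1} x \<partial>lborel) = (\<integral>\<^sup>+ x. h x * indicator {- 1..1} x \<partial>lborel)"
      by (subst nn_integral_real_affine[of _ "- 1" 0]) (auto simp: indicator_def intro!: nn_integral_cong)
  qed auto
  also have "\<dots> = unif" by (rule distr_id2) simp
  finally show ?thesis .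
qed

text \<open>Moving the mass of \<open>[-1, b - 1)\<close> to \<open>[1, b + 1)\<close> turns the uniform distribution on \<open>[-1, 1]\<close>
  into its translate by \<open>b\<close> while changing a fraction \<open>b / 2\<close> of the points only.\<close>

definition wrap :: "real \<Rightarrow> real \<Rightarrow> real" where
  "wrap b x = (if x < b - 1 then x + 2 else x)"

lemma measurable_wrap [measurable]: "wrap b \<in> borel_measurable borel"
  unfolding wrap_def by measurable

lemma distr_unif_wrap:
  assumes b: "0 \<le> b" "b \<le> 2"
  shows "distr unif borel (wrap b) = distr unif borel (\<lambda>x. b + x)"
proof (rule distr_unif_eqI)
  fix h :: "real \<Rightarrow> ennreal" assume [measurable]: "h \<in> borel_measurable borel"
  have "(\<integral>\<^sup>+ x. h (wrap b x) * indicator {- 1..1} x \<partial>lborel)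
      = (\<integral>\<^sup>+ x. h (x + 2) * indicator {- 1..<b - 1} x + h x * indicator {b - 1..1} x \<partial>lborel)"
    using b by (intro nn_integral_cong) (auto simp: wrap_def indicator_def)
  also have "\<dots> = (\<integral>\<^sup>+ x. h (x + 2) * indicator {- 1..<b - 1} x \<partial>lborel) + (\<integral>\<^sup>+ x. h x * indicator {b - 1..1} x \<partial>lborel)"
    by (rule nn_integral_add) auto
  also have "(\<integral>\<^sup>+ x. h (x + 2) * indicator {- 1..<b - 1} x \<partial>lborel) = (\<integral>\<^sup>+ x. h x * indicator {1..<b + 1} x \<partial>lborel)"
    by (subst nn_integral_real_affine[of _ 1 "- 2"]) (auto simp: indicator_def intro!: nn_integral_cong)
  also have "\<dots> + (\<integral>\<^sup>+ x. h x * indicator {b - 1..1} x \<partial>lborel)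
      = (\<integral>\<^sup>+ x. h x * indicator {1..<b + 1} x + h x * indicator {b - 1..1} x \<partial>lborel)"
    by (rule nn_integral_add[symmetric]) auto
  also have "\<dots> = (\<integral>\<^sup>+ x. h x * indicator {b - 1..b + 1} x \<partial>lborel)"
    \<comment> \<open>The two intervals overlap at 1 and miss \<open>b + 1\<close>, hence equality
      only almost everywhere.\<close>
    using AE_lborel_singleton[of 1] AE_lborel_singleton[of "b + 1"] b
    by (intro nn_integral_cong_AE) (auto simp: indicator_def elim!: eventually_elim2)
  also have "\<dots> = (\<integral>\<^sup>+ x. h (b + x) * indicator {- 1..1} x \<partial>lborel)"
    by (subst nn_integral_real_affine[of _ 1 b]) (auto simp: indicator_def intro!: nn_integral_cong)
  finally show "(\<integral>\<^sup>+ x. h (wrap b x) * indicator {- 1..1} x \<partial>lborel)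
    = (\<integral>\<^sup>+ x. h (b + x) * indicator {- 1..1} x \<partial>lborel)" .
qed auto

lemma emeasure_unif_lessThan:
  assumes "0 \<le> b" "b \<le> 2" shows "emeasure unif {x. x < b - 1} = ennreal (b / 2)"
proof -
  have "emeasure unif {x. x < b - 1} = (\<integral>\<^sup>+ x. indicator {x. x < b - 1} x \<partial>unif)"
    by (subst nn_integral_indicator) auto
  also have "\<dots> = (\<integral>\<^sup>+ x. indicator {- 1..<b - 1} x \<partial>lborel) / 2"
  proof -
    have "indicator {x. x < b - 1} x * indicator {- 1..1} x = (indicator {- 1..<b - 1} x :: ennreal)" for x
      using assms by (auto simp: indicator_def)
    then show ?thesis by (subst nn_integral_unif) auto
  qed
  also have "\<dots> = ennreal b / 2" using assms by simp
  finally show ?thesis using assms by (simp add: divide_ennreal flip: ennreal_numeral)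
qed

definition ray :: "nat \<Rightarrow> real \<Rightarrow> (nat \<Rightarrow> real) \<Rightarrow> real \<Rightarrow> (nat \<Rightarrow> real)" where
  "ray n \<sigma> v t = (\<lambda>k\<in>{..<n}. \<sigma> * t * v k)"

lemma measurable_ray [measurable]: "ray n \<sigma> v \<in> borel \<rightarrow>\<^sub>M borelRn n"
  unfolding ray_def borelRn_def by measurable

text \<open>The parameter satisfies \<open>\<bar>t\<bar> \<le> 1\<close> almost surely, so
  Cauchy-Schwarz bounds the covariance without computing the variance of the uniform law.\<close>

lemma ray_in_Xi_sym:
  assumes \<sigma>: "0 < \<sigma>" and v: "(\<Sum>k<n. (v k)\<^sup>2) = 1"
  shows "distr unif (borelRn n) (ray n \<sigma> v) \<in> Xi_sym n \<sigma>"
proof -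
  interpret U: prob_space unif by (rule prob_space_unif)
  have bounded: "integrable unif f" if [measurable]: "f \<in> borel_measurable borel" and "\<And>t. \<bar>t\<bar> \<le> 1 \<Longrightarrow> \<bar>f t\<bar> \<le> c"
    for f :: "real \<Rightarrow> real" and c
    using AE_unif that(2) by (intro U.integrable_const_bound[of _ c]) (auto elim!: eventually_mono)
  have [measurable]: "vneg n \<in> borelRn n \<rightarrow>\<^sub>M borelRn n"
    unfolding vneg_def borelRn_def by measurable
  have [measurable]: "vnorm n \<in> borel_measurable (borelRn n)"
    unfolding vnorm_def by measurable
  have [measurable]: "vinner n u \<in> borel_measurable (borelRn n)" for u
    unfolding vinner_def by measurable
  have "distr (distr unif (borelRn n) (ray n \<sigma> v)) (borelRn n) (vneg n) = distr unif (borelRn n) (vneg n \<circ> ray n \<sigma> v)"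
    by (rule distr_distr) auto
  also have "vneg n \<circ> ray n \<sigma> v = ray n \<sigma> v \<circ> uminus"
    by (auto simp: vneg_def ray_def fun_eq_iff)
  also have "distr unif (borelRn n) (ray n \<sigma> v \<circ> uminus) = distr (distr unif borel uminus) (borelRn n) (ray n \<sigma> v)"
    by (rule distr_distr[symmetric]) auto
  finally have sym: "distr (distr unif (borelRn n) (ray n \<sigma> v)) (borelRn n) (vneg n) = distr unif (borelRn n) (ray n \<sigma> v)"
    by (simp add: distr_unif_uminus)
  have norm: "(vnorm n (ray n \<sigma> v t))\<^sup>2 = (\<sigma> * t)\<^sup>2" for t
    using v by (simp add: vnorm_def sum_nonneg ray_def power_mult_distrib sum_distrib_left[symmetric])
  have sq: "integrable (distr unif (borelRn n) (ray n \<sigma> v)) (\<lambda>x. (vnorm n x)\<^sup>2)"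
    by (subst integrable_distr_eq) (auto simp: norm power_mult_distrib abs_square_le_1 mult_left_le
        intro!: bounded[of _ 1])
  have "(\<integral>t. - t \<partial>unif) = (\<integral>t. t \<partial>distr unif borel uminus)" by (subst integral_distr) auto
  then have mean0: "(\<integral>t. t \<partial>unif) = 0" by (simp add: distr_unif_uminus)
  have mean: "(\<integral>x. x i \<partial>distr unif (borelRn n) (ray n \<sigma> v)) = 0" if "i < n" for i
    using that by (subst integral_distr) (auto simp: ray_def mean0 mult.commute mult.left_commute)
  have cov: "(\<integral>x. (vinner n u x)\<^sup>2 \<partial>distr unif (borelRn n) (ray n \<sigma> v)) \<le> \<sigma>\<^sup>2 * (\<Sum>i<n. (u i)\<^sup>2)" for u
  proof -
    have vi: "vinner n u (ray n \<sigma> v t) = \<sigma> * t * (\<Sum>i<n. u i * v i)" for t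
      by (simp add: vinner_def ray_def sum_distrib_left algebra_simps)
    have cs: "(\<Sum>i<n. u i * v i)\<^sup>2 \<le> (\<Sum>i<n. (u i)\<^sup>2)"
      using power_mono[OF sum_mult_le_vnorm[of u v n], of 2] v
      by (simp add: power_mult_distrib vnorm_def sum_nonneg)
    have "(\<integral>x. (vinner n u x)\<^sup>2 \<partial>distr unif (borelRn n) (ray n \<sigma> v)) = (\<integral>t. (\<sigma> * t * (\<Sum>i<n. u i * v i))\<^sup>2 \<partial>unif)"
      by (subst integral_distr) (auto simp: vi)
    also have "\<dots> \<le> (\<integral>t. \<sigma>\<^sup>2 * (\<Sum>i<n. (u i)\<^sup>2) \<partial>unif)"
    proof (rule integral_mono_AE)
      have le: "(\<sigma> * t * (\<Sum>i<n. u i * v i))\<^sup>2 \<le> \<sigma>\<^sup>2 * (\<Sum>i<n. (u i)\<^sup>2)" if "\<bar>t\<bar> \<le> 1" for t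
      proof -
        have "t\<^sup>2 * (\<Sum>i<n. u i * v i)\<^sup>2 \<le> 1 * (\<Sum>i<n. (u i)\<^sup>2)"
          using that cs by (intro mult_mono) (auto simp: abs_square_le_1)
        then show ?thesis by (simp add: power_mult_distrib mult.assoc mult_left_mono)
      qed
      then show "AE t in unif. (\<sigma> * t * (\<Sum>i<n. u i * v i))\<^sup>2 \<le> \<sigma>\<^sup>2 * (\<Sum>i<n. (u i)\<^sup>2)"
        using AE_unif by (auto elim!: eventually_mono)
      show "integrable unif (\<lambda>t. (\<sigma> * t * (\<Sum>i<n. u i * v i))\<^sup>2)"
        using le by (intro bounded[of _ "\<sigma>\<^sup>2 * (\<Sum>i<n. (u i)\<^sup>2)"]) auto
    qed simp
    finally show ?thesis using U.prob_space by simp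
  qed
  show ?thesis
    unfolding Xi_sym_def using sym sq mean cov U.prob_space_distr[of "ray n \<sigma> v" "borelRn n"] by simp
qed

section \<open>Lower bound from contamination\<close>

text \<open>Lets both hypotheses of the two-point argument be expressed through one sample of
  uniform parameters.\<close>

lemma PiM_distr_iid:
  assumes I: "finite I" and M: "prob_space M" and f[measurable]: "f \<in> M \<rightarrow>\<^sub>M M'"
  shows "PiM I (\<lambda>_. distr M M' f) = distr (PiM I (\<lambda>_. M)) (PiM I (\<lambda>_. M')) (\<lambda>x. \<lambda>i\<in>I. f (x i))"
proof -
  let ?D = "distr M M' f"
  have D: "prob_space ?D" using M by (simp add: prob_space.prob_space_distr)
  have "distr (PiM I (\<lambda>_. M)) (PiM I (\<lambda>_. ?D)) (compose I f) = PiM I (\<lambda>_. distr M ?D f)"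
    using I M D by (intro distr_PiM_finite_prob_space') auto
  moreover have "distr M ?D f = ?D" by (rule distr_cong) auto
  moreover have "distr (PiM I (\<lambda>_. M)) (PiM I (\<lambda>_. ?D)) (compose I f)
      = distr (PiM I (\<lambda>_. M)) (PiM I (\<lambda>_. M')) (\<lambda>x. \<lambda>i\<in>I. f (x i))"
    by (rule distr_cong) (auto simp: compose_def intro!: sets_PiM_cong)
  ultimately show ?thesis by simp
qed

lemma nn_integral_PiM_distr_iid:
  assumes I: "finite I" and M: "prob_space M" and f[measurable]: "f \<in> M \<rightarrow>\<^sub>M M'"
    and h[measurable]: "h \<in> borel_measurable (PiM I (\<lambda>_. M'))"
  shows "(\<integral>\<^sup>+ x. h x \<partial>PiM I (\<lambda>_. distr M M' f)) = (\<integral>\<^sup>+ x. h (\<lambda>i\<in>I. f (x i)) \<partial>PiM I (\<lambda>_. M))"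
  unfolding PiM_distr_iid[OF I M f] by (subst nn_integral_distr) auto

text \<open>Markov's inequality: the expected number of wrapped points is \<open>N * b / 2\<close>,
  against a budget of \<open>\<epsilon> * N\<close>.\<close>

lemma unif_sample_few_wrapped:
  assumes b: "0 \<le> b" "b \<le> 2" and \<epsilon>: "0 < \<epsilon>" and N: "0 < N"
  defines "Q \<equiv> PiM {..<N} (\<lambda>_. unif)"
  shows "1 - b / (2 * \<epsilon>) \<le> measure Q {\<tau> \<in> space Q. (\<Sum>i<N. if \<tau> i < b - 1 then 1 else 0) \<le> \<epsilon> * real N}"
proof -
  interpret Q: prob_space Q unfolding Q_def by (intro prob_space_PiM prob_space_unif)
  have comp: "(\<integral>\<^sup>+ \<tau>. indicator {x. x < b - 1} (\<tau> i) \<partial>Q) = ennreal (b / 2)" if "i < N" for i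
  proof -
    have "(\<integral>\<^sup>+ \<tau>. indicator {x. x < b - 1} (\<tau> i) \<partial>Q) = (\<integral>\<^sup>+ x. indicator {x. x < b - 1} x \<partial>distr Q unif (\<lambda>\<tau>. \<tau> i))"
      unfolding Q_def using that by (subst nn_integral_distr) auto
    also have "distr Q unif (\<lambda>\<tau>. \<tau> i) = unif"
      unfolding Q_def using that by (intro distr_PiM_component prob_space_unif) auto
    also have "(\<integral>\<^sup>+ x. indicator {x. x < b - 1} x \<partial>unif) = ennreal (b / 2)"
      using emeasure_unif_lessThan[OF b] by simp
    finally show ?thesis .
  qed
  let ?G = "{\<tau> \<in> space Q. (\<Sum>i<N. if \<tau> i < b - 1 then 1 else 0) \<le> \<epsilon> * real N}"
  have G[measurable]: "?G \<in> sets Q" unfolding Q_def by measurable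
  have "ennreal (measure Q (space Q - ?G)) = (\<integral>\<^sup>+ \<tau>. indicator (space Q - ?G) \<tau> \<partial>Q)"
    by (simp add: Q.emeasure_eq_measure)
  also have "\<dots> \<le> (\<integral>\<^sup>+ \<tau>. ennreal (1 / (\<epsilon> * real N)) * (\<Sum>i<N. indicator {x. x < b - 1} (\<tau> i)) \<partial>Q)"
  proof (rule nn_integral_mono)
    fix \<tau> assume \<tau>: "\<tau> \<in> space Q"
    define s where "s = (\<Sum>i<N. if \<tau> i < b - 1 then 1 else 0 :: real)"
    have s: "0 \<le> s" unfolding s_def by (intro sum_nonneg) auto
    have "(\<Sum>i<N. indicator {x. x < b - 1} (\<tau> i)) = (\<Sum>i<N. ennreal (if \<tau> i < b - 1 then 1 else 0))"
      by (intro sum.cong) (auto simp: indicator_def)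
    also have "\<dots> = ennreal s" unfolding s_def by (rule sum_ennreal) auto
    finally have eq: "(\<Sum>i<N. indicator {x. x < b - 1} (\<tau> i)) = ennreal s" .
    then have "ennreal (1 / (\<epsilon> * real N)) * (\<Sum>i<N. indicator {x. x < b - 1} (\<tau> i)) = ennreal (1 / (\<epsilon> * real N) * s)"
      using \<epsilon> s by (subst ennreal_mult) auto
    moreover have "1 \<le> 1 / (\<epsilon> * real N) * s" if "\<tau> \<in> space Q - ?G"
    proof -
      have "\<not> s \<le> \<epsilon> * real N" using that by (auto simp: s_def)
      then show ?thesis using \<epsilon> N by (simp add: field_simps)
    qed
    ultimately show "indicator (space Q - ?G) \<tau> \<le> ennreal (1 / (\<epsilon> * real N)) * (\<Sum>i<N. indicator {x. x < b - 1} (\<tau> i))"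
      by (simp add: indicator_def)
  qed
  also have "\<dots> = ennreal (1 / (\<epsilon> * real N)) * (\<Sum>i<N. \<integral>\<^sup>+ \<tau>. indicator {x. x < b - 1} (\<tau> i) \<partial>Q)"
    unfolding Q_def by (subst nn_integral_cmult, measurable) (subst nn_integral_sum, auto)
  also have "\<dots> = ennreal (1 / (\<epsilon> * real N) * (real N * (b / 2)))"
    using comp b \<epsilon> by (simp add: ennreal_of_nat_eq_real_of_nat flip: ennreal_mult')
  also have "1 / (\<epsilon> * real N) * (real N * (b / 2)) = b / (2 * \<epsilon>)" using N \<epsilon> by simp
  finally have "measure Q (space Q - ?G) \<le> b / (2 * \<epsilon>)" using b \<epsilon> by simp
  then show ?thesis using Q.prob_compl[OF G] by simp
qed

text \<open>Two-point argument: when wrapping stays within budget, the corrupted sample from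
  \<open>\<mu>0\<close> is \<open>\<Phi>\<close> of the wrapped parameters, which has the law of the
  clean sample from \<open>\<mu>1\<close>. The factor \<open>3 / 16\<close> is \<open>1 / 2\<close>
  for the two losses, \<open>3 / 4\<close> for the good event and \<open>1 / 2\<close> for the
  larger of two risks.\<close>

lemma minimax_sym_ge_contamination:
  assumes \<sigma>: "0 < \<sigma>" and \<epsilon>: "0 < \<epsilon>" "\<epsilon> \<le> 1" and N: "0 < N" and K: "K \<subseteq> Rn n"
    and \<mu>: "\<mu>0 \<in> K" "\<mu>1 \<in> K" and le: "vdist n \<mu>0 \<mu>1 \<le> \<epsilon> * \<sigma> / 2"
  shows "ennreal (3 / 16 * (vdist n \<mu>0 \<mu>1)\<^sup>2) \<le> minimax_sym n N K \<sigma> \<epsilon>"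
proof (cases "vdist n \<mu>0 \<mu>1 = 0")
  case False
  define h where "h = vdist n \<mu>0 \<mu>1"
  have h: "0 < h" using False by (simp add: h_def order_less_le)
  define b where "b = h / \<sigma>"
  have "b \<le> \<epsilon> / 2" using le \<sigma> by (simp add: b_def h_def[symmetric] field_simps)
  moreover from this have "b \<le> 2" using \<epsilon> by linarith
  ultimately have b: "0 \<le> b" "b \<le> 2" "b \<le> \<epsilon> / 2" "\<sigma> * b = h"
    using \<sigma> h by (auto simp: b_def)
  define v where "v k = (\<mu>1 k - \<mu>0 k) / h" for k
  have v: "(\<Sum>k<n. (v k)\<^sup>2) = 1"
  proof -
    have "(\<Sum>k<n. (\<mu>1 k - \<mu>0 k)\<^sup>2) = h\<^sup>2"
      unfolding h_def vdist_commute[of n \<mu>0] vdist_power2 ..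
    then show ?thesis using h by (simp add: v_def power_divide sum_divide_distrib[symmetric])
  qed
  let ?ray = "ray n \<sigma> v"
  define P where "P = distr unif (borelRn n) ?ray"
  have P: "P \<in> Xi_sym n \<sigma>" unfolding P_def by (rule ray_in_Xi_sym[OF \<sigma> v])
  define Q where "Q = PiM {..<N} (\<lambda>_. unif)"
  interpret Q: prob_space Q unfolding Q_def by (intro prob_space_PiM prob_space_unif)
  define \<Phi> where "\<Phi> \<tau> = (\<lambda>i\<in>{..<N}. vadd n \<mu>0 (?ray (\<tau> i)))" for \<tau> :: "nat \<Rightarrow> real"
  have \<Phi>[measurable]: "\<Phi> \<in> Q \<rightarrow>\<^sub>M sample_space n N"
    supply measurable_borelRn_component[measurable del]
    unfolding \<Phi>_def Q_def sample_space_def by measurable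
  have shift: "vadd n \<mu>1 (?ray t) = vadd n \<mu>0 (?ray (b + t))" for t
  proof -
    have "\<mu>1 k = \<mu>0 k + h * v k" for k using h by (simp add: v_def)
    then show ?thesis by (auto simp: vadd_def ray_def b(4)[symmetric] algebra_simps)
  qed
  \<comment> \<open>The adversary recovers the uniform parameter of an observed point by projecting
    onto \<open>v\<close>.\<close>
  define co where "co x = (\<Sum>k<n. (x k - \<mu>0 k) * v k) / \<sigma>" for x
  have co: "co (vadd n \<mu>0 (?ray t)) = t" for t
  proof -
    have "(\<Sum>k<n. (vadd n \<mu>0 (?ray t) k - \<mu>0 k) * v k) = (\<Sum>k<n. \<sigma> * t * (v k)\<^sup>2)"
      by (intro sum.cong) (auto simp: vadd_def ray_def power2_eq_square)
    also have "\<dots> = \<sigma> * t" unfolding sum_distrib_left[symmetric] v by simp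
    finally show ?thesis using \<sigma> by (simp add: co_def)
  qed
  have [measurable]: "co \<in> borel_measurable (borelRn n)" unfolding co_def by measurable
  \<comment> \<open>If too many points would have to be moved, the sample is left alone, so the
    budget holds for every sample and not just with high probability.\<close>
  define C where "C x = (if (\<Sum>i<N. if co (x i) < b - 1 then 1 else 0) \<le> \<epsilon> * real N
     then (\<lambda>i\<in>{..<N}. if co (x i) < b - 1 then vadd n (?ray 2) (x i) else x i) else x)" for x
  have C: "C \<in> adversaries n N \<epsilon>"
    unfolding adversaries_def
  proof (intro CollectI conjI ballI)
    have [measurable]: "(\<lambda>x. x i) \<in> sample_space n N \<rightarrow>\<^sub>M borelRn n" if "i \<in> {..<N}" for i
      using that unfolding sample_space_def by measurable
    have [measurable]: "(\<lambda>x. \<lambda>i\<in>{..<N}. if co (x i) < b - 1 then vadd n (?ray 2) (x i) else x i)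
        \<in> sample_space n N \<rightarrow>\<^sub>M sample_space n N"
      by (subst (2) sample_space_def, rule measurable_restrict) measurable
    show "C \<in> sample_space n N \<rightarrow>\<^sub>M sample_space n N" unfolding C_def by measurable
    fix x
    show "real (card {i \<in> {..<N}. C x i \<noteq> x i}) \<le> \<epsilon> * real N"
    proof (cases "(\<Sum>i<N. if co (x i) < b - 1 then 1 else 0) \<le> \<epsilon> * real N")
      case True
      have "card {i \<in> {..<N}. C x i \<noteq> x i} \<le> card {i \<in> {..<N}. co (x i) < b - 1}"
        by (rule card_mono) (auto simp: C_def True)
      also have "real \<dots> = (\<Sum>i<N. if co (x i) < b - 1 then 1 else 0)"
        by (simp add: sum.If_cases) (simp add: Int_def)
      finally show ?thesis using True by simp
    next
      case False
      then show ?thesis using \<epsilon> by (simp add: C_def)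
    qed
  qed
  define G where "G = {\<tau> \<in> space Q. (\<Sum>i<N. if \<tau> i < b - 1 then 1 else 0) \<le> \<epsilon> * real N}"
  have G[measurable]: "G \<in> sets Q"
    supply measurable_borelRn_component[measurable del]
    unfolding G_def Q_def by measurable
  \<comment> \<open>This is where the separation of at most \<open>\<epsilon> * \<sigma> / 2\<close>
    is used.\<close>
  have "b / (2 * \<epsilon>) \<le> 1 / 4" using b(3) \<epsilon> by (simp add: field_simps)
  then have measure_G: "3 / 4 \<le> measure Q G"
    using unif_sample_few_wrapped[OF b(1,2) \<epsilon>(1) N] unfolding G_def Q_def by linarith
  let ?W = "\<lambda>\<tau>. \<lambda>i\<in>{..<N}. wrap b (\<tau> i)"
  have W[measurable]: "?W \<in> Q \<rightarrow>\<^sub>M Q"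
    supply measurable_borelRn_component[measurable del]
    unfolding Q_def by measurable
  have C_\<Phi>: "C (\<Phi> \<tau>) = \<Phi> (?W \<tau>)" if "\<tau> \<in> G" for \<tau>
  proof -
    have "(\<Sum>i<N. if co (\<Phi> \<tau> i) < b - 1 then 1 else 0) = (\<Sum>i<N. if \<tau> i < b - 1 then 1 else 0 :: real)"
      by (intro sum.cong) (auto simp: \<Phi>_def co)
    moreover have "vadd n (?ray 2) (vadd n \<mu>0 (?ray t)) = vadd n \<mu>0 (?ray (t + 2))" for t
      by (auto simp: vadd_def ray_def algebra_simps)
    ultimately show ?thesis using that
      by (auto simp: C_def G_def \<Phi>_def co wrap_def intro!: restrict_ext)
  qed
  show ?thesis
  proof (rule minimax_sym_geI)
    fix est assume "est \<in> estimators n N"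
    then have [measurable]: "est \<in> sample_space n N \<rightarrow>\<^sub>M borelRn n" by (simp add: estimators_def)
    have risk: "risk n N est \<mu> P D = (\<integral>\<^sup>+ \<tau>. ennreal ((vdist n (est (D (\<lambda>i\<in>{..<N}. vadd n \<mu> (?ray (\<tau> i))))) \<mu>)\<^sup>2) \<partial>Q)"
      if "D \<in> adversaries n N \<epsilon>" for \<mu> D
    proof -
      have [measurable]: "D \<in> sample_space n N \<rightarrow>\<^sub>M sample_space n N" using that by (simp add: adversaries_def)
      have [measurable]: "(\<lambda>\<xi>. \<lambda>i\<in>{..<N}. vadd n \<mu> (\<xi> i)) \<in> PiM {..<N} (\<lambda>_. borelRn n) \<rightarrow>\<^sub>M sample_space n N"
        unfolding sample_space_def by measurable
      have "risk n N est \<mu> P D = (\<integral>\<^sup>+ \<tau>. ennreal ((vdist n (est (D (\<lambda>i\<in>{..<N}. vadd n \<mu> ((\<lambda>i\<in>{..<N}. ?ray (\<tau> i)) i)))) \<mu>)\<^sup>2) \<partial>Q)"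
        unfolding risk_def P_def Q_def
        by (rule nn_integral_PiM_distr_iid[OF _ prob_space_unif]) auto
      then show ?thesis by (simp cong: restrict_cong)
    qed
    define g where "g \<mu> x = ennreal ((vdist n (est x) \<mu>)\<^sup>2)" for \<mu> x
    have [measurable]: "g \<mu> \<in> borel_measurable (sample_space n N)" for \<mu> unfolding g_def by measurable
    have "(\<integral>\<^sup>+ \<tau>. indicator G \<tau> * g \<mu>0 (\<Phi> (?W \<tau>)) \<partial>Q) \<le> (\<integral>\<^sup>+ \<tau>. g \<mu>0 (C (\<Phi> \<tau>)) \<partial>Q)"
      by (intro nn_integral_mono) (auto simp: indicator_def C_\<Phi>)
    also have "\<dots> = risk n N est \<mu>0 P C" using risk[OF C, of \<mu>0] by (simp add: g_def \<Phi>_def)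
    finally have r0: "(\<integral>\<^sup>+ \<tau>. indicator G \<tau> * g \<mu>0 (\<Phi> (?W \<tau>)) \<partial>Q) \<le> risk n N est \<mu>0 P C" .
    \<comment> \<open>Under \<open>\<mu>1\<close> the parameters are translated by \<open>b\<close>,
      which has the same law as wrapping; both risks are then compared on the same event
      \<open>G\<close> and the same data.\<close>
    have "risk n N est \<mu>1 P (\<lambda>x. x) = (\<integral>\<^sup>+ \<tau>. g \<mu>1 (\<Phi> (\<lambda>i\<in>{..<N}. b + \<tau> i)) \<partial>Q)"
      using \<epsilon> by (subst risk) (auto simp: id_in_adversaries g_def \<Phi>_def shift cong: restrict_cong)
    also have "\<dots> = (\<integral>\<^sup>+ \<tau>. g \<mu>1 (\<Phi> \<tau>) \<partial>PiM {..<N} (\<lambda>_. distr unif unif (\<lambda>x. b + x)))"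
      unfolding Q_def by (rule nn_integral_PiM_distr_iid[OF _ prob_space_unif, symmetric]) (auto simp flip: Q_def)
    also have "distr unif unif (\<lambda>x. b + x) = distr unif unif (wrap b)"
    proof -
      have "distr unif unif f = distr unif borel f" for f by (rule distr_cong) auto
      then show ?thesis using distr_unif_wrap[OF b(1,2)] by simp
    qed
    also have "(\<integral>\<^sup>+ \<tau>. g \<mu>1 (\<Phi> \<tau>) \<partial>PiM {..<N} (\<lambda>_. distr unif unif (wrap b))) = (\<integral>\<^sup>+ \<tau>. g \<mu>1 (\<Phi> (?W \<tau>)) \<partial>Q)"
      unfolding Q_def by (rule nn_integral_PiM_distr_iid[OF _ prob_space_unif]) (auto simp flip: Q_def)
    also have "\<dots> \<ge> (\<integral>\<^sup>+ \<tau>. indicator G \<tau> * g \<mu>1 (\<Phi> (?W \<tau>)) \<partial>Q)"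
      by (intro nn_integral_mono) (auto simp: indicator_def)
    finally have r1: "(\<integral>\<^sup>+ \<tau>. indicator G \<tau> * g \<mu>1 (\<Phi> (?W \<tau>)) \<partial>Q) \<le> risk n N est \<mu>1 P (\<lambda>x. x)" .
    have two_points: "ennreal (h\<^sup>2 / 2) \<le> g \<mu>0 x + g \<mu>1 x" for x
    proof -
      have "h \<le> vdist n (est x) \<mu>0 + vdist n (est x) \<mu>1"
        unfolding h_def vdist_commute[of n "est x" \<mu>0] by (rule vdist_triangle)
      then have "h\<^sup>2 \<le> (vdist n (est x) \<mu>0 + vdist n (est x) \<mu>1)\<^sup>2" using h by (intro power_mono) auto
      also have "\<dots> \<le> 2 * ((vdist n (est x) \<mu>0)\<^sup>2 + (vdist n (est x) \<mu>1)\<^sup>2)"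
        using zero_le_power2[of "vdist n (est x) \<mu>0 - vdist n (est x) \<mu>1"]
        by (simp add: power2_eq_square algebra_simps)
      finally show ?thesis by (simp add: g_def flip: ennreal_plus)
    qed
    have "ennreal (3 / 8 * h\<^sup>2) \<le> ennreal (h\<^sup>2 / 2 * measure Q G)"
      using measure_G mult_left_mono[of "3 / 4" "measure Q G" "h\<^sup>2 / 2"] by (intro ennreal_leI) simp
    also have "\<dots> = (\<integral>\<^sup>+ \<tau>. ennreal (h\<^sup>2 / 2) * indicator G \<tau> \<partial>Q)"
      by (subst ennreal_mult) (auto simp: nn_integral_cmult Q.emeasure_eq_measure)
    also have "\<dots> \<le> (\<integral>\<^sup>+ \<tau>. indicator G \<tau> * g \<mu>0 (\<Phi> (?W \<tau>)) + indicator G \<tau> * g \<mu>1 (\<Phi> (?W \<tau>)) \<partial>Q)"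
      using two_points by (intro nn_integral_mono) (auto simp: indicator_def)
    also have "\<dots> = (\<integral>\<^sup>+ \<tau>. indicator G \<tau> * g \<mu>0 (\<Phi> (?W \<tau>)) \<partial>Q) + (\<integral>\<^sup>+ \<tau>. indicator G \<tau> * g \<mu>1 (\<Phi> (?W \<tau>)) \<partial>Q)"
      by (rule nn_integral_add) measurable
    also have "\<dots> \<le> risk n N est \<mu>0 P C + risk n N est \<mu>1 P (\<lambda>x. x)"
      by (intro add_mono r0 r1)
    finally have sum: "ennreal (3 / 8 * h\<^sup>2) \<le> risk n N est \<mu>0 P C + risk n N est \<mu>1 P (\<lambda>x. x)" .
    have "ennreal (3 / 16 * h\<^sup>2) \<le> risk n N est \<mu>0 P C \<or> ennreal (3 / 16 * h\<^sup>2) \<le> risk n N est \<mu>1 P (\<lambda>x. x)"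
    proof (rule ccontr)
      assume "\<not> ?thesis"
      then have "risk n N est \<mu>0 P C + risk n N est \<mu>1 P (\<lambda>x. x) < ennreal (3 / 16 * h\<^sup>2) + ennreal (3 / 16 * h\<^sup>2)"
        by (intro add_strict_mono) auto
      also have "\<dots> = ennreal (3 / 8 * h\<^sup>2)" by (simp flip: ennreal_plus)
      finally show False using sum by simp
    qed
    then show "\<exists>\<mu>\<in>K. \<exists>P\<in>Xi_sym n \<sigma>. \<exists>C\<in>adversaries n N \<epsilon>. ennreal (3 / 16 * (vdist n \<mu>0 \<mu>1)\<^sup>2) \<le> risk n N est \<mu> P C"
      using P C id_in_adversaries[of \<epsilon>] \<epsilon> \<mu> unfolding h_def[symmetric] by (meson less_imp_le)
  qed
qed simp

section \<open>The minimax rate\<close>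

lemma eln_ereal_exp: "eln (ereal (exp L)) = ereal L"
  by (simp add: eln_def)

section \<open>Diameter and points far from a given one\<close>

lemma vdist_le_diam:
  assumes "vbounded n K" "x \<in> K" "y \<in> K"
  shows "vdist n x y \<le> diam n K"
proof -
  obtain B where "\<And>x y. x \<in> K \<Longrightarrow> y \<in> K \<Longrightarrow> vdist n x y \<le> B" using assms(1) by (auto simp: vbounded_def)
  then have "bdd_above {vdist n x y |x y. x \<in> K \<and> y \<in> K}" by (intro bdd_aboveI[of _ B]) auto
  then show ?thesis unfolding diam_def using assms(2,3) by (intro cSup_upper) auto
qed

lemma diam_le:
  assumes "k \<in> K" "\<And>x y. x \<in> K \<Longrightarrow> y \<in> K \<Longrightarrow> vdist n x y \<le> B"
  shows "diam n K \<le> B"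
  unfolding diam_def using assms by (intro cSup_least) auto

text \<open>A third instead of a half because the diameter is a supremum: points all strictly within
  half of it would give no contradiction.\<close>

lemma exists_far_point:
  assumes k: "k \<in> K" and d: "0 < diam n K"
  shows "\<exists>x\<in>K. diam n K / 3 \<le> vdist n k x"
proof (rule ccontr)
  assume "\<not> ?thesis"
  then have lt: "vdist n k x < diam n K / 3" if "x \<in> K" for x using that by force
  have "vdist n x y \<le> 2 * diam n K / 3" if "x \<in> K" "y \<in> K" for x y
    using vdist_triangle[of n x y k] lt[OF that(1)] lt[OF that(2)] by (simp add: vdist_commute[of n x k])
  then have "diam n K \<le> 2 * diam n K / 3" by (rule diam_le[OF k])
  then show False using d by simp
qed

lemma exists_far_unbounded:
  assumes "\<not> vbounded n K" and k: "k \<in> K"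
  shows "\<exists>x\<in>K. r \<le> vdist n k x"
proof (rule ccontr)
  assume "\<not> ?thesis"
  then have lt: "vdist n k x < r" if "x \<in> K" for x using that by force
  have "vdist n x y \<le> 2 * r" if "x \<in> K" "y \<in> K" for x y
    using vdist_triangle[of n x y k] lt[OF that(1)] lt[OF that(2)] by (simp add: vdist_commute[of n x k])
  then show False using assms(1) unfolding vbounded_def by blast
qed

lemma minimax_sym_le_diam:
  assumes K: "K \<subseteq> Rn n" "k \<in> K" and b: "vbounded n K"
  shows "minimax_sym n N K \<sigma> \<epsilon> \<le> ennreal ((diam n K)\<^sup>2)"
proof -
  have est: "(\<lambda>_. k) \<in> estimators n N"
    unfolding estimators_def using K by (intro measurable_const) auto
  have "risk n N (\<lambda>_. k) \<mu> P C \<le> ennreal ((diam n K)\<^sup>2)" if "\<mu> \<in> K" "P \<in> Xi_sym n \<sigma>" for \<mu> P C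
  proof -
    interpret prob_space "PiM {..<N} (\<lambda>_. P)" by (rule prob_space_PiM_Xi_sym[OF that(2)])
    have "risk n N (\<lambda>_. k) \<mu> P C = ennreal ((vdist n k \<mu>)\<^sup>2)"
      by (simp add: risk_def emeasure_space_1)
    also have "\<dots> \<le> ennreal ((diam n K)\<^sup>2)"
      using vdist_le_diam[OF b K(2) that(1)] by (intro ennreal_leI power_mono) auto
    finally show ?thesis .
  qed
  then show ?thesis
    unfolding minimax_sym_def by (intro INF_lower2[OF est] SUP_least)
qed

text \<open>Instantiates the universal constants: \<open>c = 20\<close>, \<open>Q = 24\<close>,
  \<open>C0 = 400000\<close>. The bound \<open>1 / 24\<close> keeps the allowance
  \<open>6 * \<epsilon>\<close> below the limit \<open>1 / 4\<close> of the test.\<close>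

locale minimax_setting =
  fixes n N :: nat and K :: "(nat \<Rightarrow> real) set" and \<sigma> \<epsilon> :: real and k0 :: "nat \<Rightarrow> real"
  assumes N: "1 \<le> N" and K: "K \<subseteq> Rn n" "star_centre n K k0"
    and \<sigma>: "0 < \<sigma>" and \<epsilon>: "0 < \<epsilon>" "\<epsilon> \<le> 1 / 24"
    and entropy: "ereal (real N) \<ge> ereal 400000 * (SUP \<delta> \<in> {0<..}. eln (Mloc n K \<delta> 20))"
begin

definition \<delta>s :: real where "\<delta>s = delta_star n K 20 N \<sigma>"

definition \<rho> :: real where "\<rho> = max \<delta>s (\<epsilon> * \<sigma>)"

definition admissible :: "real set" where
  "admissible = {\<delta>. \<delta> \<ge> 0 \<and> ereal (real N * \<delta>^2 / \<sigma>^2) \<le> eln (Mloc n K \<delta> 20)}"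

lemma \<delta>s_eq: "\<delta>s = Sup admissible"
  by (simp add: \<delta>s_def delta_star_def admissible_def)

lemma k0: "k0 \<in> K"
  using K by (simp add: star_centre_def)

text \<open>A finite \<open>N\<close> dominating the entropy excludes an infinite packing number,
  and the exponential form turns \<open>eln\<close> into the real number \<open>L\<close>.\<close>

lemma Mloc_eq_exp:
  assumes "0 < \<delta>"
  obtains L where "Mloc n K \<delta> 20 = ereal (exp L)" "L \<le> real N / 400000"
proof -
  have "eln (Mloc n K \<delta> 20) \<le> (SUP \<delta> \<in> {0<..}. eln (Mloc n K \<delta> 20))"
    using assms by (intro SUP_upper) auto
  then have "ereal 400000 * eln (Mloc n K \<delta> 20) \<le> ereal 400000 * (SUP \<delta> \<in> {0<..}. eln (Mloc n K \<delta> 20))"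
    by (intro ereal_mult_left_mono) auto
  also have "\<dots> \<le> ereal (real N)" by (rule entropy)
  finally have le: "ereal 400000 * eln (Mloc n K \<delta> 20) \<le> ereal (real N)" .
  have ge: "1 \<le> Mloc n K \<delta> 20" using Mloc_ge_1[OF K(1) k0] assms by simp
  show ?thesis
  proof (cases "Mloc n K \<delta> 20")
    case (real m)
    then have m: "1 \<le> m" using ge by simp
    then have eq: "Mloc n K \<delta> 20 = ereal (exp (ln m))" using real by simp
    then have "400000 * ln m \<le> real N" using le by (simp add: eln_ereal_exp del: exp_ln)
    then show ?thesis using that[OF eq] by simp
  next
    case PInf
    then show ?thesis using le by (simp add: eln_def)
  next
    case MInf
    then show ?thesis using ge by simp
  qed
qed

lemma zero_admissible: "0 \<in> admissible"
proof -
  have "1 \<le> Mloc n K 0 20" by (rule Mloc_ge_1[OF K(1) k0]) simp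
  then show ?thesis
    by (cases "Mloc n K 0 20") (auto simp: admissible_def eln_def)
qed

text \<open>Admissibility gives \<open>N * \<delta>^2 / \<sigma>^2 \<le> L \<le> N\<close>. Without
  such a bound the real \<open>Sup\<close> would carry no information.\<close>

lemma bdd_admissible: "bdd_above admissible"
proof (rule bdd_aboveI[of _ \<sigma>])
  fix \<delta> assume \<delta>: "\<delta> \<in> admissible"
  show "\<delta> \<le> \<sigma>"
  proof (cases "\<delta> = 0")
    case False
    then have pos: "0 < \<delta>" using \<delta> by (simp add: admissible_def)
    obtain L where L: "Mloc n K \<delta> 20 = ereal (exp L)" "L \<le> real N / 400000" by (rule Mloc_eq_exp[OF pos])
    have "real N * \<delta>\<^sup>2 / \<sigma>\<^sup>2 \<le> real N * 1"
      using \<delta> L by (simp add: admissible_def eln_ereal_exp)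
    then have "real N * (\<delta>\<^sup>2 / \<sigma>\<^sup>2) \<le> real N * 1" by simp
    then have "\<delta>\<^sup>2 / \<sigma>\<^sup>2 \<le> 1" using N by (subst (asm) mult_le_cancel_left_pos) auto
    then have "\<delta>\<^sup>2 \<le> \<sigma>\<^sup>2" using \<sigma> by (simp add: divide_le_eq)
    then show ?thesis using \<sigma> by (simp add: power2_le_iff_abs_le)
  qed (use \<sigma> in simp)
qed

lemma admissible_le: "\<delta> \<in> admissible \<Longrightarrow> \<delta> \<le> \<delta>s"
  unfolding \<delta>s_eq by (rule cSup_upper[OF _ bdd_admissible])

lemma \<delta>s_nonneg: "0 \<le> \<delta>s"
  by (rule admissible_le[OF zero_admissible])

lemma \<rho>: "\<delta>s \<le> \<rho>" "\<epsilon> * \<sigma> \<le> \<rho>" "0 < \<rho>"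
  unfolding \<rho>_def using \<sigma> \<epsilon> by (auto simp: less_max_iff_disj)

lemma \<rho>_power2: "max (\<delta>s\<^sup>2) (\<epsilon>\<^sup>2 * \<sigma>\<^sup>2) = \<rho>\<^sup>2"
proof -
  have "0 \<le> \<epsilon> * \<sigma>" using \<epsilon> \<sigma> by simp
  then show ?thesis
    using \<delta>s_nonneg power_mono[of \<delta>s "\<epsilon> * \<sigma>" 2] power_mono[of "\<epsilon> * \<sigma>" \<delta>s 2]
    unfolding \<rho>_def power_mult_distrib[symmetric] by (auto simp: max_def)
qed

text \<open>A set reaching distance \<open>\<delta>\<close> has entropy above \<open>ln 2\<close>,
  which exceeds the variance term at this scale; the entropy hypothesis then also forces
  \<open>N\<close> to be large.\<close>

lemma admissibleI_far:
  assumes "0 < \<delta>" "x \<in> K" "\<delta> \<le> vdist n k0 x" "real N * \<delta>\<^sup>2 \<le> \<sigma>\<^sup>2 * ln 2"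
  shows "\<delta> \<in> admissible" "400000 * ln 2 \<le> real N"
proof -
  obtain L where L: "Mloc n K \<delta> 20 = ereal (exp L)" "L \<le> real N / 400000" by (rule Mloc_eq_exp[OF assms(1)])
  have "17 \<le> exp L" using Mloc_ge_17[OF K assms(2,3,1)] L(1) by simp
  then have "exp (ln 2) \<le> exp L" by simp
  then have ln2: "ln 2 \<le> L" by (simp only: exp_le_cancel_iff)
  have "real N * \<delta>\<^sup>2 / \<sigma>\<^sup>2 \<le> ln 2" using assms(4) \<sigma> by (simp add: divide_le_eq mult.commute)
  then show "\<delta> \<in> admissible" using ln2 L(1) assms(1) by (simp add: admissible_def eln_ereal_exp)
  show "400000 * ln 2 \<le> real N" using ln2 L(2) by simp
qed

lemma upper_bound:
  assumes far: "x \<in> K" "\<sigma>\<^sup>2 * ln 2 \<le> real N * (vdist n k0 x)\<^sup>2"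
  shows "minimax_sym n N K \<sigma> \<epsilon> \<le> ennreal (4 * upper_const * \<rho>\<^sup>2)"
proof -
  \<comment> \<open>The largest scale covered by \<open>admissibleI_far\<close>; its admissibility
    yields the lower bound on \<open>N * \<eta>^2\<close> that the risk bound needs.\<close>
  define \<delta> where "\<delta> = \<sigma> * sqrt (ln 2 / real N)"
  have \<delta>: "0 < \<delta>" "real N * \<delta>\<^sup>2 = \<sigma>\<^sup>2 * ln 2" using \<sigma> N by (auto simp: \<delta>_def power_mult_distrib)
  have "real N * \<delta>\<^sup>2 \<le> real N * (vdist n k0 x)\<^sup>2" using far(2) \<delta>(2) by simp
  then have "\<delta>\<^sup>2 \<le> (vdist n k0 x)\<^sup>2" using N by (subst (asm) mult_le_cancel_left_pos) auto
  then have "\<delta> \<le> vdist n k0 x" using \<delta>(1) by (simp add: power2_le_iff_abs_le)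
  note adm = admissibleI_far[OF \<delta>(1) far(1) this] 
  have \<delta>_le: "\<delta> \<le> \<rho>" using admissible_le[OF adm(1)] \<delta>(2) \<rho>(1) by simp
  define \<eta> where "\<eta> = 2 * \<rho>"
  have \<eta>: "0 < \<eta>" using \<rho> by (simp add: \<eta>_def)
  obtain L where L: "Mloc n K \<eta> 20 = ereal (exp L)" "L \<le> real N / 400000" by (rule Mloc_eq_exp[OF \<eta>])
  \<comment> \<open>Doubling puts \<open>\<eta>\<close> strictly beyond the supremum, so the entropy
    inequality reverses there, whether or not the supremum is attained.\<close>
  have "\<not> \<eta> \<le> \<delta>s" using \<rho> by (simp add: \<eta>_def)
  then have "\<eta> \<notin> admissible" using admissible_le by blast
  then have L_le: "L \<le> real N * \<eta>\<^sup>2 / \<sigma>\<^sup>2"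
    using \<eta> L(1) by (simp add: admissible_def eln_ereal_exp)
  have "minimax_sym n N K \<sigma> \<epsilon> \<le> ennreal (upper_const * \<eta>\<^sup>2)"
  proof (rule tournament_risk_le[OF \<sigma> \<epsilon> K _ \<eta> _ _ L_le L(2)])
    show "2 * \<epsilon> * \<sigma> \<le> \<eta>" using \<rho>(2) by (simp add: \<eta>_def)
    show "Mloc n K \<eta> 20 \<le> ereal (exp L)" using L by simp
    show "400000 * ln 2 \<le> real N" using adm(2) \<delta>(2) by simp
    have "\<sigma>\<^sup>2 * (8 / 3) \<le> \<sigma>\<^sup>2 * (4 * ln 2)" using ln2_ge_two_thirds by (intro mult_left_mono) auto
    also have "\<dots> = real N * (2 * \<delta>)\<^sup>2" using \<delta>(2) by (simp add: power_mult_distrib)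
    also have "\<dots> \<le> real N * \<eta>\<^sup>2" using \<delta>_le \<delta>(1) by (intro mult_left_mono power_mono) (auto simp: \<eta>_def)
    finally show "\<sigma>\<^sup>2 * (8 / 3) \<le> real N * \<eta>\<^sup>2" .
  qed simp
  then show ?thesis by (simp add: \<eta>_def power_mult_distrib algebra_simps)
qed

text \<open>If \<open>K\<close> does not reach the scale \<open>\<sigma> * sqrt (ln 2 / N)\<close>,
  a third of its diameter is admissible or zero, hence at most \<open>\<rho>\<close>, and the
  constant estimator already has the right risk.\<close>

lemma upper_bound_bounded:
  assumes b: "vbounded n K"
  shows "minimax_sym n N K \<sigma> \<epsilon> \<le> ennreal (4 * upper_const * min (\<rho>\<^sup>2) ((diam n K)\<^sup>2))"
proof -
  let ?d = "diam n K"
  have uc: "9 \<le> 4 * upper_const" by (simp add: upper_const_def)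
  have d0: "0 \<le> ?d" using vdist_le_diam[OF b k0 k0] by simp
  have le_d: "minimax_sym n N K \<sigma> \<epsilon> \<le> ennreal (?d\<^sup>2)" by (rule minimax_sym_le_diam[OF K(1) k0 b])
  show ?thesis
  proof (cases "\<exists>x\<in>K. \<sigma>\<^sup>2 * ln 2 \<le> real N * (vdist n k0 x)\<^sup>2")
    case True
    then have le_\<rho>: "minimax_sym n N K \<sigma> \<epsilon> \<le> ennreal (4 * upper_const * \<rho>\<^sup>2)" using upper_bound by blast
    show ?thesis
    proof (cases "\<rho>\<^sup>2 \<le> ?d\<^sup>2")
      case True then show ?thesis using le_\<rho> by (simp add: min_def)
    next
      case False
      have "1 * ?d\<^sup>2 \<le> 4 * upper_const * ?d\<^sup>2" using uc by (intro mult_right_mono) auto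
      then show ?thesis using False le_d by (auto simp: min_def intro: order_trans ennreal_leI)
    qed
  next
    case False
    have "?d / 3 \<le> \<rho>"
    proof (cases "?d = 0")
      case False
      then obtain x where x: "x \<in> K" "?d / 3 \<le> vdist n k0 x" using exists_far_point[OF k0] d0 by force
      have "real N * (?d / 3)\<^sup>2 \<le> real N * (vdist n k0 x)\<^sup>2"
        using x d0 by (intro mult_left_mono power_mono) auto
      also have "\<dots> \<le> \<sigma>\<^sup>2 * ln 2" using \<open>\<not> (\<exists>x\<in>K. _ x)\<close> x(1) by (meson less_imp_le not_le)
      finally have "?d / 3 \<in> admissible" using admissibleI_far(1)[OF _ x] d0 False by simp
      then show ?thesis using admissible_le \<rho>(1) by force
    qed (use \<rho> in simp)
    then have "(?d / 3)\<^sup>2 \<le> \<rho>\<^sup>2" using d0 by (intro power_mono) auto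
    then have "?d\<^sup>2 \<le> 9 * min (\<rho>\<^sup>2) (?d\<^sup>2)" by (simp add: power_divide min_def)
    also have "\<dots> \<le> 4 * upper_const * min (\<rho>\<^sup>2) (?d\<^sup>2)" using uc by (intro mult_right_mono) auto
    finally show ?thesis using le_d by (auto intro: order_trans ennreal_leI)
  qed
qed

lemma upper_bound_unbounded:
  assumes "\<not> vbounded n K"
  shows "minimax_sym n N K \<sigma> \<epsilon> \<le> ennreal (4 * upper_const * \<rho>\<^sup>2)"
proof -
  obtain x where x: "x \<in> K" "\<sigma> \<le> vdist n k0 x" using exists_far_unbounded[OF assms k0] by blast
  have "\<sigma>\<^sup>2 * ln 2 \<le> \<sigma>\<^sup>2 * real N"
    using N ln2_le_25_over_36 by (intro mult_left_mono) auto
  also have "\<dots> \<le> (vdist n k0 x)\<^sup>2 * real N" using x(2) \<sigma> by (intro mult_right_mono power_mono) auto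
  finally show ?thesis using x(1) by (intro upper_bound) (auto simp: mult.commute)
qed

lemma lower_bound_entropy:
  assumes x: "x \<in> K" and l: "0 < vdist n k0 x" and pos: "0 < \<delta>s"
  shows "ennreal ((min \<delta>s (vdist n k0 x))\<^sup>2 / 51200) \<le> minimax_sym n N K \<sigma> \<epsilon>"
proof -
  let ?l = "vdist n k0 x"
  obtain \<delta> where \<delta>: "\<delta> \<in> admissible" "\<delta>s / 2 < \<delta>"
    using less_cSup_iff[OF _ bdd_admissible, of "\<delta>s / 2"] zero_admissible pos \<delta>s_eq by force
  have \<delta>0: "0 < \<delta>" using \<delta>(2) pos by simp
  \<comment> \<open>Halving \<open>\<delta>\<close> divides the variance term by 4, while entropy
    can only grow; the cap at the distance to \<open>x\<close> makes the count of 17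
    available.\<close>
  define \<delta>' where "\<delta>' = min (\<delta> / 2) ?l"
  have \<delta>': "0 < \<delta>'" "\<delta>' \<le> \<delta> / 2" "\<delta>' \<le> ?l" "\<delta>' \<le> \<delta>" using \<delta>0 l by (auto simp: \<delta>'_def)
  obtain L where L: "Mloc n K \<delta> 20 = ereal (exp L)" by (rule Mloc_eq_exp[OF \<delta>0])
  obtain L' where L': "Mloc n K \<delta>' 20 = ereal (exp L')" by (rule Mloc_eq_exp[OF \<delta>'(1)])
  define a where "a = real N * \<delta>'\<^sup>2 / \<sigma>\<^sup>2"
  have a: "0 \<le> a" by (simp add: a_def)
  have "4 * a = real N * (2 * \<delta>')\<^sup>2 / \<sigma>\<^sup>2" by (simp add: a_def power_mult_distrib)
  also have "\<dots> \<le> real N * \<delta>\<^sup>2 / \<sigma>\<^sup>2"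
    using \<delta>' by (intro divide_right_mono mult_left_mono power_mono) auto
  also have "\<dots> \<le> L" using \<delta>(1) L by (simp add: admissible_def eln_ereal_exp)
  also have "L \<le> L'"
    using Mloc_antimono[OF K \<delta>'(1) \<delta>'(4), of 20] L L' by simp
  finally have aL: "4 * a \<le> L'" .
  have "17 \<le> exp L'" using Mloc_ge_17[OF K x \<delta>'(3,1)] L' by simp
  also have "exp L' = (exp (L' / 2))\<^sup>2" by (simp add: exp_double[symmetric])
  finally have "4\<^sup>2 < (exp (L' / 2))\<^sup>2" by simp
  then have 4: "4 < exp (L' / 2)" by (rule power2_less_imp_less) simp
  \<comment> \<open>Half of the entropy pays for the factor 4, and a quarter for
    \<open>exp a\<close>.\<close>
  have "4 * exp a < exp (L' / 2) * exp a" using 4 by simp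
  also have "\<dots> = exp (L' / 2 + a)" by (simp add: exp_add)
  also have "\<dots> \<le> exp L'" using aL a by simp
  finally have "ereal (4 * exp a) < Mloc n K \<delta>' 20" by (simp add: L')
  then obtain \<nu> S where S: "\<nu> \<in> K" "finite S" "S \<subseteq> K" "S \<subseteq> vcball n \<nu> \<delta>'" "separated n (\<delta>' / 20) S"
    "4 * exp a < real (card S)" by (rule less_Mloc_obtain)
  have "ennreal ((\<delta>' / 40)\<^sup>2 / 2) \<le> minimax_sym n N K \<sigma> \<epsilon>"
    using S \<epsilon> \<delta>' by (intro minimax_sym_ge_packing[OF \<sigma> _ _ K(1), where \<nu> = \<nu> and S = S and \<delta> = \<delta>']) (auto simp: a_def)
  \<comment> \<open>\<open>51200 = 4^2 * 40^2 * 2\<close>.\<close>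
  moreover have "(min \<delta>s ?l)\<^sup>2 / 51200 \<le> (\<delta>' / 40)\<^sup>2 / 2"
  proof -
    have "min \<delta>s ?l \<le> 4 * \<delta>'" using \<delta>(2) l by (auto simp: \<delta>'_def min_def)
    then have "(min \<delta>s ?l)\<^sup>2 \<le> (4 * \<delta>')\<^sup>2" using pos l by (intro power_mono) auto
    then show ?thesis by (simp add: power_mult_distrib power_divide)
  qed
  ultimately show ?thesis by (metis order_trans ennreal_leI)
qed

text \<open>The second hypothesis is placed on the segment from \<open>k0\<close> to
  \<open>x\<close>, at the largest distance allowed by both the segment and the adversary. The
  constant is weakened to match the entropy bound.\<close>

lemma lower_bound_contamination:
  assumes x: "x \<in> K" and l: "0 < vdist n k0 x"
  shows "ennreal ((min (\<epsilon> * \<sigma>) (vdist n k0 x))\<^sup>2 / 51200) \<le> minimax_sym n N K \<sigma> \<epsilon>"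
proof -
  let ?l = "vdist n k0 x"
  define h where "h = min (\<epsilon> * \<sigma> / 2) ?l"
  have h: "0 < h" "h \<le> \<epsilon> * \<sigma> / 2" "h \<le> ?l" using \<epsilon> \<sigma> l by (auto simp: h_def)
  define \<mu>1 where "\<mu>1 = vcomb n (h / ?l) k0 x"
  have "h / ?l \<in> {0..1}" using h l by auto
  then have \<mu>1: "\<mu>1 \<in> K" unfolding \<mu>1_def using K(2) x by (simp add: star_centre_def)
  have d: "vdist n k0 \<mu>1 = h" unfolding \<mu>1_def vdist_vcomb_centre using h l by simp
  have "ennreal (3 / 16 * h\<^sup>2) \<le> minimax_sym n N K \<sigma> \<epsilon>"
    using minimax_sym_ge_contamination[OF \<sigma> \<epsilon>(1) _ _ K(1) k0 \<mu>1, of N] \<epsilon> N h by (simp add: d)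
  moreover have "(min (\<epsilon> * \<sigma>) ?l)\<^sup>2 / 51200 \<le> 3 / 16 * h\<^sup>2"
  proof -
    have "min (\<epsilon> * \<sigma>) ?l \<le> 2 * h" using l by (auto simp: h_def min_def)
    then have "(min (\<epsilon> * \<sigma>) ?l)\<^sup>2 \<le> (2 * h)\<^sup>2" using \<epsilon> \<sigma> l by (intro power_mono) auto
    then have "(min (\<epsilon> * \<sigma>) ?l)\<^sup>2 \<le> 4 * h\<^sup>2" by (simp add: power_mult_distrib)
    then show ?thesis using zero_le_power2[of h] by linarith
  qed
  ultimately show ?thesis by (metis order_trans ennreal_leI)
qed

lemma lower_bound:
  assumes x: "x \<in> K" and l: "0 < vdist n k0 x"
  shows "ennreal ((min \<rho> (vdist n k0 x))\<^sup>2 / 51200) \<le> minimax_sym n N K \<sigma> \<epsilon>"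
proof (cases "\<delta>s \<le> \<epsilon> * \<sigma>")
  case True
  then show ?thesis using lower_bound_contamination[OF assms] by (simp add: \<rho>_def max_def)
next
  case False
  then have "0 < \<delta>s" using \<epsilon> \<sigma> by (meson less_trans mult_pos_pos not_le)
  then show ?thesis using lower_bound_entropy[OF assms] False by (simp add: \<rho>_def max_def)
qed

text \<open>A point at a third of the diameter from \<open>k0\<close> costs a factor 9, and
  \<open>460800 = 9 * 51200\<close>.\<close>

lemma lower_bound_bounded:
  assumes b: "vbounded n K"
  shows "ennreal (1 / 460800 * min (\<rho>\<^sup>2) ((diam n K)\<^sup>2)) \<le> minimax_sym n N K \<sigma> \<epsilon>"
proof (cases "diam n K = 0")
  case False
  let ?d = "diam n K"
  have d: "0 < ?d" using vdist_le_diam[OF b k0 k0] False by simp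
  obtain x where x: "x \<in> K" "?d / 3 \<le> vdist n k0 x" using exists_far_point[OF k0 d] by blast
  have "(min \<rho> ?d)\<^sup>2 \<le> (3 * min \<rho> (vdist n k0 x))\<^sup>2"
    using \<rho>(3) d x(2) by (intro power_mono) (auto simp: min_def)
  moreover have "min (\<rho>\<^sup>2) (?d\<^sup>2) \<le> (min \<rho> ?d)\<^sup>2" by (simp add: min_def)
  ultimately have "1 / 460800 * min (\<rho>\<^sup>2) (?d\<^sup>2) \<le> (min \<rho> (vdist n k0 x))\<^sup>2 / 51200"
    by (simp add: power_mult_distrib)
  then show ?thesis
    using d x(2) by (intro order_trans[OF ennreal_leI lower_bound[OF x(1)]]) auto
qed simp

lemma lower_bound_unbounded:
  assumes "\<not> vbounded n K"
  shows "ennreal (1 / 460800 * \<rho>\<^sup>2) \<le> minimax_sym n N K \<sigma> \<epsilon>"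
proof -
  obtain x where x: "x \<in> K" "\<rho> \<le> vdist n k0 x" using exists_far_unbounded[OF assms k0] by blast
  then have "ennreal (\<rho>\<^sup>2 / 51200) \<le> minimax_sym n N K \<sigma> \<epsilon>"
    using lower_bound[OF x(1)] \<rho>(3) by (simp add: min_def)
  moreover have "1 / 460800 * \<rho>\<^sup>2 \<le> \<rho>\<^sup>2 / 51200" by simp
  ultimately show ?thesis by (metis order_trans ennreal_leI)
qed

end

theorem mainTheorem3:
  "\<exists>c Q C0 c1 c2 :: real. c > 0 \<and> Q > 0 \<and> C0 > 0 \<and> c1 > 0 \<and> c2 > 0 \<and>
    (\<forall>n N K \<sigma> \<epsilon>. n \<ge> 1 \<longrightarrow> N \<ge> 1 \<longrightarrow> K \<subseteq> Rn n \<longrightarrow> star_shaped n K \<longrightarrow>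
       \<sigma> > 0 \<longrightarrow> 0 < \<epsilon> \<longrightarrow> \<epsilon> < 1 / Q \<longrightarrow>
       ereal (real N) \<ge> ereal C0 * (SUP \<delta> \<in> {0<..}. eln (Mloc n K \<delta> c)) \<longrightarrow>
       (let R = max ((delta_star n K c N \<sigma>)^2) (\<epsilon>^2 * \<sigma>^2) in
        (vbounded n K \<longrightarrow>
           ennreal (c1 * min R ((diam n K)^2)) \<le> minimax_sym n N K \<sigma> \<epsilon> \<and>
           minimax_sym n N K \<sigma> \<epsilon> \<le> ennreal (c2 * min R ((diam n K)^2))) \<and>
        (\<not> vbounded n K \<longrightarrow>
           ennreal (c1 * R) \<le> minimax_sym n N K \<sigma> \<epsilon> \<and>
           minimax_sym n N K \<sigma> \<epsilon> \<le> ennreal (c2 * R))))"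
proof (rule exI[of _ 20], rule exI[of _ 24], rule exI[of _ 400000], rule exI[of _ "1 / 460800"],
    rule exI[of _ "4 * upper_const"], intro conjI allI impI)
  show "0 < 4 * upper_const" by (simp add: upper_const_def)
  fix n N :: nat and K and \<sigma> \<epsilon> :: real
  assume *: "1 \<le> n" "1 \<le> N" "K \<subseteq> Rn n" "star_shaped n K" "0 < \<sigma>" "0 < \<epsilon>" "\<epsilon> < 1 / 24"
    "ereal 400000 * (SUP \<delta> \<in> {0<..}. eln (Mloc n K \<delta> 20)) \<le> ereal (real N)"
  then obtain k0 where "star_centre n K k0" by (auto simp: star_shaped_centre)
  then interpret minimax_setting n N K \<sigma> \<epsilon> k0 using * by unfold_locales auto
  show "let R = max ((delta_star n K 20 N \<sigma>)^2) (\<epsilon>^2 * \<sigma>^2) in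
        (vbounded n K \<longrightarrow>
           ennreal (1 / 460800 * min R ((diam n K)^2)) \<le> minimax_sym n N K \<sigma> \<epsilon> \<and>
           minimax_sym n N K \<sigma> \<epsilon> \<le> ennreal (4 * upper_const * min R ((diam n K)^2))) \<and>
        (\<not> vbounded n K \<longrightarrow>
           ennreal (1 / 460800 * R) \<le> minimax_sym n N K \<sigma> \<epsilon> \<and>
           minimax_sym n N K \<sigma> \<epsilon> \<le> ennreal (4 * upper_const * R))"
    unfolding Let_def \<delta>s_def[symmetric] \<rho>_power2
    using lower_bound_bounded lower_bound_unbounded upper_bound_bounded upper_bound_unbounded by blast
qed simp_all

end
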